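(* Let $A\in\mathbb{R}^{m\times n}$ with $m\ge n$ have singular value decomposition $A=U\Sigma V^T$ with singular values $\sigma_1\ge\cdots\ge\sigma_n$, and let $b$ be a block size, $q\ge0$ an integer and $\ell\ge2$. Let $Q_{[\ell-1]}=[Q_1\ \cdots\ Q_{\ell-1}]$ ($Q_i\in\mathbb{R}^{m\times b}$) be the orthonormal-column matrix produced after $\ell-1$ block steps of the blarank or sblarank algorithm (described in the context), $\mathcal{P}_{\ell-1}^\perp=I-Q_{[\ell-1]}Q_{[\ell-1]}^T$, and $B=\mathcal{P}_{\ell-1}^\perp A$ with singular value decomposition $B=\widetilde U\widetilde\Sigma\widetilde V^T$ and singular values $\widetilde\sigma_1\ge\widetilde\sigma_2\ge\cdots\ge\widetilde\sigma_n$. Let $\Omega_\ell$ be an $n\times b$ standard Gaussian matrix, $Q_\ell={\sf orth}((BB^T)^qB\Omega_\ell)$, $Q_{[\ell]}=[Q_{[\ell-1]}\ Q_\ell]$ and $\mathcal{P}_\ell^\perp=I-Q_{[\ell]}Q_{[\ell]}^T$. Partition $\widetilde V^T\Omega_\ell=\begin{bmatrix}\widetilde\Omega_1\\ \widetilde\Omega_2\end{bmatrix}$ with $\widetilde\Omega_1\in\mathbb{R}^{b\times b}$ assumed nonsingular, and let $\widetilde\Sigma_{(b)\perp}$ be the trailing diagonal block of $\widetilde\Sigma$ containing $\widetilde\sigma_{b+1},\dots,\widetilde\sigma_n$. Let $U_{[\ell-1]}$ be the first $b(\ell-1)$ columns of $U$. If \[\epsilon_{\ell-1}=\mathbf{d}(\mathcal{R}(Q_{[\ell-1]}),\mathcal{R}(U_{[\ell-1]}))<1\quad\text{and}\quad\sigma_{b\ell}-\sigma_{b\ell+1}>2\epsilon_{\ell-1}\|A\|_2,\]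 then: (i) $|\widetilde\sigma_j-\sigma_{b(\ell-1)+j}|\le\epsilon_{\ell-1}\|A\|_2$ for $j=1,\dots,n-b(\ell-1)$, and $\widetilde\sigma_j\le\epsilon_{\ell-1}\|A\|_2$ for $j=n-b(\ell-1)+1,\dots,n$; (ii) $\tilde\tau_b:=\dfrac{\widetilde\sigma_{b+1}}{\widetilde\sigma_b}\le\dfrac{\sigma_{b\ell+1}+\epsilon_{\ell-1}\|A\|_2}{\sigma_{b\ell}-\epsilon_{\ell-1}\|A\|_2}<1$; (iii) for $0<\delta<1$, with probability at least $1-\delta$, for $\xi\in\{2,F\}$, \[\|\mathcal{P}_\ell^\perp A\|_{\xi}\le\big(1+\tilde\tau_b^{4q}\|\widetilde\Omega_2\widetilde\Omega_1^{-1}\|_2^2\big)^{1/2}\|\widetilde\Sigma_{(b)\perp}\|_{\xi}\le\big(1+\tilde\tau_b^{4q}\mathcal{C}_{\delta,b,b}^2\big)^{1/2}\|\widetilde\Sigma_{(b)\perp}\|_{\xi},\] where $\mathcal{C}_{\delta,b,b}=2e\sqrt b\,\frac{2}{\delta}\big(\sqrt{n-b}+\sqrt b+\sqrt{2\log(2/\delta)}\big)$; (iv) for $j=1,\dots,b$, \[\widetilde\sigma_j\ge\sigma_j(Q_\ell^TA)\ge\frac{\widetilde\sigma_j}{\sqrt{1+\|\widetilde\Omega_2\|_2^2\|\widetilde\Omega_1^{-1}\|_2^2\big(\widetilde\sigma_{b+1}/\widetilde\sigma_j\big)^{4q+2}}}.\]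
   Context: $\sigma_j(M)$ is the $j$-th largest singular value; $\|\cdot\|_2,\|\cdot\|_F$ spectral and Frobenius norms. For orthonormal-column $W,Z$, $\mathbf{d}(\mathcal{R}(W),\mathcal{R}(Z))=\|(I-ZZ^T)WW^T\|_2$. ${\sf orth}(Y)$ denotes an orthonormal basis of $\mathcal{R}(Y)$ (thin QR factor). The blarank algorithm with block size $b$ and power parameter $q$: start with $Q=[\ ]$; at step $i$, draw an $n\times b$ standard Gaussian $\Omega_i$, set $Y_0={\sf orth}(A\Omega_i)$; for $j=1,\dots,q$: $Y_{j-1}:=Y_{j-1}-Q(Q^TY_{j-1})$, $Z={\sf orth}(A^TY_{j-1})$, $Y_j={\sf orth}(AZ)$; then $\widehat Q_i={\sf orth}(Y_q-Q(Q^TY_q))$ (in sblarank this orthogonalization against $Q$ is performed twice); compute eigenvectors $\widehat U_i$ of $\widehat Q_i^TAA^T\widehat Q_i$ ordered by decreasing eigenvalue, replace $\widehat Q_i$ by $\widehat Q_i\widehat U_i$; set $Q_i={\sf orth}((I-QQ^T)\widehat Q_i)$ and $Q:=[Q\ Q_i]$. A standard Gaussian matrix has i.i.d. $N(0,1)$ entries. *)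

theory Defs
  imports "Jordan_Normal_Form.Matrix" "HOL-Probability.Probability"
begin

definition vnorm :: "real Matrix.vec \<Rightarrow> real" where
  "vnorm x = sqrt (\<Sum>i<dim_vec x. (x $ i)\<^sup>2)"

definition spec_norm :: "real mat \<Rightarrow> real" where
  "spec_norm M = Sup (insert 0 ((\<lambda>x. vnorm (M *\<^sub>v x)) ` {x \<in> carrier_vec (dim_col M). vnorm x = 1}))"

definition frob_norm :: "real mat \<Rightarrow> real" where
  "frob_norm M = sqrt (\<Sum>i<dim_row M. \<Sum>j<dim_col M. (M $$ (i,j))\<^sup>2)"

definition orthonormal_cols :: "real mat \<Rightarrow> bool" where
  "orthonormal_cols Q \<longleftrightarrow> Q\<^sup>T * Q = 1\<^sub>m (dim_col Q)"

definition colsp :: "real mat \<Rightarrow> real Matrix.vec set" where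
  "colsp M = {M *\<^sub>v x | x. x \<in> carrier_vec (dim_col M)}"

definition orth :: "real mat \<Rightarrow> real mat" where
  "orth Y = (SOME Q. dim_row Q = dim_row Y \<and> orthonormal_cols Q \<and> colsp Q = colsp Y)"

definition hcat :: "real mat \<Rightarrow> real mat \<Rightarrow> real mat" where
  "hcat X Y = Matrix.mat (dim_row X) (dim_col X + dim_col Y)
     (\<lambda>(i,j). if j < dim_col X then X $$ (i,j) else Y $$ (i, j - dim_col X))"

definition first_cols :: "nat \<Rightarrow> real mat \<Rightarrow> real mat" where
  "first_cols k M = Matrix.mat (dim_row M) k (\<lambda>(i,j). M $$ (i,j))"

definition first_rows :: "nat \<Rightarrow> real mat \<Rightarrow> real mat" where
  "first_rows k M = Matrix.mat k (dim_col M) (\<lambda>(i,j). M $$ (i,j))"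

definition rows_from :: "nat \<Rightarrow> real mat \<Rightarrow> real mat" where
  "rows_from k M = Matrix.mat (dim_row M - k) (dim_col M) (\<lambda>(i,j). M $$ (i + k, j))"

definition trailing_block :: "nat \<Rightarrow> real mat \<Rightarrow> real mat" where
  "trailing_block k M = Matrix.mat (dim_row M - k) (dim_col M - k) (\<lambda>(i,j). M $$ (i + k, j + k))"

definition mat_inv :: "real mat \<Rightarrow> real mat" where
  "mat_inv M = (SOME N. inverts_mat M N \<and> inverts_mat N M)"

definition is_svd :: "real mat \<Rightarrow> real mat \<Rightarrow> real mat \<Rightarrow> real mat \<Rightarrow> bool" where
  "is_svd M U S V \<longleftrightarrow>
     (let m = dim_row M; n = dim_col M in
       U \<in> carrier_mat m m \<and> U\<^sup>T * U = 1\<^sub>m m \<and>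
       V \<in> carrier_mat n n \<and> V\<^sup>T * V = 1\<^sub>m n \<and>
       S \<in> carrier_mat m n \<and>
       (\<forall>i<m. \<forall>j<n. i \<noteq> j \<longrightarrow> S $$ (i,j) = 0) \<and>
       (\<forall>i<min m n. 0 \<le> S $$ (i,i)) \<and>
       (\<forall>i j. i \<le> j \<longrightarrow> j < min m n \<longrightarrow> S $$ (j,j) \<le> S $$ (i,i)) \<and>
       M = U * S * V\<^sup>T)"

text \<open>sigma_j(M), j-th largest singular value (1-based); convention: 0 for j outside 1..min(m,n).\<close>
definition sval :: "real mat \<Rightarrow> nat \<Rightarrow> real" where
  "sval M j = (if 1 \<le> j \<and> j \<le> min (dim_row M) (dim_col M)
     then (SOME s. \<exists>U S V. is_svd M U S V \<and> s = S $$ (j - 1, j - 1)) else 0)"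

text \<open>d(R(W),R(Z)) = || (I - Z Z^T) W W^T ||_2 for orthonormal-column W, Z.\<close>
definition subspace_dist :: "real mat \<Rightarrow> real mat \<Rightarrow> real" where
  "subspace_dist W Z = spec_norm ((1\<^sub>m (dim_row Z) - Z * Z\<^sup>T) * (W * W\<^sup>T))"

fun pow_iter :: "real mat \<Rightarrow> real mat \<Rightarrow> real mat \<Rightarrow> nat \<Rightarrow> real mat" where
  "pow_iter A Q Y 0 = Y"
| "pow_iter A Q Y (Suc j) =
     (let Y' = pow_iter A Q Y j; Y'' = Y' - Q * (Q\<^sup>T * Y') in orth (A * orth (A\<^sup>T * Y'')))"

text \<open>Hat Q_i before the eigenvector rotation; flag sbl = True for sblarank
  (orthogonalization against Q performed twice).\<close>
definition qhat :: "bool \<Rightarrow> real mat \<Rightarrow> nat \<Rightarrow> real mat \<Rightarrow> real mat \<Rightarrow> real mat" where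
  "qhat sbl A q Q \<Omega> =
     (let Y = pow_iter A Q (orth (A * \<Omega>)) q;
          W = Y - Q * (Q\<^sup>T * Y);
          W' = (if sbl then W - Q * (Q\<^sup>T * W) else W)
      in orth W')"

definition ordered_eigvecs :: "real mat \<Rightarrow> real mat \<Rightarrow> bool" where
  "ordered_eigvecs M Uh \<longleftrightarrow>
     (let k = dim_row M in
       Uh \<in> carrier_mat k k \<and> Uh\<^sup>T * Uh = 1\<^sub>m k \<and>
       (\<forall>i<k. \<forall>j<k. i \<noteq> j \<longrightarrow> (Uh\<^sup>T * M * Uh) $$ (i,j) = 0) \<and>
       (\<forall>i j. i \<le> j \<longrightarrow> j < k \<longrightarrow> (Uh\<^sup>T * M * Uh) $$ (j,j) \<le> (Uh\<^sup>T * M * Uh) $$ (i,i)))"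

text \<open>blarank_run sbl A b q k Q: Q is a possible output of k block steps of
  blarank (sbl = False) or sblarank (sbl = True), for some realisation of the
  Gaussian draws Omega_i (n x b) and some admissible choice of eigenvector bases.\<close>
inductive blarank_run :: "bool \<Rightarrow> real mat \<Rightarrow> nat \<Rightarrow> nat \<Rightarrow> nat \<Rightarrow> real mat \<Rightarrow> bool"
  for sbl A b q where
  start: "blarank_run sbl A b q 0 (0\<^sub>m (dim_row A) 0)"
| step: "\<lbrakk> blarank_run sbl A b q k Q; \<Omega> \<in> carrier_mat (dim_col A) b;
           Qh = qhat sbl A q Q \<Omega>;
           ordered_eigvecs (Qh\<^sup>T * A * A\<^sup>T * Qh) Uh;
           Qi = orth ((1\<^sub>m (dim_row A) - Q * Q\<^sup>T) * (Qh * Uh)) \<rbrakk>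
         \<Longrightarrow> blarank_run sbl A b q (Suc k) (hcat Q Qi)"

definition gauss_space :: "nat \<Rightarrow> nat \<Rightarrow> (nat \<times> nat \<Rightarrow> real) measure" where
  "gauss_space n b = PiM ({0..<n} \<times> {0..<b}) (\<lambda>_. density lborel std_normal_density)"

definition gauss_mat :: "nat \<Rightarrow> nat \<Rightarrow> (nat \<times> nat \<Rightarrow> real) \<Rightarrow> real mat" where
  "gauss_mat n b \<omega> = Matrix.mat n b \<omega>"

end

theory Submission
  imports Defs "Jordan_Normal_Form.Spectral_Radius"
begin

text \<open>The singular values of the deflated matrix are controlled from both sides by dimension counts
  (min-max): from below because the deflation has rank \<open>b (l - 1)\<close>, from above because
  the two subspaces have the same dimension, so that their distance is symmetric. The columns
  of the sketch span a graph over the leading left singular vectors of \<open>B\<close>; subtracting from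
  \<open>B x\<close> a suitable vector of this graph leaves \<open>S Z x\<close>, where \<open>S\<close> is the trailing block of
  singular values and \<open>Z\<close> has the asserted norm, and the same graph gives the lower bounds on the
  singular values of the compression.

  For the tail bound write \<open>X\<close> for the quotient of the two blocks of the rotated Gaussian
  matrix and take independent standard normal vectors \<open>h\<close>, \<open>g\<close>. For fixed \<open>h\<close>, \<open>g\<close> rotation
  invariance makes \<open>h \<bullet> X g\<close> equal in law to \<open>|h| |g|\<close> times one entry of \<open>X\<close>, a
  ratio of two independent normal variables; for fixed \<open>X\<close> the form exceeds a quarter of the norm of
  \<open>X\<close> with probability at least 9/25. Markov's inequality then bounds the probability that
  the norm of \<open>X\<close> is large, with no need for an estimate of the norm of either block.\<close>

unbundle no vec_syntax and no inner_syntax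
hide_const (open) Finite_Cartesian_Product.vec Finite_Cartesian_Product.mat Determinants.det
  Finite_Cartesian_Product.row Finite_Cartesian_Product.column Finite_Cartesian_Product.transpose
  Inner_Product.real_inner_class.inner
hide_type (open) Finite_Cartesian_Product.vec

section \<open>Euclidean and matrix norms\<close>

text \<open>Neither singular values nor \<open>orth\<close> are computed: both are choices
  constrained by a specification. Hence existence of a decomposition and uniqueness of its diagonal
  precede everything else, and the sketch enters only through the column space of its basis, whose
  number of columns is the rank of the sketch and need not be tracked. In the tail bound the norm of
  the quotient, the inverse block and \<open>orth\<close> are never shown measurable; instead a
  measurable set \<open>E\<close> of good draws is placed inside the event. The bilinear form is
  multiplied by the determinant and written with cofactors, which makes it a polynomial in the
  entries. The constants: the ratio of normals has tail (4/5)/t, detection happens at a quarter of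
  the norm with probability (3/5)^2, and E|h| E|g| <= sqrt(b (n-b)). Markov therefore gives (25/9)
  (4/5) 4 = 80/9 times sqrt(b (n-b)) / C. The stated constant is at least 9 sqrt(b (n-b)) / delta
  because 4 e >= 9, so the other terms in its bracket are slack.\<close>

lemma vnorm_nonneg [simp]: "0 \<le> vnorm x"
  by (simp add: vnorm_def sum_nonneg)

lemma vnorm_sq: "(vnorm x)\<^sup>2 = (\<Sum>i<dim_vec x. (x $ i)\<^sup>2)"
  by (simp add: vnorm_def sum_nonneg)

lemma vnorm_sq_scalar_prod: "(vnorm x)\<^sup>2 = x \<bullet> x"
  unfolding vnorm_sq scalar_prod_def by (simp add: power2_eq_square atLeast0LessThan)

lemma vnorm_L2_set: "vnorm x = L2_set (\<lambda>i. x $ i) {..<dim_vec x}"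
  by (simp add: vnorm_def L2_set_def)

lemma vnorm_add:
  assumes "x \<in> carrier_vec n" "y \<in> carrier_vec n"
  shows "vnorm (x + y) \<le> vnorm x + vnorm y"
proof -
  have "vnorm (x + y) = L2_set (\<lambda>i. x $ i + y $ i) {..<n}"
    unfolding vnorm_L2_set using assms by (auto intro!: L2_set_cong)
  thus ?thesis
    using L2_set_triangle_ineq[of "\<lambda>i. x $ i" "\<lambda>i. y $ i" "{..<n}"] assms
    by (simp add: vnorm_L2_set)
qed

lemma scalar_prod_le_vnorm:
  assumes "x \<in> carrier_vec n" "y \<in> carrier_vec n"
  shows "\<bar>x \<bullet> y\<bar> \<le> vnorm x * vnorm y"
proof -
  have "\<bar>x \<bullet> y\<bar> \<le> (\<Sum>i<n. \<bar>x $ i\<bar> * \<bar>y $ i\<bar>)"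
    unfolding scalar_prod_def using assms
    by (auto simp: atLeast0LessThan abs_mult[symmetric] intro: sum_abs)
  also have "\<dots> \<le> L2_set (\<lambda>i. x $ i) {..<n} * L2_set (\<lambda>i. y $ i) {..<n}"
    by (rule L2_set_mult_ineq)
  finally show ?thesis using assms by (simp add: vnorm_L2_set)
qed

lemma vnorm_smult [simp]: "vnorm (a \<cdot>\<^sub>v x) = \<bar>a\<bar> * vnorm x"
  by (simp add: vnorm_def power_mult_distrib sum_distrib_left[symmetric] real_sqrt_mult)

lemma vnorm_zero [simp]: "vnorm (0\<^sub>v n) = 0"
  by (simp add: vnorm_def)

lemma vnorm_eq_0:
  assumes "x \<in> carrier_vec n" 
  shows "vnorm x = 0 \<longleftrightarrow> x = 0\<^sub>v n"
proof
  assume "vnorm x = 0"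
  hence "(\<Sum>i<n. (x $ i)\<^sup>2) = 0" using assms vnorm_sq[of x] by simp
  hence "\<forall>i<n. x $ i = 0" by (subst (asm) sum_nonneg_eq_0_iff) auto
  thus "x = 0\<^sub>v n" using assms by (intro eq_vecI) auto
qed simp

lemma scalar_prod_adjoint:
  fixes M :: "real mat"
  assumes "M \<in> carrier_mat p r" "x \<in> carrier_vec r" "y \<in> carrier_vec p"
  shows "(M *\<^sub>v x) \<bullet> y = x \<bullet> (M\<^sup>T *\<^sub>v y)"
proof -
  have "(M *\<^sub>v x) \<bullet> y = y \<bullet> (M *\<^sub>v x)"
    using assms by (intro comm_scalar_prod[of _ p]) auto
  also have "\<dots> = (M\<^sup>T *\<^sub>v y) \<bullet> x"
    using assms by (simp add: transpose_vec_mult_scalar)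
  also have "\<dots> = x \<bullet> (M\<^sup>T *\<^sub>v y)"
    using assms by (intro comm_scalar_prod[of _ r]) auto
  finally show ?thesis .
qed

lemma orthonormal_cols_mult_vec:
  assumes "Q \<in> carrier_mat p r" "orthonormal_cols Q" "x \<in> carrier_vec r"
  shows "Q\<^sup>T *\<^sub>v (Q *\<^sub>v x) = x"
proof -
  have "Q\<^sup>T *\<^sub>v (Q *\<^sub>v x) = (Q\<^sup>T * Q) *\<^sub>v x"
    using assms by (intro assoc_mult_mat_vec[symmetric]) auto
  also have "\<dots> = x" using assms by (simp only: orthonormal_cols_def) simp
  finally show ?thesis .
qed

lemma vnorm_orthonormal_cols:
  assumes "Q \<in> carrier_mat p r" "orthonormal_cols Q" "x \<in> carrier_vec r"
  shows "vnorm (Q *\<^sub>v x) = vnorm x"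
proof -
  have "(vnorm (Q *\<^sub>v x))\<^sup>2 = (vnorm x)\<^sup>2"
    unfolding vnorm_sq_scalar_prod using assms
    by (subst scalar_prod_adjoint[of _ p r]) (auto simp: orthonormal_cols_mult_vec)
  thus ?thesis by (simp add: power2_eq_iff_nonneg)
qed

lemma orthogonal_mat_transpose:
  assumes "U \<in> carrier_mat p p" "orthonormal_cols U"
  shows "U * U\<^sup>T = 1\<^sub>m p" "orthonormal_cols (U\<^sup>T)"
proof -
  show "U * U\<^sup>T = 1\<^sub>m p"
    using assms mat_mult_left_right_inverse[of "U\<^sup>T" p U] by (simp add: orthonormal_cols_def)
  thus "orthonormal_cols (U\<^sup>T)" using assms by (simp add: orthonormal_cols_def)
qed

section \<open>Kernel vectors from counting equations\<close>

lemma exists_kernel_vec: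
  fixes R :: "'a::field mat"
  assumes R: "R \<in> carrier_mat p k" and "p < k"
  shows "\<exists>c\<in>carrier_vec k. c \<noteq> 0\<^sub>v k \<and> R *\<^sub>v c = 0\<^sub>v p"
proof -
  \<comment> \<open>Zero rows pad \<open>R\<close> to a square matrix; since \<open>p < k\<close>
    the last row vanishes, and expanding along it gives determinant zero.\<close>
  define R' where "R' = mat k k (\<lambda>(i,j). if i < p then R $$ (i,j) else 0)"
  have R': "R' \<in> carrier_mat k k" by (simp add: R'_def)
  have "det R' = 0"
    using laplace_expansion_row[OF R', of "k - 1"] \<open>p < k\<close> by (simp add: R'_def)
  then obtain c where c: "c \<in> carrier_vec k" "c \<noteq> 0\<^sub>v k" "R' *\<^sub>v c = 0\<^sub>v k"
    using det_0_iff_vec_prod_zero_field[OF R'] by auto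
  have "R *\<^sub>v c = 0\<^sub>v p"
  proof (intro eq_vecI)
    fix i assume i: "i < dim_vec (0\<^sub>v p :: 'a vec)"
    hence "(R *\<^sub>v c) $ i = (R' *\<^sub>v c) $ i"
      using R c(1) \<open>p < k\<close> by (auto simp: R'_def scalar_prod_def intro!: sum.cong)
    thus "(R *\<^sub>v c) $ i = 0\<^sub>v p $ i" using c i \<open>p < k\<close> by simp
  qed (use R in auto)
  thus ?thesis using c by auto
qed

lemma exists_common_kernel_vec:
  fixes R R' :: "'a::field mat"
  assumes R: "R \<in> carrier_mat p k" "R' \<in> carrier_mat p' k" and "p + p' < k"
  shows "\<exists>c\<in>carrier_vec k. c \<noteq> 0\<^sub>v k \<and> R *\<^sub>v c = 0\<^sub>v p \<and> R' *\<^sub>v c = 0\<^sub>v p'"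
proof -
  have "R @\<^sub>r R' \<in> carrier_mat (p + p') k" using R by (rule carrier_append_rows)
  from exists_kernel_vec[OF this \<open>p + p' < k\<close>] obtain c where
    c: "c \<in> carrier_vec k" "c \<noteq> 0\<^sub>v k" "(R @\<^sub>r R') *\<^sub>v c = 0\<^sub>v (p + p')" by auto
  have e: "(R @\<^sub>r R') *\<^sub>v c = (R *\<^sub>v c) @\<^sub>v (R' *\<^sub>v c)" using R c by (intro mat_mult_append)
  have "0\<^sub>v (p + p') = 0\<^sub>v p @\<^sub>v (0\<^sub>v p' :: 'a vec)" by (intro eq_vecI) auto
  with c(3) e have "R *\<^sub>v c = 0\<^sub>v p \<and> R' *\<^sub>v c = 0\<^sub>v p'"
    using append_vec_eq[of "R *\<^sub>v c" p "0\<^sub>v p"] R by (metis mult_mat_vec_carrier c(1) zero_carrier_vec)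
  thus ?thesis using c by auto
qed

section \<open>Spectral and Frobenius norms\<close>

lemma vnorm_mult_bounded:
  fixes M :: "real mat"
  assumes "x \<in> carrier_vec (dim_col M)"
  shows "vnorm (M *\<^sub>v x) \<le> frob_norm M * vnorm x"
proof -
  have "(vnorm (M *\<^sub>v x))\<^sup>2 = (\<Sum>i<dim_row M. (row M i \<bullet> x)\<^sup>2)"
    by (simp add: vnorm_sq)
  also have "\<dots> \<le> (\<Sum>i<dim_row M. (vnorm (row M i))\<^sup>2 * (vnorm x)\<^sup>2)"
  proof (intro sum_mono)
    fix i
    have "\<bar>row M i \<bullet> x\<bar> \<le> vnorm (row M i) * vnorm x"
      using assms by (intro scalar_prod_le_vnorm[of _ "dim_col M"]) auto
    from power_mono[OF this, of 2] 
    show "(row M i \<bullet> x)\<^sup>2 \<le> (vnorm (row M i))\<^sup>2 * (vnorm x)\<^sup>2"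
      by (simp add: power_mult_distrib)
  qed
  also have "\<dots> = (frob_norm M * vnorm x)\<^sup>2"
    by (simp add: frob_norm_def power_mult_distrib sum_nonneg sum_distrib_right vnorm_sq)
  finally show ?thesis
    by (rule power2_le_imp_le) (simp add: frob_norm_def sum_nonneg)
qed

text \<open>The supremum in \<open>spec_norm\<close> is meaningful only over a bounded set; the
  Frobenius norm, through Cauchy-Schwarz on each row, supplies the bound.\<close>

lemma spec_norm_bdd:
  "bdd_above (insert 0 ((\<lambda>x. vnorm (M *\<^sub>v x)) ` {x \<in> carrier_vec (dim_col M). vnorm x = 1}))"
proof -
  have "vnorm (M *\<^sub>v x) \<le> frob_norm M" if "x \<in> carrier_vec (dim_col M)" "vnorm x = 1" for x
    using vnorm_mult_bounded[OF that(1)] that(2) by simp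
  thus ?thesis by (intro bdd_aboveI[of _ "max 0 (frob_norm M)"]) (auto simp: le_max_iff_disj)
qed

lemma spec_norm_nonneg [simp]: "0 \<le> spec_norm M"
  unfolding spec_norm_def by (rule cSup_upper[OF _ spec_norm_bdd]) simp

lemma vnorm_mult_le:
  assumes "M \<in> carrier_mat p r" "x \<in> carrier_vec r"
  shows "vnorm (M *\<^sub>v x) \<le> spec_norm M * vnorm x"
proof (cases "vnorm x = 0")
  case True
  hence "x = 0\<^sub>v r" using assms vnorm_eq_0 by blast
  moreover have "M *\<^sub>v 0\<^sub>v r = 0\<^sub>v p" using assms(1) by (intro eq_vecI) auto
  ultimately show ?thesis by simp
next
  case False
  define y where "y = (1 / vnorm x) \<cdot>\<^sub>v x"
  have y: "y \<in> carrier_vec r" "vnorm y = 1" using assms False by (auto simp: y_def)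
  have "M *\<^sub>v y = (1 / vnorm x) \<cdot>\<^sub>v (M *\<^sub>v x)"
    unfolding y_def by (rule mult_mat_vec[OF assms])
  hence "vnorm (M *\<^sub>v x) / vnorm x = vnorm (M *\<^sub>v y)" by simp
  also have "\<dots> \<le> spec_norm M"
    unfolding spec_norm_def using y assms by (intro cSup_upper[OF _ spec_norm_bdd]) auto
  finally have "vnorm (M *\<^sub>v x) / vnorm x \<le> spec_norm M" .
  moreover have "0 < vnorm x" using False vnorm_nonneg[of x] by linarith
  ultimately show ?thesis by (simp add: divide_le_eq)
qed

lemma spec_norm_le:
  assumes "M \<in> carrier_mat p r" "0 \<le> t" "\<And>x. x \<in> carrier_vec r \<Longrightarrow> vnorm (M *\<^sub>v x) \<le> t * vnorm x"
  shows "spec_norm M \<le> t"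
  unfolding spec_norm_def
proof (rule cSup_least)
  fix z assume "z \<in> insert 0 ((\<lambda>x. vnorm (M *\<^sub>v x)) ` {x \<in> carrier_vec (dim_col M). vnorm x = 1})"
  then consider "z = 0" | x where "x \<in> carrier_vec r" "vnorm x = 1" "z = vnorm (M *\<^sub>v x)"
    using assms(1) by auto
  thus "z \<le> t" using assms(2,3) by cases fastforce+
qed simp

text \<open>With z = M^T y one has |z|^2 = (M z) . y, which is at most the norm of \<open>M\<close>
  times |z| |y|; cancelling |z| leaves the claim.\<close>

lemma spec_norm_transpose_le:
  assumes "M \<in> carrier_mat p r"
  shows "spec_norm (M\<^sup>T) \<le> spec_norm M"
proof (rule spec_norm_le)
  show "M\<^sup>T \<in> carrier_mat r p" using assms by simp
  fix y :: "real vec" assume y: "y \<in> carrier_vec p"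
  let ?z = "M\<^sup>T *\<^sub>v y"
  have z: "?z \<in> carrier_vec r" using assms y by (auto intro!: mult_mat_vec_carrier)
  have "(vnorm ?z)\<^sup>2 = (M *\<^sub>v ?z) \<bullet> y"
    using assms y z by (simp add: vnorm_sq_scalar_prod scalar_prod_adjoint)
  also have "\<dots> \<le> vnorm (M *\<^sub>v ?z) * vnorm y"
    using scalar_prod_le_vnorm[of "M *\<^sub>v ?z" p y] assms y z by auto
  also have "\<dots> \<le> (spec_norm M * vnorm ?z) * vnorm y"
    by (intro mult_right_mono vnorm_mult_le[OF assms z]) simp
  finally have le: "vnorm ?z * vnorm ?z \<le> (spec_norm M * vnorm y) * vnorm ?z"
    by (simp add: power2_eq_square mult_ac)
  show "vnorm ?z \<le> spec_norm M * vnorm y"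
  proof (cases "vnorm ?z = 0")
    case False
    hence "0 < vnorm ?z" using vnorm_nonneg[of ?z] by linarith
    with le show ?thesis by (rule mult_right_le_imp_le)
  qed simp
qed simp

lemma spec_norm_mult:
  assumes "M \<in> carrier_mat p r" "N \<in> carrier_mat r s"
  shows "spec_norm (M * N) \<le> spec_norm M * spec_norm N"
proof (rule spec_norm_le)
  fix x :: "real vec" assume x: "x \<in> carrier_vec s"
  have "vnorm (M * N *\<^sub>v x) = vnorm (M *\<^sub>v (N *\<^sub>v x))" using assms x by simp
  also have "\<dots> \<le> spec_norm M * (spec_norm N * vnorm x)"
    using assms x by (intro order_trans[OF vnorm_mult_le] mult_left_mono vnorm_mult_le) auto
  finally show "vnorm (M * N *\<^sub>v x) \<le> spec_norm M * spec_norm N * vnorm x" by (simp add: mult_ac)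
qed (use assms in auto)

lemma frob_norm_nonneg [simp]: "0 \<le> frob_norm M"
  by (simp add: frob_norm_def sum_nonneg)

lemma frob_norm_sq_cols:
  "(frob_norm M)\<^sup>2 = (\<Sum>j<dim_col M. (vnorm (col M j))\<^sup>2)"
  by (simp add: frob_norm_def vnorm_sq sum_nonneg) (rule sum.swap)

lemma frob_norm_sq_rows:
  "(frob_norm M)\<^sup>2 = (\<Sum>i<dim_row M. (vnorm (row M i))\<^sup>2)"
  by (simp add: frob_norm_def vnorm_sq sum_nonneg)

text \<open>The spectral norm controls each column of the product, and the squared Frobenius norm is
  the sum over columns. The mirrored bound follows by transposition.\<close>

lemma frob_norm_mult_left:
  assumes "M \<in> carrier_mat p r" "N \<in> carrier_mat r s"
  shows "frob_norm (M * N) \<le> spec_norm M * frob_norm N"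
proof (rule power2_le_imp_le)
  have "(frob_norm (M * N))\<^sup>2 = (\<Sum>j<s. (vnorm (M *\<^sub>v col N j))\<^sup>2)"
    unfolding frob_norm_sq_cols using assms by (intro sum.cong) (auto simp: col_mult2[OF assms] simp del: col_mult)
  also have "\<dots> \<le> (\<Sum>j<s. (spec_norm M)\<^sup>2 * (vnorm (col N j))\<^sup>2)"
  proof (intro sum_mono)
    fix j assume "j \<in> {..<s}"
    hence "vnorm (M *\<^sub>v col N j) \<le> spec_norm M * vnorm (col N j)"
      using assms by (intro vnorm_mult_le) auto
    from power_mono[OF this, of 2]
    show "(vnorm (M *\<^sub>v col N j))\<^sup>2 \<le> (spec_norm M)\<^sup>2 * (vnorm (col N j))\<^sup>2"
      by (simp add: power_mult_distrib)
  qed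
  also have "\<dots> = (spec_norm M * frob_norm N)\<^sup>2"
    using assms by (simp add: power_mult_distrib frob_norm_sq_cols sum_distrib_left)
  finally show "(frob_norm (M * N))\<^sup>2 \<le> (spec_norm M * frob_norm N)\<^sup>2" .
qed simp

lemma frob_norm_transpose: "frob_norm (M\<^sup>T) = frob_norm M"
proof -
  have "(frob_norm (M\<^sup>T))\<^sup>2 = (frob_norm M)\<^sup>2"
    by (subst frob_norm_sq_rows, subst frob_norm_sq_cols) auto
  thus ?thesis by (simp add: power2_eq_iff_nonneg)
qed

lemma frob_norm_mult_right:
  assumes "M \<in> carrier_mat p r" "N \<in> carrier_mat r s"
  shows "frob_norm (M * N) \<le> frob_norm M * spec_norm N"
proof -
  have "frob_norm (M * N) = frob_norm (N\<^sup>T * M\<^sup>T)"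
    using assms by (metis frob_norm_transpose transpose_mult)
  also have "\<dots> \<le> spec_norm (N\<^sup>T) * frob_norm (M\<^sup>T)"
    using assms by (intro frob_norm_mult_left[of _ s r _ p]) auto
  also have "\<dots> \<le> spec_norm N * frob_norm M"
    unfolding frob_norm_transpose by (intro mult_right_mono spec_norm_transpose_le[OF assms(2)]) simp
  finally show ?thesis by (simp add: mult_ac)
qed

text \<open>Pythagoras for the orthogonal projection onto the range of \<open>Q\<close>. It converts
  a short residual into a long projection and back, which is how \<open>subspace_dist\<close> is
  exploited later.\<close>

lemma orthonormal_cols_complement_sq:
  assumes Q: "Q \<in> carrier_mat p r" "orthonormal_cols Q" and x: "x \<in> carrier_vec p"
  shows "(vnorm (x - Q *\<^sub>v (Q\<^sup>T *\<^sub>v x)))\<^sup>2 = (vnorm x)\<^sup>2 - (vnorm (Q\<^sup>T *\<^sub>v x))\<^sup>2"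
proof -
  let ?y = "Q\<^sup>T *\<^sub>v x"
  have y: "?y \<in> carrier_vec r" and Qy: "Q *\<^sub>v ?y \<in> carrier_vec p"
    using Q x by (auto intro!: mult_mat_vec_carrier)
  have e: "(Q *\<^sub>v ?y) \<bullet> x = ?y \<bullet> ?y" using Q x y by (simp add: scalar_prod_adjoint)
  have e2: "(Q *\<^sub>v ?y) \<bullet> (Q *\<^sub>v ?y) = ?y \<bullet> ?y"
    using vnorm_orthonormal_cols[OF Q y] by (metis vnorm_sq_scalar_prod)
  have e3: "x \<bullet> (Q *\<^sub>v ?y) = ?y \<bullet> ?y" using e x Qy by (simp add: comm_scalar_prod[of x p])
  show ?thesis
    unfolding vnorm_sq_scalar_prod using x Qy e e2 e3
    by (simp add: minus_scalar_prod_distrib[of _ p] scalar_prod_minus_distrib[of _ p])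
qed

section \<open>Singular values\<close>

text \<open>Extending the diagonal by zero gives a decreasing nonnegative sequence on all of
  \<open>nat\<close>, so most index ranges disappear from the min-max arguments. Indices start at 0
  here and at 1 in \<open>sval\<close>.\<close>

definition svd_diag :: "real mat \<Rightarrow> nat \<Rightarrow> real" where
  "svd_diag S i = (if i < min (dim_row S) (dim_col S) then S $$ (i,i) else 0)"

lemma is_svdD:
  assumes "is_svd M U S V" "M \<in> carrier_mat p r"
  shows "U \<in> carrier_mat p p" "orthonormal_cols U" "V \<in> carrier_mat r r" "orthonormal_cols V"
    "S \<in> carrier_mat p r" "M = U * S * V\<^sup>T" 
    "\<And>i j. i < p \<Longrightarrow> j < r \<Longrightarrow> S $$ (i,j) = (if i = j then svd_diag S i else 0)"
    "0 \<le> svd_diag S i" "i \<le> j \<Longrightarrow> svd_diag S j \<le> svd_diag S i"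
  using assms by (auto simp: is_svd_def Let_def orthonormal_cols_def svd_diag_def)

text \<open>The diagonal \<open>d\<close> is arbitrary because the lemma also serves the trailing
  block and the scaling matrix of a sketch.\<close>

lemma svd_diag_mult_vec:
  assumes "S \<in> carrier_mat p r" "y \<in> carrier_vec r" "i < p"
    and "\<And>i j. i < p \<Longrightarrow> j < r \<Longrightarrow> S $$ (i,j) = (if i = j then d i else 0)"
  shows "(S *\<^sub>v y) $ i = (if i < r then d i * y $ i else 0)"
proof -
  have "(S *\<^sub>v y) $ i = (\<Sum>j<r. S $$ (i,j) * y $ j)"
    using assms by (auto simp: scalar_prod_def atLeast0LessThan)
  also have "\<dots> = (\<Sum>j<r. if i = j then d i * y $ i else 0)"
    using assms by (intro sum.cong) auto
  finally show ?thesis by simp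
qed

text \<open>In the coordinates V^T x the map is diagonal up to an isometry, so norms become weighted
  sums of squares and the bounds below reduce to comparing weights.\<close>

lemma vnorm_sq_svd:
  assumes "is_svd M U S V" "M \<in> carrier_mat p r" "x \<in> carrier_vec r"
  shows "(vnorm (M *\<^sub>v x))\<^sup>2 = (\<Sum>i<r. (svd_diag S i)\<^sup>2 * ((V\<^sup>T *\<^sub>v x) $ i)\<^sup>2)"
    and "(vnorm x)\<^sup>2 = (\<Sum>i<r. ((V\<^sup>T *\<^sub>v x) $ i)\<^sup>2)"
proof -
  note D = is_svdD[OF assms(1,2)]
  let ?y = "V\<^sup>T *\<^sub>v x"
  have y: "?y \<in> carrier_vec r" using D assms(3) by (auto intro!: mult_mat_vec_carrier)
  have Sy: "S *\<^sub>v ?y \<in> carrier_vec p" using D y by (auto intro!: mult_mat_vec_carrier)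
  have "M *\<^sub>v x = U * S *\<^sub>v ?y"
    unfolding D(6) using D assms(3) by (intro assoc_mult_mat_vec) auto
  also have "\<dots> = U *\<^sub>v (S *\<^sub>v ?y)" using D y by (intro assoc_mult_mat_vec) auto
  finally have "vnorm (M *\<^sub>v x) = vnorm (S *\<^sub>v ?y)"
    using vnorm_orthonormal_cols[OF D(1,2) Sy] by simp
  hence "(vnorm (M *\<^sub>v x))\<^sup>2 = (\<Sum>i<p. ((S *\<^sub>v ?y) $ i)\<^sup>2)"
    by (simp only: vnorm_sq carrier_vecD[OF Sy])
  also have "\<dots> = (\<Sum>i<p. if i < r then (svd_diag S i)\<^sup>2 * (?y $ i)\<^sup>2 else 0)"
    using svd_diag_mult_vec[OF D(5) y _ D(7)] by (intro sum.cong) (auto simp: power_mult_distrib)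
  also have "\<dots> = (\<Sum>i<min p r. (svd_diag S i)\<^sup>2 * (?y $ i)\<^sup>2)"
    by (intro sum.mono_neutral_cong_right) auto
  also have "\<dots> = (\<Sum>i<r. (svd_diag S i)\<^sup>2 * (?y $ i)\<^sup>2)"
    using D(5) by (intro sum.mono_neutral_left) (auto simp: svd_diag_def)
  finally show "(vnorm (M *\<^sub>v x))\<^sup>2 = (\<Sum>i<r. (svd_diag S i)\<^sup>2 * (?y $ i)\<^sup>2)" .
  have "vnorm x = vnorm ?y"
    using vnorm_orthonormal_cols[OF _ orthogonal_mat_transpose(2)[OF D(3,4)] assms(3)] D(3) by auto
  thus "(vnorm x)\<^sup>2 = (\<Sum>i<r. (?y $ i)\<^sup>2)" by (simp only: vnorm_sq carrier_vecD[OF y])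
qed

lemma svd_upper:
  assumes svd: "is_svd M U S V" "M \<in> carrier_mat p r" "x \<in> carrier_vec r"
    and z: "\<And>i. i < k \<Longrightarrow> i < r \<Longrightarrow> (V\<^sup>T *\<^sub>v x) $ i = 0"
  shows "vnorm (M *\<^sub>v x) \<le> svd_diag S k * vnorm x"
proof (rule power2_le_imp_le)
  note D = is_svdD[OF svd(1,2)]
  have "(\<Sum>i<r. (svd_diag S i)\<^sup>2 * ((V\<^sup>T *\<^sub>v x) $ i)\<^sup>2)
      \<le> (\<Sum>i<r. (svd_diag S k)\<^sup>2 * ((V\<^sup>T *\<^sub>v x) $ i)\<^sup>2)"
  proof (intro sum_mono)
    fix i assume "i \<in> {..<r}"
    thus "(svd_diag S i)\<^sup>2 * ((V\<^sup>T *\<^sub>v x) $ i)\<^sup>2 \<le> (svd_diag S k)\<^sup>2 * ((V\<^sup>T *\<^sub>v x) $ i)\<^sup>2"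
      using z[of i] D(8,9) by (cases "i < k") (auto intro!: mult_right_mono power_mono)
  qed
  thus "(vnorm (M *\<^sub>v x))\<^sup>2 \<le> (svd_diag S k * vnorm x)\<^sup>2"
    by (simp add: vnorm_sq_svd[OF svd] power_mult_distrib sum_distrib_left)
qed (simp add: is_svdD(8)[OF svd(1,2)])

lemma svd_lower:
  assumes svd: "is_svd M U S V" "M \<in> carrier_mat p r" "x \<in> carrier_vec r"
    and z: "\<And>i. k < i \<Longrightarrow> i < r \<Longrightarrow> (V\<^sup>T *\<^sub>v x) $ i = 0"
  shows "svd_diag S k * vnorm x \<le> vnorm (M *\<^sub>v x)"
proof (rule power2_le_imp_le)
  note D = is_svdD[OF svd(1,2)]
  have "(\<Sum>i<r. (svd_diag S k)\<^sup>2 * ((V\<^sup>T *\<^sub>v x) $ i)\<^sup>2)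
      \<le> (\<Sum>i<r. (svd_diag S i)\<^sup>2 * ((V\<^sup>T *\<^sub>v x) $ i)\<^sup>2)"
  proof (intro sum_mono)
    fix i assume "i \<in> {..<r}"
    thus "(svd_diag S k)\<^sup>2 * ((V\<^sup>T *\<^sub>v x) $ i)\<^sup>2 \<le> (svd_diag S i)\<^sup>2 * ((V\<^sup>T *\<^sub>v x) $ i)\<^sup>2"
      using z[of i] D(8,9) by (cases "k < i") (auto intro!: mult_right_mono power_mono)
  qed
  thus "(svd_diag S k * vnorm x)\<^sup>2 \<le> (vnorm (M *\<^sub>v x))\<^sup>2"
    by (simp add: vnorm_sq_svd[OF svd] power_mult_distrib sum_distrib_left)
qed simp

lemma first_rows_mult_vec:
  assumes "M \<in> carrier_mat p r" "x \<in> carrier_vec r" "i < k" "k \<le> p"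
  shows "(first_rows k M *\<^sub>v x) $ i = (M *\<^sub>v x) $ i"
  using assms by (auto simp: first_rows_def scalar_prod_def intro!: sum.cong)

lemma first_rows_carrier: "M \<in> carrier_mat p r \<Longrightarrow> first_rows k M \<in> carrier_mat k r"
  by (auto simp: first_rows_def)

lemma first_rows_zeroD:
  assumes "M \<in> carrier_mat p r" "x \<in> carrier_vec r" "first_rows k M *\<^sub>v x = 0\<^sub>v k" "i < k" "k \<le> p"
  shows "(M *\<^sub>v x) $ i = 0"
  using first_rows_mult_vec[OF assms(1,2,4,5)] assms(3,4) by (metis index_zero_vec(1))

section \<open>Min-max and uniqueness of singular values\<close>

text \<open>Max-min half of Courant-Fischer. \<open>W\<close> parametrises a
  \<open>k\<close>-dimensional test space and \<open>N\<close> cuts it by \<open>s\<close>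
  equations. Orthogonality to the first \<open>j\<close> right singular vectors adds at most
  \<open>j\<close> more, and \<open>s + j < k\<close> leaves a nonzero vector on which both bounds
  meet. Keeping the equations \<open>N\<close> separate spares choosing a basis of the cut
  space.\<close>

lemma svd_maxmin:
  assumes svd: "is_svd M U S V" "M \<in> carrier_mat p r"
    and W: "W \<in> carrier_mat r k" "\<And>c. c \<in> carrier_vec k \<Longrightarrow> c \<noteq> 0\<^sub>v k \<Longrightarrow> W *\<^sub>v c \<noteq> 0\<^sub>v r"
    and N: "N \<in> carrier_mat s k" "s + j < k"
    and t: "\<And>c. c \<in> carrier_vec k \<Longrightarrow> N *\<^sub>v c = 0\<^sub>v s \<Longrightarrow> t * vnorm (W *\<^sub>v c) \<le> vnorm (M *\<^sub>v (W *\<^sub>v c))"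
  shows "t \<le> svd_diag S j"
proof -
  note D = is_svdD[OF svd]
  \<comment> \<open>For \<open>j \<ge> r\<close> there are only \<open>r\<close> right singular
    vectors to be orthogonal to.\<close>
  define j' where "j' = min j r"
  define R where "R = first_rows j' (V\<^sup>T) * W"
  have R: "R \<in> carrier_mat j' k" using D(3) W(1) by (auto simp: R_def first_rows_def)
  have jk: "s + j' < k" using N(2) by (simp add: j'_def)
  obtain c where c: "c \<in> carrier_vec k" "c \<noteq> 0\<^sub>v k" "N *\<^sub>v c = 0\<^sub>v s" "R *\<^sub>v c = 0\<^sub>v j'"
    using exists_common_kernel_vec[OF N(1) R jk] by blast
  let ?x = "W *\<^sub>v c"
  have x: "?x \<in> carrier_vec r" using W c by auto
  have "R *\<^sub>v c = first_rows j' (V\<^sup>T) *\<^sub>v ?x"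
    unfolding R_def using D(3) W(1) c(1)
    by (intro assoc_mult_mat_vec[of _ j' r _ k] first_rows_carrier) auto
  hence R0: "first_rows j' (V\<^sup>T) *\<^sub>v ?x = 0\<^sub>v j'" using c(4) by simp
  have "(V\<^sup>T *\<^sub>v ?x) $ i = 0" if "i < j" "i < r" for i
    using first_rows_zeroD[OF _ x R0, of r i] D(3) that by (auto simp: j'_def)
  hence "vnorm (M *\<^sub>v ?x) \<le> svd_diag S j * vnorm ?x"
    using svd_upper[OF svd x] by blast
  with t[OF c(1,3)] have "t * vnorm ?x \<le> svd_diag S j * vnorm ?x" by linarith
  moreover have "0 < vnorm ?x"
    using W(2)[OF c(1,2)] vnorm_eq_0[OF x] vnorm_nonneg[of ?x] by linarith
  ultimately show ?thesis by simp
qed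

text \<open>Min-max half of Courant-Fischer. The span of the first \<open>Suc j\<close> right
  singular vectors has more dimensions than \<open>N\<close> has equations, and every vector in it
  is stretched by at least \<open>svd_diag S j\<close>.\<close>

lemma svd_minmax:
  assumes svd: "is_svd M U S V" "M \<in> carrier_mat p r"
    and N: "N \<in> carrier_mat s r" "s \<le> j" and t0: "0 \<le> t"
    and t: "\<And>x. x \<in> carrier_vec r \<Longrightarrow> N *\<^sub>v x = 0\<^sub>v s \<Longrightarrow> vnorm (M *\<^sub>v x) \<le> t * vnorm x"
  shows "svd_diag S j \<le> t"
proof (cases "j < r")
  case False
  thus ?thesis using t0 is_svdD(5)[OF svd] by (simp add: svd_diag_def)
next
  case True
  note D = is_svdD[OF svd]
  \<comment> \<open>\<open>V * E\<close> consists of the first \<open>j + 1\<close> columns of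
    \<open>V\<close>; the extra column beats the at most \<open>j\<close> equations.\<close>
  define E where "E = mat r (Suc j) (\<lambda>(i,k). if i = k then 1 else (0::real))"
  have E: "E \<in> carrier_mat r (Suc j)" by (simp add: E_def)
  have VE: "V * E \<in> carrier_mat r (Suc j)" using D(3) E by simp
  have NVE: "N * (V * E) \<in> carrier_mat s (Suc j)" using N(1) VE by simp
  obtain c where c: "c \<in> carrier_vec (Suc j)" "c \<noteq> 0\<^sub>v (Suc j)" "N * (V * E) *\<^sub>v c = 0\<^sub>v s"
    using exists_kernel_vec[OF NVE] N(2) by auto
  define x where "x = V *\<^sub>v (E *\<^sub>v c)"
  have Ec: "E *\<^sub>v c \<in> carrier_vec r" using E c by auto
  have x: "x \<in> carrier_vec r" using D(3) Ec by (auto simp: x_def)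
  have Eci: "(E *\<^sub>v c) $ i = (if i \<le> j then c $ i else 0)" if "i < r" for i
  proof -
    have "(E *\<^sub>v c) $ i = (\<Sum>k\<in>{..<Suc j}. (if i = k then 1 else 0) * c $ k)"
      unfolding E_def using that c(1)
      by (simp add: scalar_prod_def atLeast0LessThan del: sum.lessThan_Suc)
    also have "\<dots> = (\<Sum>k\<in>{..<Suc j}. if k = i then c $ k else 0)"
      by (intro sum.cong) auto
    also have "\<dots> = (if i \<in> {..<Suc j} then c $ i else 0)" by (rule sum.delta) simp
    finally show ?thesis by auto
  qed
  have Vx: "V\<^sup>T *\<^sub>v x = E *\<^sub>v c" unfolding x_def by (rule orthonormal_cols_mult_vec[OF D(3,4) Ec])
  have "E *\<^sub>v c \<noteq> 0\<^sub>v r"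
  proof
    assume *: "E *\<^sub>v c = 0\<^sub>v r"
    have "c $ i = 0" if "i < Suc j" for i
      using Eci[of i] * True that by simp
    hence "c = 0\<^sub>v (Suc j)" using c(1) by (intro eq_vecI) auto
    thus False using c by simp
  qed
  hence x0: "0 < vnorm x" unfolding x_def vnorm_orthonormal_cols[OF D(3,4) Ec]
    using vnorm_eq_0[OF Ec] vnorm_nonneg[of "E *\<^sub>v c"] by linarith
  have "N *\<^sub>v x = N *\<^sub>v (V * E *\<^sub>v c)"
    by (simp only: x_def assoc_mult_mat_vec[OF D(3) E c(1)])
  also have "\<dots> = 0\<^sub>v s" by (simp only: assoc_mult_mat_vec[OF N(1) VE c(1), symmetric] c(3))
  finally have "vnorm (M *\<^sub>v x) \<le> t * vnorm x" using t x by blast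
  moreover have "svd_diag S j * vnorm x \<le> vnorm (M *\<^sub>v x)"
    by (rule svd_lower[OF svd x]) (simp only: Vx Eci, simp)
  ultimately have "svd_diag S j * vnorm x \<le> t * vnorm x" by linarith
  thus ?thesis using x0 by (rule mult_right_le_imp_le)
qed

text \<open>The space orthogonal to the first \<open>j\<close> right singular vectors of one
  decomposition is a test space for the other, so min-max gives the inequality in both
  directions.\<close>

lemma svd_unique:
  assumes "is_svd M U S V" "is_svd M U' S' V'"
  shows "svd_diag S j = svd_diag S' j"
proof -
  have le: "svd_diag S j \<le> svd_diag S' j"
    if svd: "is_svd M U S V" "is_svd M U' S' V'" for U S V U' S' V'
  proof (cases "j < dim_col M")
    case True
    have M: "M \<in> carrier_mat (dim_row M) (dim_col M)" by simp
    note D = is_svdD[OF svd(2) M]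
    show ?thesis
    proof (rule svd_minmax[OF svd(1) M, of "first_rows j (V'\<^sup>T)" j])
      show "first_rows j (V'\<^sup>T) \<in> carrier_mat j (dim_col M)"
        using D(3) by (intro first_rows_carrier) auto
      fix x :: "real vec"
      assume x: "x \<in> carrier_vec (dim_col M)" "first_rows j (V'\<^sup>T) *\<^sub>v x = 0\<^sub>v j"
      have "(V'\<^sup>T *\<^sub>v x) $ i = 0" if "i < j" for i
        using first_rows_zeroD[OF _ x(1) x(2), of "dim_col M" i] D(3) that True by auto
      thus "vnorm (M *\<^sub>v x) \<le> svd_diag S' j * vnorm x"
        by (intro svd_upper[OF svd(2) M x(1)])
    qed (use D(8) in auto)
  next
    case False
    thus ?thesis using is_svdD(5)[OF svd(1), of "dim_row M" "dim_col M"]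
        is_svdD(5)[OF svd(2), of "dim_row M" "dim_col M"] by (simp add: svd_diag_def)
  qed
  show ?thesis using le[OF assms] le[OF assms(2,1)] by simp
qed

text \<open>Uniqueness makes the choice in \<open>sval\<close> harmless: any decomposition may be
  used to evaluate it. Out of range both sides default to zero.\<close>

lemma sval_eq_svd_diag:
  assumes "is_svd M U S V"
  shows "sval M (Suc j) = svd_diag S j"
proof -
  have S: "S \<in> carrier_mat (dim_row M) (dim_col M)" by (rule is_svdD(5)[OF assms carrier_matI[OF refl refl]])
  show ?thesis
  proof (cases "Suc j \<le> min (dim_row M) (dim_col M)")
    case True
    have "(SOME s. \<exists>U S V. is_svd M U S V \<and> s = S $$ (j, j)) = svd_diag S j"
    proof (rule some_equality)
      have "svd_diag S j = S $$ (j,j)" using True S by (simp add: svd_diag_def)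
      thus "\<exists>U S' V. is_svd M U S' V \<and> svd_diag S j = S' $$ (j, j)" using assms by metis
      fix s assume "\<exists>U S V. is_svd M U S V \<and> s = S $$ (j, j)"
      then obtain U' S' V' where s: "is_svd M U' S' V'" "s = S' $$ (j,j)" by metis
      have "S' \<in> carrier_mat (dim_row M) (dim_col M)"
        by (rule is_svdD(5)[OF s(1) carrier_matI[OF refl refl]])
      hence "s = svd_diag S' j" unfolding s(2) using True by (simp add: svd_diag_def)
      thus "s = svd_diag S j" by (simp only: svd_unique[OF assms s(1)])
    qed
    hence "sval M (Suc j) = svd_diag S j" unfolding sval_def using True
      by (simp only: diff_Suc_1) simp
    thus ?thesis .
  next
    case False
    thus ?thesis using S by (auto simp: sval_def svd_diag_def)
  qed
qed

lemma is_svd_transpose: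
  assumes "is_svd M U S V"
  shows "is_svd (M\<^sup>T) V (S\<^sup>T) U"
proof -
  have M: "M \<in> carrier_mat (dim_row M) (dim_col M)" by simp
  note D = is_svdD[OF assms M]
  have "M\<^sup>T = (U * S * V\<^sup>T)\<^sup>T" using D(6) by (rule arg_cong)
  also have "\<dots> = V * (U * S)\<^sup>T"
    using D(1,3,5) by (subst transpose_mult[of _ "dim_row M" "dim_col M" _ "dim_col M"]) auto
  also have "\<dots> = V * (S\<^sup>T * U\<^sup>T)"
    using D(1,3,5) by (subst transpose_mult[of _ "dim_row M" "dim_row M" _ "dim_col M"]) auto
  also have "\<dots> = V * S\<^sup>T * U\<^sup>T" using D(1,3,5) by (intro assoc_mult_mat[symmetric]) auto
  finally have MT: "M\<^sup>T = V * S\<^sup>T * U\<^sup>T" .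
  have S: "dim_row S = dim_row M" "dim_col S = dim_col M" using D(5) by auto
  have d: "(S\<^sup>T) $$ (i,i) = svd_diag S i" if "i < dim_row M" "i < dim_col M" for i
    using that S by (simp add: svd_diag_def)
  show ?thesis
    unfolding is_svd_def Let_def index_transpose_mat(2,3)
  proof (intro conjI allI impI)
    show "U\<^sup>T * U = 1\<^sub>m (dim_row M)" "V\<^sup>T * V = 1\<^sub>m (dim_col M)"
      using D(1-4) by (auto simp: orthonormal_cols_def)
    show "(S\<^sup>T) $$ (i,j) = 0" if "i < dim_col M" "j < dim_row M" "i \<noteq> j" for i j
      using that S D(7)[of j i] by simp
    show "0 \<le> (S\<^sup>T) $$ (i,i)" if "i < min (dim_col M) (dim_row M)" for i
      using that d[of i] D(8) by simp
    show "(S\<^sup>T) $$ (j,j) \<le> (S\<^sup>T) $$ (i,i)" if "i \<le> j" "j < min (dim_col M) (dim_row M)" for i j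
      using that d[of i] d[of j] D(9) by simp
    show "M\<^sup>T = V * S\<^sup>T * U\<^sup>T" by (fact MT)
  qed (use D(1,3,5) in auto)
qed

section \<open>Existence of the singular value decomposition\<close>

lemma exists_max_on_sphere:
  fixes M :: "real mat"
  assumes M: "M \<in> carrier_mat p r" and "0 < r"
  shows "\<exists>v\<in>carrier_vec r. vnorm v = 1 \<and> (\<forall>x\<in>carrier_vec r. vnorm (M *\<^sub>v x) \<le> vnorm (M *\<^sub>v v) * vnorm x)"
proof -
  \<comment> \<open>Vectors are encoded as functions on all of \<open>nat\<close> with the
    coordinates from \<open>r\<close> on pinned to zero, so that the box is a product of compact
    sets and Tychonoff applies. Cutting it with the closed set where \<open>G\<close> equals 1 gives
    a compact sphere.\<close>
  define I :: "nat \<Rightarrow> real set" where "I = (\<lambda>i. if i < r then {-1..1} else {0})"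
  define F :: "(nat \<Rightarrow> real) \<Rightarrow> real" where "F f = (\<Sum>i<p. (\<Sum>j<r. M $$ (i,j) * f j)\<^sup>2)" for f
  define G :: "(nat \<Rightarrow> real) \<Rightarrow> real" where "G f = (\<Sum>j<r. (f j)\<^sup>2)" for f
  have vn: "(vnorm (vec r f))\<^sup>2 = G f" for f
    by (simp add: vnorm_sq G_def)
  have Mvn: "(vnorm (M *\<^sub>v vec r f))\<^sup>2 = F f" for f
    using M by (simp add: vnorm_sq F_def scalar_prod_def atLeast0LessThan)
  have "compactin (product_topology (\<lambda>i. euclidean) UNIV) (PiE UNIV I)"
    by (simp add: compactin_PiE I_def)
  hence cP: "compact (PiE UNIV I)"
    by (simp add: euclidean_product_topology)
  have cont: "continuous_on UNIV (\<lambda>f :: nat \<Rightarrow> real. f j)" for j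
    by (rule continuous_on_product_coordinates)
  have contG: "continuous_on UNIV G" unfolding G_def
    by (intro continuous_intros continuous_on_subset[OF cont]) auto
  have contF: "continuous_on UNIV F" unfolding F_def
    by (intro continuous_intros continuous_on_subset[OF cont]) auto
  have "closed (G -` {1})" using contG by (intro continuous_closed_vimage) (auto simp: continuous_on_eq_continuous_at)
  hence cK: "compact (PiE UNIV I \<inter> G -` {1})" by (rule compact_Int_closed[OF cP])
  have mem: "(\<lambda>i. if i < r then x $ i else 0) \<in> PiE UNIV I \<inter> G -` {1}"
    if "x \<in> carrier_vec r" "vnorm x = 1" for x
  proof -
    have s: "(\<Sum>j<r. (x $ j)\<^sup>2) = 1" using that vnorm_sq[of x] by simp
    have "\<bar>x $ i\<bar> \<le> 1" if "i < r" for i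
    proof -
      have "(x $ i)\<^sup>2 \<le> (\<Sum>j<r. (x $ j)\<^sup>2)" using that by (intro member_le_sum) auto
      thus ?thesis using s by (simp add: abs_square_le_1)
    qed
    thus ?thesis using s by (auto simp: I_def G_def abs_le_iff)
  qed
  have "vnorm (unit_vec r 0 :: real vec) = 1"
  proof -
    have "(vnorm (unit_vec r 0 :: real vec))\<^sup>2 = (\<Sum>i<r. if i = 0 then 1 else 0)"
      unfolding vnorm_sq by (intro sum.cong) (auto simp: unit_vec_def)
    also have "\<dots> = 1" using \<open>0 < r\<close> by simp
    finally show ?thesis by (metis real_sqrt_unique real_sqrt_one vnorm_nonneg)
  qed
  hence ne: "PiE UNIV I \<inter> G -` {1} \<noteq> {}" using mem[of "unit_vec r 0"] by auto
  obtain f where f: "f \<in> PiE UNIV I \<inter> G -` {1}" "\<And>g. g \<in> PiE UNIV I \<inter> G -` {1} \<Longrightarrow> F g \<le> F f"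
    using continuous_attains_sup[OF cK ne continuous_on_subset[OF contF]] by auto
  define v where "v = vec r f"
  have v: "v \<in> carrier_vec r" by (simp add: v_def)
  have v1: "vnorm v = 1" using vn[of f] f(1) real_sqrt_unique[of "vnorm v" "G f"] by (simp add: v_def)
  have unit: "vnorm (M *\<^sub>v x) \<le> vnorm (M *\<^sub>v v)" if x: "x \<in> carrier_vec r" "vnorm x = 1" for x
  proof (rule power2_le_imp_le)
    let ?g = "\<lambda>i. if i < r then x $ i else 0"
    have "x = vec r ?g" using x by (intro eq_vecI) auto
    thus "(vnorm (M *\<^sub>v x))\<^sup>2 \<le> (vnorm (M *\<^sub>v v))\<^sup>2"
      using f(2)[OF mem[OF x]] Mvn[of ?g] Mvn[of f] by (metis v_def)
  qed simp
  have "vnorm (M *\<^sub>v x) \<le> vnorm (M *\<^sub>v v) * vnorm x" if x: "x \<in> carrier_vec r" for x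
  proof -
    have "spec_norm M \<le> vnorm (M *\<^sub>v v)"
      unfolding spec_norm_def using M unit by (intro cSup_least) auto
    thus ?thesis using vnorm_mult_le[OF M x] by (meson mult_right_mono order_trans vnorm_nonneg)
  qed
  thus ?thesis using v v1 by auto
qed

text \<open>The reflection that exchanges \<open>v\<close> with the multiple of the first unit
  vector of equal length. Symmetry is recorded because it makes the reflection its own inverse. It
  serves twice: to split off a singular value, and later to rotate Gaussian blocks.\<close>

lemma householder:
  fixes v :: "real vec"
  assumes v: "v \<in> carrier_vec r" and "0 < r"
  shows "\<exists>H\<in>carrier_mat r r. orthonormal_cols H \<and> H\<^sup>T = H \<and> H *\<^sub>v v = vnorm v \<cdot>\<^sub>v unit_vec r 0"
proof -
  \<comment> \<open>\<open>w\<close> is the normal v - |v| e_0 of the mirror; if it vanishes,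
    \<open>v\<close> already points along e_0 and the identity will do.\<close>
  define w where "w = (\<lambda>i. v $ i - (if i = 0 then vnorm v else 0))"
  define N where "N = (\<Sum>i<r. (w i)\<^sup>2)"
  show ?thesis
  proof (cases "N = 0")
    case True
    hence w0: "w i = 0" if "i < r" for i using that by (simp add: N_def sum_nonneg_eq_0_iff)
    have "v = vnorm v \<cdot>\<^sub>v unit_vec r 0"
      using w0 v by (intro eq_vecI) (auto simp: w_def unit_vec_def)
    thus ?thesis using v by (intro bexI[of _ "1\<^sub>m r"]) (auto simp: orthonormal_cols_def)
  next
    case False
    define c where "c = 2 / N"
    define H where "H = mat r r (\<lambda>(i,j). (if i = j then 1 else 0) - c * w i * w j)"
    have H: "H \<in> carrier_mat r r" and HT: "H\<^sup>T = H" by (auto simp: H_def mult_ac)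
    have "H * H = 1\<^sub>m r"
    proof (intro eq_matI)
      fix i j assume "i < dim_row (1\<^sub>m r :: real mat)" "j < dim_col (1\<^sub>m r :: real mat)"
      hence ij: "i < r" "j < r" by auto
      have "(H * H) $$ (i,j) = (\<Sum>k<r. ((if i = k then 1 else 0) - c * w i * w k) * ((if k = j then 1 else 0) - c * w k * w j))"
        using ij by (simp add: H_def scalar_prod_def atLeast0LessThan)
      also have "\<dots> = (\<Sum>k<r. (if k = i then (if i = j then 1 else 0) - c * w i * w j else 0)
           - (if k = j then c * w i * w j else 0) + c * c * w i * w j * (w k)\<^sup>2)"
        by (intro sum.cong) (auto simp: algebra_simps power2_eq_square)
      also have "\<dots> = ((if i = j then 1 else 0) - c * w i * w j) - c * w i * w j + c * c * w i * w j * N"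
        using ij by (simp add: sum.distrib sum_subtractf N_def sum_distrib_left)
      also have "\<dots> = (1\<^sub>m r) $$ (i,j)"
        using ij False by (simp add: c_def field_simps)
      finally show "(H * H) $$ (i,j) = (1\<^sub>m r) $$ (i,j)" .
    qed (use H in auto)
    hence "orthonormal_cols H" using H HT by (auto simp: orthonormal_cols_def)
    moreover have "H *\<^sub>v v = vnorm v \<cdot>\<^sub>v unit_vec r 0"
    proof (intro eq_vecI)
      have d: "(\<Sum>k<r. if k = 0 then vnorm v * v $ k else 0) = vnorm v * v $ 0" using \<open>0 < r\<close> by simp
      have d2: "(\<Sum>k<r. if k = 0 then (vnorm v)\<^sup>2 - 2 * vnorm v * v $ k else 0) = (vnorm v)\<^sup>2 - 2 * vnorm v * v $ 0"
        using \<open>0 < r\<close> by simp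
      have vv: "(\<Sum>k<r. (v $ k)\<^sup>2) = (vnorm v)\<^sup>2" using v by (simp add: vnorm_sq)
      have wv: "(\<Sum>k<r. w k * v $ k) = (vnorm v)\<^sup>2 - vnorm v * v $ 0"
      proof -
        have "(\<Sum>k<r. w k * v $ k) = (\<Sum>k<r. (v $ k)\<^sup>2 - (if k = 0 then vnorm v * v $ k else 0))"
          by (intro sum.cong) (auto simp: w_def algebra_simps power2_eq_square)
        thus ?thesis by (simp only: sum_subtractf d vv)
      qed
      have "N = (\<Sum>k<r. (v $ k)\<^sup>2 + (if k = 0 then (vnorm v)\<^sup>2 - 2 * vnorm v * v $ k else 0))"
        unfolding N_def by (intro sum.cong) (auto simp: w_def algebra_simps power2_eq_square)
      hence "N = 2 * ((vnorm v)\<^sup>2 - vnorm v * v $ 0)" by (simp only: sum.distrib d2 vv) (simp add: algebra_simps)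
      \<comment> \<open>Since the two exchanged vectors have equal length, |w|^2 = 2 (w . v); with
        \<open>c = 2 / N\<close> the reflection subtracts exactly \<open>w\<close> from
        \<open>v\<close>.\<close>
      with wv have cw: "c * (\<Sum>k<r. w k * v $ k) = 1" using False by (simp add: c_def)
      fix i assume "i < dim_vec (vnorm v \<cdot>\<^sub>v unit_vec r 0)"
      hence i: "i < r" by simp
      have "(H *\<^sub>v v) $ i = (\<Sum>k<r. ((if i = k then 1 else 0) - c * w i * w k) * v $ k)"
        using i v by (simp add: H_def scalar_prod_def atLeast0LessThan)
      also have "\<dots> = (\<Sum>k<r. (if k = i then v $ i else 0) - w i * (c * (w k * v $ k)))"
        by (intro sum.cong) (auto simp: algebra_simps)
      also have "\<dots> = v $ i - w i * (c * (\<Sum>k<r. w k * v $ k))"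
        using i by (simp add: sum_subtractf sum_distrib_left)
      also have "\<dots> = (vnorm v \<cdot>\<^sub>v unit_vec r 0) $ i"
        unfolding cw using i by (auto simp: w_def unit_vec_def)
      finally show "(H *\<^sub>v v) $ i = (vnorm v \<cdot>\<^sub>v unit_vec r 0) $ i" .
    qed (use H in auto)
    ultimately show ?thesis using H HT by blast
  qed
qed

lemma orthonormal_cols_mult:
  assumes "P \<in> carrier_mat p r" "orthonormal_cols P" "Q \<in> carrier_mat r s" "orthonormal_cols Q"
  shows "orthonormal_cols (P * Q)"
proof -
  have "(P * Q)\<^sup>T * (P * Q) = Q\<^sup>T * P\<^sup>T * (P * Q)" using assms by (simp add: transpose_mult)
  also have "\<dots> = Q\<^sup>T * (P\<^sup>T * (P * Q))" using assms by (intro assoc_mult_mat[of _ s r _ p _ s]) auto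
  also have "P\<^sup>T * (P * Q) = P\<^sup>T * P * Q" using assms by (intro assoc_mult_mat[symmetric, of _ r p _ r _ s]) auto
  also have "\<dots> = Q" using assms by (simp add: orthonormal_cols_def)
  finally show ?thesis using assms by (simp add: orthonormal_cols_def)
qed

definition dsum_one :: "real \<Rightarrow> real mat \<Rightarrow> real mat" where
  "dsum_one a X = four_block_mat (mat 1 1 (\<lambda>_. a)) (0\<^sub>m 1 (dim_col X)) (0\<^sub>m (dim_row X) 1) X"

lemma dsum1_index:
  assumes "i < Suc (dim_row X)" "j < Suc (dim_col X)"
  shows "dsum_one a X $$ (i,j) = (if i = 0 then if j = 0 then a else 0 else if j = 0 then 0 else X $$ (i - 1, j - 1))"
  using assms by (auto simp: dsum_one_def)

lemma dsum1_carrier: "X \<in> carrier_mat p r \<Longrightarrow> dsum_one a X \<in> carrier_mat (Suc p) (Suc r)"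
  by (auto simp: dsum_one_def)

lemma dsum1_mult:
  assumes "X \<in> carrier_mat p r" "Y \<in> carrier_mat r s"
  shows "dsum_one a X * dsum_one a' Y = dsum_one (a * a') (X * Y)"
proof -
  have "mat 1 1 (\<lambda>_. a) * mat 1 1 (\<lambda>_. a') + 0\<^sub>m 1 r * 0\<^sub>m r 1 = mat 1 1 (\<lambda>_. a * a')"
    by (intro eq_matI) (auto simp: scalar_prod_def)
  thus ?thesis unfolding dsum_one_def using assms
    by (subst mult_four_block_mat[of _ 1 1 _ r _ p _ _ 1 _ s]) auto
qed

lemma dsum1_transpose: "(dsum_one a X)\<^sup>T = dsum_one a (X\<^sup>T)"
  by (intro eq_matI) (auto simp: dsum_one_def)

lemma orthonormal_cols_dsum1:
  assumes "X \<in> carrier_mat p r" "orthonormal_cols X"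
  shows "orthonormal_cols (dsum_one 1 X)"
proof -
  have "(dsum_one 1 X)\<^sup>T * dsum_one 1 X = dsum_one (1 * 1) (X\<^sup>T * X)"
    unfolding dsum1_transpose using assms by (intro dsum1_mult[of _ r p _ r]) auto
  also have "\<dots> = 1\<^sub>m (Suc r)"
    using assms unfolding orthonormal_cols_def by (intro eq_matI) (auto simp: dsum_one_def)
  finally show ?thesis using assms by (auto simp: orthonormal_cols_def dsum_one_def)
qed

text \<open>A unit vector of maximal stretch and its image are reflected onto the first axes, which
  splits off the largest singular value. In the induction on rows the number of columns stays
  arbitrary, since it drops together with the rows.\<close>

theorem svd_exists: "\<exists>U S V. is_svd M U S V"
proof -
  have "\<exists>U S V. is_svd M U S V" if "M \<in> carrier_mat p r" for p r and M :: "real mat"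
    using that
  proof (induction p arbitrary: r M)
    case 0
    thus ?case by (intro exI[of _ "1\<^sub>m 0"] exI[of _ M] exI[of _ "1\<^sub>m r"]) (auto simp: is_svd_def)
  next
    case (Suc p)
    note M = Suc.prems
    show ?case
    proof (cases r)
      case 0
      thus ?thesis using M
        by (intro exI[of _ "1\<^sub>m (Suc p)"] exI[of _ M] exI[of _ "1\<^sub>m 0"]) (auto simp: is_svd_def)
    next
      case r: (Suc s)
      obtain v where v: "v \<in> carrier_vec r" "vnorm v = 1"
        "\<And>x. x \<in> carrier_vec r \<Longrightarrow> vnorm (M *\<^sub>v x) \<le> vnorm (M *\<^sub>v v) * vnorm x"
        using exists_max_on_sphere[OF M] r by auto
      define \<sigma> where "\<sigma> = vnorm (M *\<^sub>v v)"
      have Mv: "M *\<^sub>v v \<in> carrier_vec (Suc p)" using M v(1) by auto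
      obtain HV where HV: "HV \<in> carrier_mat r r" "orthonormal_cols HV" "HV\<^sup>T = HV" 
        "HV *\<^sub>v v = 1 \<cdot>\<^sub>v unit_vec r 0" using householder[OF v(1)] r v(2) by auto
      obtain HU where HU: "HU \<in> carrier_mat (Suc p) (Suc p)" "orthonormal_cols HU" "HU\<^sup>T = HU"
        "HU *\<^sub>v (M *\<^sub>v v) = \<sigma> \<cdot>\<^sub>v unit_vec (Suc p) 0"
        using householder[OF Mv] by (auto simp: \<sigma>_def)
      have HUU: "HU * HU = 1\<^sub>m (Suc p)" and HVV: "HV * HV = 1\<^sub>m r"
        using HU HV by (auto simp: orthonormal_cols_def)
      define M' where "M' = HU * M * HV"
      have M': "M' \<in> carrier_mat (Suc p) r" using HU(1) HV(1) M by (auto simp: M'_def)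
      have HVe: "HV *\<^sub>v unit_vec r 0 = v"
      proof -
        have "HV *\<^sub>v (HV *\<^sub>v v) = v" using orthonormal_cols_mult_vec[OF HV(1,2) v(1)] HV(3) by simp
        thus ?thesis using HV(4) by simp
      qed
      have M'x: "M' *\<^sub>v x = HU *\<^sub>v (M *\<^sub>v (HV *\<^sub>v x))" if "x \<in> carrier_vec r" for x
      proof -
        have "M' *\<^sub>v x = HU * M *\<^sub>v (HV *\<^sub>v x)"
          unfolding M'_def using HU(1) HV(1) M that by (intro assoc_mult_mat_vec) auto
        also have "\<dots> = HU *\<^sub>v (M *\<^sub>v (HV *\<^sub>v x))"
          using HU(1) HV(1) M that by (intro assoc_mult_mat_vec) auto
        finally show ?thesis .
      qed
      have M'bd: "vnorm (M' *\<^sub>v x) \<le> \<sigma> * vnorm x" if x: "x \<in> carrier_vec r" for x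
      proof -
        have x': "HV *\<^sub>v x \<in> carrier_vec r" using HV(1) x by auto
        hence "M *\<^sub>v (HV *\<^sub>v x) \<in> carrier_vec (Suc p)" using M by auto
        hence "vnorm (M' *\<^sub>v x) = vnorm (M *\<^sub>v (HV *\<^sub>v x))"
          unfolding M'x[OF x] by (rule vnorm_orthonormal_cols[OF HU(1,2)])
        also have "\<dots> \<le> \<sigma> * vnorm (HV *\<^sub>v x)" using v(3)[OF x'] by (simp add: \<sigma>_def)
        finally show ?thesis by (simp add: vnorm_orthonormal_cols[OF HV(1,2) x])
      qed
      have col0: "M' $$ (i,0) = (if i = 0 then \<sigma> else 0)" if "i < Suc p" for i
      proof -
        have "M' *\<^sub>v unit_vec r 0 = \<sigma> \<cdot>\<^sub>v unit_vec (Suc p) 0"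
          by (simp only: M'x[OF unit_vec_carrier] HVe HU(4))
        hence "(M' *\<^sub>v unit_vec r 0) $ i = (\<sigma> \<cdot>\<^sub>v unit_vec (Suc p) 0) $ i" by simp
        moreover have "(M' *\<^sub>v unit_vec r 0) $ i = M' $$ (i,0)"
          using M' that r by simp
        ultimately show ?thesis using that by (cases "i = 0") (simp_all add: unit_vec_def)
      qed
      \<comment> \<open>Applied to its own first row, \<open>M'\<close> yields the squared length of
        that row as first coordinate; the bound \<open>\<sigma>\<close> on the stretch then limits
        the row length to \<open>\<sigma>\<close>. The entry in position 0 already has this size, so
        no other entry can be nonzero.\<close>
      have row0: "M' $$ (0,j) = 0" if "0 < j" "j < r" for j
      proof -
        let ?w = "row M' 0"
        have w: "?w \<in> carrier_vec r" using M' by auto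
        have "(vnorm ?w)\<^sup>2 = (M' *\<^sub>v ?w) $ 0" using M' by (simp add: vnorm_sq_scalar_prod)
        also have "\<dots> \<le> vnorm (M' *\<^sub>v ?w)"
        proof -
          have "((M' *\<^sub>v ?w) $ 0)\<^sup>2 \<le> (\<Sum>i<Suc p. ((M' *\<^sub>v ?w) $ i)\<^sup>2)" by (intro member_le_sum) auto
          also have "\<dots> = (vnorm (M' *\<^sub>v ?w))\<^sup>2" using M' by (simp only: vnorm_sq) simp
          finally show ?thesis by (metis power2_le_imp_le vnorm_nonneg)
        qed
        also have "\<dots> \<le> \<sigma> * vnorm ?w" by (rule M'bd[OF w])
        finally have "vnorm ?w \<le> \<sigma>"
          by (cases "vnorm ?w = 0") (auto simp: power2_eq_square mult_le_cancel_right \<sigma>_def less_le)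
        hence "(vnorm ?w)\<^sup>2 \<le> \<sigma>\<^sup>2" by (intro power_mono) auto
        moreover have "(vnorm ?w)\<^sup>2 = (\<Sum>j<r. (M' $$ (0,j))\<^sup>2)" using M' by (simp add: vnorm_sq)
        moreover have "(\<Sum>j\<in>{0,j}. (M' $$ (0,j))\<^sup>2) \<le> (\<Sum>j<r. (M' $$ (0,j))\<^sup>2)"
          using that by (intro sum_mono2) auto
        moreover have "(\<Sum>j\<in>{0,j}. (M' $$ (0,j))\<^sup>2) = \<sigma>\<^sup>2 + (M' $$ (0,j))\<^sup>2"
          using that col0[of 0] by simp
        ultimately have "(M' $$ (0,j))\<^sup>2 \<le> 0" by linarith
        thus ?thesis by simp
      qed
      define M'' where "M'' = mat p s (\<lambda>(i,j). M' $$ (Suc i, Suc j))"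
      have M'': "M'' \<in> carrier_mat p s" by (simp add: M''_def)
      have M'eq: "M' = dsum_one \<sigma> M''"
      proof (intro eq_matI)
        fix i j assume "i < dim_row (dsum_one \<sigma> M'')" "j < dim_col (dsum_one \<sigma> M'')"
        hence ij: "i < Suc p" "j < Suc s" using dsum1_carrier[OF M'', of \<sigma>] by auto
        thus "M' $$ (i,j) = dsum_one \<sigma> M'' $$ (i,j)"
          using M'' row0[of j] col0[of i] r by (subst dsum1_index) (auto simp: M''_def)
      qed (use M' dsum1_carrier[OF M'', of \<sigma>] r in auto)
      from Suc.IH[OF M''] obtain U'' S'' V'' where svd: "is_svd M'' U'' S'' V''" by blast
      note D = is_svdD[OF svd M'']
      \<comment> \<open>Padding \<open>x\<close> with a leading zero embeds it in the domain of
        \<open>M'\<close>, so the remaining block inherits the bound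
        \<open>\<sigma>\<close>.\<close>
      have "vnorm (M'' *\<^sub>v x) \<le> \<sigma> * vnorm x" if x: "x \<in> carrier_vec s" for x
      proof -
        define y where "y = vec r (\<lambda>i. if i = 0 then 0 else x $ (i - 1))"
        have y: "y \<in> carrier_vec r" by (simp add: y_def)
        have "(vnorm y)\<^sup>2 = (vnorm x)\<^sup>2"
          unfolding vnorm_sq using x r by (simp add: y_def sum.lessThan_Suc_shift del: sum.lessThan_Suc)
        hence yx: "vnorm y = vnorm x" by (simp add: power2_eq_iff_nonneg)
        have c: "(M'' *\<^sub>v x) $ i = (M' *\<^sub>v y) $ Suc i" if "i < p" for i
        proof -
          have "(M' *\<^sub>v y) $ Suc i = (\<Sum>j<Suc s. M' $$ (Suc i,j) * y $ j)"
            using that M' y r by (simp add: scalar_prod_def atLeast0LessThan del: sum.lessThan_Suc)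
          also have "\<dots> = (\<Sum>j<s. M' $$ (Suc i,Suc j) * x $ j)"
            using r unfolding sum.lessThan_Suc_shift by (simp add: y_def)
          finally show ?thesis using that x by (simp add: M''_def scalar_prod_def atLeast0LessThan)
        qed
        have "(vnorm (M'' *\<^sub>v x))\<^sup>2 = (\<Sum>i<p. ((M' *\<^sub>v y) $ Suc i)\<^sup>2)"
        proof -
          have "(vnorm (M'' *\<^sub>v x))\<^sup>2 = (\<Sum>i<p. ((M'' *\<^sub>v x) $ i)\<^sup>2)" using M'' by (simp only: vnorm_sq) simp
          thus ?thesis using c by (metis (no_types, lifting) lessThan_iff sum.cong)
        qed
        also have "\<dots> \<le> (\<Sum>i<Suc p. ((M' *\<^sub>v y) $ i)\<^sup>2)"
          unfolding sum.lessThan_Suc_shift by simp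
        also have "\<dots> = (vnorm (M' *\<^sub>v y))\<^sup>2" using M' by (simp only: vnorm_sq) simp
        finally have "vnorm (M'' *\<^sub>v x) \<le> vnorm (M' *\<^sub>v y)" by (rule power2_le_imp_le) simp
        with M'bd[OF y] yx show ?thesis by simp
      qed
      \<comment> \<open>Min-max with an empty set of equations turns the norm bound into a bound on
        the largest singular value of the block; this keeps the assembled diagonal
        decreasing.\<close>
      hence le: "svd_diag S'' i \<le> \<sigma>" for i
        by (intro order_trans[OF D(9)[of 0 i]] svd_minmax[OF svd M'', of "0\<^sub>m 0 s" 0]) (auto simp: \<sigma>_def)
      have "M' = dsum_one 1 U'' * dsum_one \<sigma> S'' * (dsum_one 1 V'')\<^sup>T"
        unfolding M'eq dsum1_transpose using D(1,3,5)
        by (subst dsum1_mult[of _ p p _ s], simp, simp, subst dsum1_mult[of _ p s _ s]) (auto simp: D(6)[symmetric])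
      moreover have "M = HU * M' * HV"
      proof -
        have "HU * M' * HV = HU * (HU * M * HV) * HV" by (simp add: M'_def)
        also have "HU * (HU * M * HV) = HU * (HU * M) * HV"
          using HU(1) HV(1) M by (intro assoc_mult_mat[symmetric, of _ "Suc p" "Suc p" _ r _ r]) auto
        also have "HU * (HU * M) = HU * HU * M"
          using HU(1) M by (intro assoc_mult_mat[symmetric, of _ "Suc p" "Suc p" _ "Suc p" _ r]) auto
        also have "HU * HU * M * HV * HV = HU * HU * M * (HV * HV)"
          using HU(1) HV(1) M by (intro assoc_mult_mat[of _ "Suc p" r _ r _ r]) auto
        finally show ?thesis using HUU HVV M by simp
      qed
      ultimately have Meq: "M = HU * (dsum_one 1 U'' * dsum_one \<sigma> S'' * (dsum_one 1 V'')\<^sup>T) * HV" by simp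
      let ?U = "HU * dsum_one 1 U''" and ?S = "dsum_one \<sigma> S''" and ?V = "HV * dsum_one 1 V''"
      have cU: "dsum_one 1 U'' \<in> carrier_mat (Suc p) (Suc p)" and cV: "dsum_one 1 V'' \<in> carrier_mat r r"
        and cS: "?S \<in> carrier_mat (Suc p) r" using dsum1_carrier D(1,3,5) r by auto
      have "M = ?U * ?S * ?V\<^sup>T"
      proof -
        have "?V\<^sup>T = (dsum_one 1 V'')\<^sup>T * HV" using HV cV by (simp add: transpose_mult)
        hence "?U * ?S * ?V\<^sup>T = ?U * ?S * ((dsum_one 1 V'')\<^sup>T * HV)" by (simp only:)
        also have "\<dots> = ?U * ?S * (dsum_one 1 V'')\<^sup>T * HV"
          using HU(1) HV(1) cU cV cS by (intro assoc_mult_mat[symmetric, of _ "Suc p" r _ r _ r]) auto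
        also have "\<dots> = HU * (dsum_one 1 U'' * ?S) * (dsum_one 1 V'')\<^sup>T * HV"
          using HU(1) cU cS by (simp only: assoc_mult_mat)
        also have "\<dots> = HU * (dsum_one 1 U'' * ?S * (dsum_one 1 V'')\<^sup>T) * HV"
          using HU(1) cU cS cV by (intro arg_cong2[of _ _ _ _ "(*)"] refl assoc_mult_mat) auto
        finally show ?thesis using Meq by (simp only:)
      qed
      moreover have "orthonormal_cols ?U" "orthonormal_cols ?V"
        using orthonormal_cols_mult[OF HU(1,2) cU] orthonormal_cols_mult[OF HV(1,2) cV]
          orthonormal_cols_dsum1 D(1-4) by blast+
      moreover have S0: "?S $$ (i,j) = (if i = j then if i = 0 then \<sigma> else svd_diag S'' (i - 1) else 0)"
        if "i < Suc p" "j < r" for i j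
      proof -
        have "?S $$ (i,j) = (if i = 0 then if j = 0 then \<sigma> else 0 else if j = 0 then 0 else S'' $$ (i - 1, j - 1))"
          using that D(5) r by (intro dsum1_index) auto
        thus ?thesis using that D(7)[of "i - 1" "j - 1"] r by auto
      qed
      moreover have "0 \<le> \<sigma>" by (simp add: \<sigma>_def)
      ultimately have "is_svd M ?U ?S ?V"
        unfolding is_svd_def Let_def using M HU(1) HV(1) cU cV cS D(8,9) le
        by (auto simp: orthonormal_cols_def S0)
      thus ?thesis by blast
    qed
  qed
  thus ?thesis by (metis carrier_matI)
qed

lemma sval_nonneg: "0 \<le> sval M j"
proof (cases j)
  case 0
  thus ?thesis by (simp add: sval_def)
next
  case (Suc i)
  obtain U S V where svd: "is_svd M U S V" using svd_exists by blast
  show ?thesis unfolding Suc sval_eq_svd_diag[OF svd]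
    by (rule is_svdD(8)[OF svd carrier_matI[OF refl refl]])
qed

lemma sval_transpose: "sval (M\<^sup>T) j = sval M j"
proof (cases j)
  case 0
  thus ?thesis by (simp add: sval_def)
next
  case (Suc i)
  obtain U S V where svd: "is_svd M U S V" using svd_exists by blast
  have "svd_diag (S\<^sup>T) i = svd_diag S i" by (auto simp: svd_diag_def)
  thus ?thesis
    unfolding Suc sval_eq_svd_diag[OF svd] sval_eq_svd_diag[OF is_svd_transpose[OF svd]] .
qed

section \<open>Orthonormal bases of column spaces and the blocks of the algorithm\<close>

lemma first_cols_carrier: "M \<in> carrier_mat p r \<Longrightarrow> first_cols k M \<in> carrier_mat p k"
  by (auto simp: first_cols_def)

lemma first_cols_mult_vec:
  assumes "M \<in> carrier_mat p r" "k \<le> r" "c \<in> carrier_vec k"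
  shows "first_cols k M *\<^sub>v c = M *\<^sub>v vec r (\<lambda>i. if i < k then c $ i else 0)"
proof (intro eq_vecI)
  fix i assume "i < dim_vec (M *\<^sub>v vec r (\<lambda>i. if i < k then c $ i else 0))"
  hence i: "i < p" using assms by simp
  have "(first_cols k M *\<^sub>v c) $ i = (\<Sum>j<k. M $$ (i,j) * c $ j)"
    using i assms by (simp add: first_cols_def scalar_prod_def atLeast0LessThan)
  also have "\<dots> = (\<Sum>j<r. M $$ (i,j) * (if j < k then c $ j else 0))"
    using assms(2) by (intro sum.mono_neutral_cong_left) auto
  also have "\<dots> = (M *\<^sub>v vec r (\<lambda>i. if i < k then c $ i else 0)) $ i"
    using i assms by (simp add: scalar_prod_def atLeast0LessThan)
  finally show "(first_cols k M *\<^sub>v c) $ i = (M *\<^sub>v vec r (\<lambda>i. if i < k then c $ i else 0)) $ i" .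
qed (use assms in \<open>auto simp: first_cols_def\<close>)

lemma orthonormal_cols_iff:
  assumes "Q \<in> carrier_mat p r"
  shows "orthonormal_cols Q \<longleftrightarrow>
    (\<forall>i<r. \<forall>j<r. col Q i \<bullet> col Q j = (if i = j then 1 else 0))"
proof -
  have "Q\<^sup>T * Q = 1\<^sub>m r \<longleftrightarrow> (\<forall>i<r. \<forall>j<r. (Q\<^sup>T * Q) $$ (i,j) = (1\<^sub>m r) $$ (i,j))"
    using assms by (subst mat_eq_iff) auto
  thus ?thesis using assms by (simp add: orthonormal_cols_def)
qed

lemma orthonormal_cols_first_cols:
  assumes "M \<in> carrier_mat p r" "k \<le> r" "orthonormal_cols M"
  shows "orthonormal_cols (first_cols k M)"
proof -
  have "col (first_cols k M) i = col M i" if "i < k" for i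
    using that assms by (intro eq_vecI) (auto simp: first_cols_def)
  thus ?thesis using assms
    by (simp add: orthonormal_cols_iff[OF assms(1)] orthonormal_cols_iff[OF first_cols_carrier[OF assms(1)]])
qed

lemma svd_mult_vec:
  assumes "is_svd M U S V" "M \<in> carrier_mat p r" "x \<in> carrier_vec r"
  shows "M *\<^sub>v x = U *\<^sub>v vec p (\<lambda>i. if i < r then svd_diag S i * (V\<^sup>T *\<^sub>v x) $ i else 0)"
proof -
  note D = is_svdD[OF assms(1,2)]
  let ?y = "V\<^sup>T *\<^sub>v x"
  have y: "?y \<in> carrier_vec r" using D(3) assms(3) by (auto intro!: mult_mat_vec_carrier)
  have "M *\<^sub>v x = U * S *\<^sub>v ?y"
    by (subst D(6)) (use D(1,3,5) assms(3) in \<open>intro assoc_mult_mat_vec, auto\<close>)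
  also have "\<dots> = U *\<^sub>v (S *\<^sub>v ?y)" using D(1,5) y by (intro assoc_mult_mat_vec) auto
  also have "S *\<^sub>v ?y = vec p (\<lambda>i. if i < r then svd_diag S i * ?y $ i else 0)"
    using svd_diag_mult_vec[OF D(5) y _ D(7)] D(5) by (intro eq_vecI) (auto simp del: index_mult_mat_vec)
  finally show ?thesis .
qed

lemma svd_mult_V:
  assumes "is_svd M U S V" "M \<in> carrier_mat p r" "y \<in> carrier_vec r"
  shows "M *\<^sub>v (V *\<^sub>v y) = U *\<^sub>v vec p (\<lambda>i. if i < r then svd_diag S i * y $ i else 0)"
proof -
  note D = is_svdD[OF assms(1,2)]
  have Vy: "V *\<^sub>v y \<in> carrier_vec r" using D(3) assms(3) by (rule mult_mat_vec_carrier)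
  show ?thesis
    unfolding svd_mult_vec[OF assms(1,2) Vy] orthonormal_cols_mult_vec[OF D(3,4) assms(3)] ..
qed

text \<open>The left singular vectors belonging to nonzero singular values form the basis; a
  rank-deficient \<open>Y\<close> thus gets fewer columns than it has itself.\<close>

lemma orth_exists:
  "\<exists>Q. dim_row Q = dim_row Y \<and> orthonormal_cols Q \<and> colsp Q = colsp Y"
proof -
  define p r where "p = dim_row Y" and "r = dim_col Y"
  have Y: "Y \<in> carrier_mat p r" by (simp add: p_def r_def)
  obtain U S V where svd: "is_svd Y U S V" using svd_exists by blast
  note D = is_svdD[OF svd Y]
  have "svd_diag S (min p r) = 0" using D(5) by (auto simp: svd_diag_def)
  \<comment> \<open>The rank is the first index with vanishing singular value. It exists because the
    diagonal is extended by zero, and monotonicity makes everything after it vanish.\<close>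
  define k where "k = (LEAST k. svd_diag S k = 0)"
  have k0: "svd_diag S k = 0" unfolding k_def by (rule LeastI) fact
  have k: "k \<le> p" "k \<le> r"
    using Least_le[of "\<lambda>k. svd_diag S k = 0", OF \<open>svd_diag S (min p r) = 0\<close>] by (auto simp: k_def)
  have pos: "svd_diag S i \<noteq> 0" if "i < k" for i using not_less_Least that by (auto simp: k_def)
  have zero: "svd_diag S i = 0" if "k \<le> i" for i
    using D(8)[of i] D(9)[OF that] k0 by linarith
  define Q where "Q = first_cols k U"
  have Q: "Q \<in> carrier_mat p k" using D(1) by (simp add: Q_def first_cols_carrier)
  have "colsp Q = colsp Y"
  proof (intro equalityI subsetI)
    fix z assume "z \<in> colsp Q"
    then obtain c where c: "c \<in> carrier_vec k" "z = Q *\<^sub>v c" using Q by (auto simp: colsp_def)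
    define y where "y = vec r (\<lambda>i. if i < k then c $ i / svd_diag S i else 0)"
    have y: "y \<in> carrier_vec r" by (simp add: y_def)
    have "Y *\<^sub>v (V *\<^sub>v y) = U *\<^sub>v vec p (\<lambda>i. if i < r then svd_diag S i * y $ i else 0)"
      by (rule svd_mult_V[OF svd Y y])
    also have "vec p (\<lambda>i. if i < r then svd_diag S i * y $ i else 0)
        = vec p (\<lambda>i. if i < k then c $ i else 0)"
      using k pos by (intro eq_vecI) (auto simp: y_def)
    also have "U *\<^sub>v \<dots> = z" using first_cols_mult_vec[OF D(1) k(1) c(1)] c(2) by (simp add: Q_def)
    finally have "z = Y *\<^sub>v (V *\<^sub>v y)" by simp
    moreover have "V *\<^sub>v y \<in> carrier_vec r" using D(3) y by auto
    ultimately show "z \<in> colsp Y" using Y by (auto simp: colsp_def)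
  next
    fix z assume "z \<in> colsp Y"
    then obtain x where x: "x \<in> carrier_vec r" "z = Y *\<^sub>v x" using Y by (auto simp: colsp_def)
    define c where "c = vec k (\<lambda>i. svd_diag S i * (V\<^sup>T *\<^sub>v x) $ i)"
    have c: "c \<in> carrier_vec k" by (simp add: c_def)
    have "z = U *\<^sub>v vec p (\<lambda>i. if i < r then svd_diag S i * (V\<^sup>T *\<^sub>v x) $ i else 0)"
      unfolding x(2) by (rule svd_mult_vec[OF svd Y x(1)])
    also have "vec p (\<lambda>i. if i < r then svd_diag S i * (V\<^sup>T *\<^sub>v x) $ i else 0)
       = vec p (\<lambda>i. if i < k then c $ i else 0)"
      using k zero by (intro eq_vecI) (auto simp: c_def simp del: index_mult_mat_vec)
    also have "U *\<^sub>v \<dots> = Q *\<^sub>v c" using first_cols_mult_vec[OF D(1) k(1) c] by (simp add: Q_def)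
    finally show "z \<in> colsp Q" using Q c by (auto simp: colsp_def)
  qed
  moreover have "orthonormal_cols Q" unfolding Q_def by (rule orthonormal_cols_first_cols[OF D(1) k(1) D(2)])
  ultimately show ?thesis using Q by (auto simp: p_def)
qed

text \<open>The choice in \<open>orth\<close> is never resolved: these three properties are its
  whole interface from here on.\<close>

lemma orth_props:
  "dim_row (orth Y) = dim_row Y" "orthonormal_cols (orth Y)" "colsp (orth Y) = colsp Y"
proof -
  have "dim_row (orth Y) = dim_row Y \<and> orthonormal_cols (orth Y) \<and> colsp (orth Y) = colsp Y"
    unfolding orth_def by (rule someI_ex) (rule orth_exists)
  thus "dim_row (orth Y) = dim_row Y" "orthonormal_cols (orth Y)" "colsp (orth Y) = colsp Y" by auto
qed

lemma complement_mult_vec: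
  fixes Q :: "real mat"
  assumes "Q \<in> carrier_mat p r" "x \<in> carrier_vec p"
  shows "(1\<^sub>m p - Q * Q\<^sup>T) *\<^sub>v x = x - Q *\<^sub>v (Q\<^sup>T *\<^sub>v x)"
proof -
  have "(1\<^sub>m p - Q * Q\<^sup>T) *\<^sub>v x = 1\<^sub>m p *\<^sub>v x - Q * Q\<^sup>T *\<^sub>v x"
    using assms by (intro minus_mult_distrib_mat_vec) auto
  also have "Q * Q\<^sup>T *\<^sub>v x = Q *\<^sub>v (Q\<^sup>T *\<^sub>v x)" using assms by (intro assoc_mult_mat_vec) auto
  finally show ?thesis using assms by simp
qed

lemma complement_orthogonal:
  assumes Q: "Q \<in> carrier_mat p r" "orthonormal_cols Q" and x: "x \<in> carrier_vec p"
  shows "Q\<^sup>T *\<^sub>v (x - Q *\<^sub>v (Q\<^sup>T *\<^sub>v x)) = 0\<^sub>v r"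
proof -
  have y: "Q\<^sup>T *\<^sub>v x \<in> carrier_vec r" using Q x by (auto intro!: mult_mat_vec_carrier)
  have "Q\<^sup>T *\<^sub>v (x - Q *\<^sub>v (Q\<^sup>T *\<^sub>v x)) = Q\<^sup>T *\<^sub>v x - Q\<^sup>T *\<^sub>v (Q *\<^sub>v (Q\<^sup>T *\<^sub>v x))"
    using Q x y by (intro mult_minus_distrib_mat_vec) auto
  also have "\<dots> = 0\<^sub>v r" using orthonormal_cols_mult_vec[OF Q y] y by simp
  finally show ?thesis .
qed

lemma mult_unit_vec_col:
  fixes P :: "real mat"
  assumes "P \<in> carrier_mat p k" "j < k"
  shows "P *\<^sub>v unit_vec k j = col P j"
  using assms by (intro eq_vecI) auto

lemma orth_complement_gram:
  assumes Q: "Q \<in> carrier_mat p r" "orthonormal_cols Q" and X: "X \<in> carrier_mat p s"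
    and P: "P \<in> carrier_mat p k" "colsp P \<subseteq> colsp ((1\<^sub>m p - Q * Q\<^sup>T) * X)"
  shows "Q\<^sup>T * P = 0\<^sub>m r k"
proof (intro eq_matI)
  fix i j assume "i < dim_row (0\<^sub>m r k :: real mat)" "j < dim_col (0\<^sub>m r k :: real mat)"
  hence ij: "i < r" "j < k" by auto
  have "P *\<^sub>v unit_vec k j \<in> colsp P" using P(1) ij by (auto simp: colsp_def)
  then obtain x where x: "x \<in> carrier_vec s" "P *\<^sub>v unit_vec k j = ((1\<^sub>m p - Q * Q\<^sup>T) * X) *\<^sub>v x"
    using P(2) X by (auto simp: colsp_def)
  have Xx: "X *\<^sub>v x \<in> carrier_vec p" using X x by auto
  have "col P j = (1\<^sub>m p - Q * Q\<^sup>T) *\<^sub>v (X *\<^sub>v x)"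
    unfolding mult_unit_vec_col[OF P(1) ij(2), symmetric] x(2)
    using Q(1) X x(1) by (intro assoc_mult_mat_vec) auto
  hence "col P j = X *\<^sub>v x - Q *\<^sub>v (Q\<^sup>T *\<^sub>v (X *\<^sub>v x))" by (simp only: complement_mult_vec[OF Q(1) Xx])
  hence "Q\<^sup>T *\<^sub>v col P j = 0\<^sub>v r" by (simp only: complement_orthogonal[OF Q Xx])
  moreover have "(Q\<^sup>T * P) $$ (i,j) = (Q\<^sup>T *\<^sub>v col P j) $ i" using Q P ij by simp
  ultimately show "(Q\<^sup>T * P) $$ (i,j) = 0\<^sub>m r k $$ (i,j)" using ij by simp
qed (use Q P in auto)

lemma orthonormal_cols_hcat:
  assumes X: "X \<in> carrier_mat p r" "orthonormal_cols X" and Y: "Y \<in> carrier_mat p s" "orthonormal_cols Y"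
    and XY: "X\<^sup>T * Y = 0\<^sub>m r s"
  shows "orthonormal_cols (hcat X Y)"
proof -
  have H: "hcat X Y \<in> carrier_mat p (r + s)" using X Y by (auto simp: hcat_def)
  have c1: "col (hcat X Y) j = col X j" if "j < r" for j
    using that X Y by (intro eq_vecI) (auto simp: hcat_def)
  have c2: "col (hcat X Y) j = col Y (j - r)" if "\<not> j < r" "j < r + s" for j
    using that X Y by (intro eq_vecI) (auto simp: hcat_def)
  have xy: "col X i \<bullet> col Y j = 0" if "i < r" "j < s" for i j
  proof -
    have "(X\<^sup>T * Y) $$ (i,j) = col X i \<bullet> col Y j" using X Y that by simp
    thus ?thesis using XY that by simp
  qed
  have yx: "col Y j \<bullet> col X i = 0" if "i < r" "j < s" for i j
    using xy[OF that] X(1) Y(1) by (subst comm_scalar_prod[of _ p]) auto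
  show ?thesis unfolding orthonormal_cols_iff[OF H]
  proof (intro allI impI)
    fix i j assume ij: "i < r + s" "j < r + s"
    show "col (hcat X Y) i \<bullet> col (hcat X Y) j = (if i = j then 1 else 0)"
      using ij X(2) Y(2) xy yx unfolding orthonormal_cols_iff[OF X(1)] orthonormal_cols_iff[OF Y(1)]
      by (cases "i < r"; cases "j < r") (auto simp: c1 c2)
  qed
qed

lemma hcat_gram:
  assumes X: "X \<in> carrier_mat p r" and Y: "Y \<in> carrier_mat p s"
  shows "hcat X Y * (hcat X Y)\<^sup>T = X * X\<^sup>T + Y * Y\<^sup>T"
proof (intro eq_matI)
  fix i j assume "i < dim_row (X * X\<^sup>T + Y * Y\<^sup>T)" "j < dim_col (X * X\<^sup>T + Y * Y\<^sup>T)"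
  hence ij: "i < p" "j < p" using X Y by auto
  let ?f = "\<lambda>k. (if k < r then X $$ (i,k) else Y $$ (i,k - r)) * (if k < r then X $$ (j,k) else Y $$ (j,k - r))"
  have "(hcat X Y * (hcat X Y)\<^sup>T) $$ (i,j) = (\<Sum>k\<in>{0..<r + s}. ?f k)"
    using X Y ij by (auto simp: hcat_def scalar_prod_def intro!: sum.cong)
  also have "\<dots> = (\<Sum>k\<in>{0..<r}. ?f k) + (\<Sum>k\<in>{r..<r + s}. ?f k)"
    by (rule sum.atLeastLessThan_concat[symmetric]) auto
  also have "\<dots> = (\<Sum>k\<in>{0..<r}. ?f k) + (\<Sum>k\<in>{0..<s}. ?f (k + r))"
    using sum.shift_bounds_nat_ivl[of ?f 0 r s] by (simp only: add.commute[of s r] add_0)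
  also have "\<dots> = (X * X\<^sup>T + Y * Y\<^sup>T) $$ (i,j)"
    using X Y ij by (auto simp: scalar_prod_def)
  finally show "(hcat X Y * (hcat X Y)\<^sup>T) $$ (i,j) = (X * X\<^sup>T + Y * Y\<^sup>T) $$ (i,j)" .
qed (use X Y in \<open>auto simp: hcat_def\<close>)

text \<open>Each step projects off the current range before its last \<open>orth\<close>, so the new
  block is orthogonal to the old ones for every draw and every admissible eigenvector
  rotation.\<close>

lemma blarank_run_orthonormal:
  assumes "blarank_run sbl A b q k Q"
  shows "dim_row Q = dim_row A \<and> orthonormal_cols Q"
  using assms
proof induction
  case start
  have "orthonormal_cols (0\<^sub>m (dim_row A) 0)" unfolding orthonormal_cols_def by (intro eq_matI) simp_all
  thus ?case by simp
next
  case (step k Q \<Omega> Qh Uh Qi)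
  define p where "p = dim_row A"
  let ?X = "(1\<^sub>m p - Q * Q\<^sup>T) * (Qh * Uh)"
  have Q: "Q \<in> carrier_mat p (dim_col Q)" "orthonormal_cols Q" using step.IH by (auto simp: p_def intro: carrier_matI)
  have "dim_row Qh = dim_row Q" unfolding step.hyps(3) qhat_def Let_def orth_props(1)
    by (cases sbl) (simp_all only: if_True if_False index_minus_mat(2) index_mult_mat(2))
  hence "dim_row Qh = p" using Q(1) by simp
  hence Qh: "Qh * Uh \<in> carrier_mat p (dim_col Uh)" by auto
  have Qi: "Qi = orth ?X" unfolding p_def by (rule step.hyps(5))
  have "dim_row Qi = p" unfolding Qi orth_props(1) using Q(1) by simp
  hence Qi': "Qi \<in> carrier_mat p (dim_col Qi)" "orthonormal_cols Qi" "colsp Qi \<subseteq> colsp ?X"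
    unfolding Qi orth_props(3) by (auto simp only: orth_props(2) intro: carrier_matI)
  have "Q\<^sup>T * Qi = 0\<^sub>m (dim_col Q) (dim_col Qi)"
    by (rule orth_complement_gram[OF Q Qh Qi'(1,3)])
  hence "orthonormal_cols (hcat Q Qi)" by (rule orthonormal_cols_hcat[OF Q Qi'(1,2)])
  moreover have "dim_row (hcat Q Qi) = dim_row A" using step.IH by (simp add: hcat_def)
  ultimately show ?case by (rule conjI[rotated])
qed

section \<open>Deflation\<close>

lemma complement_norm_le:
  assumes "Q \<in> carrier_mat p r" "orthonormal_cols Q" "x \<in> carrier_vec p"
  shows "vnorm (x - Q *\<^sub>v (Q\<^sup>T *\<^sub>v x)) \<le> vnorm x"
  by (rule power2_le_imp_le) (simp_all add: orthonormal_cols_complement_sq[OF assms])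

text \<open>The distance measures how far the range of \<open>Q\<close> sticks out of the range of
  \<open>P\<close>; the conclusion concerns the reverse direction. With K = P^T Q, closeness says
  that \<open>K\<close> shrinks no vector by more than the factor sqrt(1 - e^2). Both bases have
  \<open>r\<close> columns, so \<open>K\<close> is square, hence invertible, and its transpose obeys
  the same lower bound.\<close>

lemma subspace_dist_swap:
  assumes Q: "Q \<in> carrier_mat p r" "orthonormal_cols Q" and P: "P \<in> carrier_mat p r" "orthonormal_cols P"
    and lt: "subspace_dist Q P < 1" and y: "y \<in> carrier_vec r"
  shows "vnorm (P *\<^sub>v y - Q *\<^sub>v (Q\<^sup>T *\<^sub>v (P *\<^sub>v y))) \<le> subspace_dist Q P * vnorm y"
proof -
  define e where "e = subspace_dist Q P"
  have e: "0 \<le> e" "e < 1" using lt by (auto simp: e_def subspace_dist_def)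
  define K where "K = P\<^sup>T * Q"
  have K: "K \<in> carrier_mat r r" using P Q by (auto simp: K_def)
  have Kv: "K *\<^sub>v c = P\<^sup>T *\<^sub>v (Q *\<^sub>v c)" if "c \<in> carrier_vec r" for c
    unfolding K_def using P(1) Q(1) that by (intro assoc_mult_mat_vec) auto
  have KTv: "K\<^sup>T *\<^sub>v c = Q\<^sup>T *\<^sub>v (P *\<^sub>v c)" if "c \<in> carrier_vec r" for c
  proof -
    have "K\<^sup>T = Q\<^sup>T * P" unfolding K_def using P(1) Q(1) by (simp add: transpose_mult[of _ r p _ r])
    thus ?thesis using P(1) Q(1) that by (simp only:) (intro assoc_mult_mat_vec, auto)
  qed
  have low: "(1 - e\<^sup>2) * (vnorm c)\<^sup>2 \<le> (vnorm (K *\<^sub>v c))\<^sup>2" if c: "c \<in> carrier_vec r" for c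
  proof -
    let ?x = "Q *\<^sub>v c"
    have x: "?x \<in> carrier_vec p" using Q c by auto
    have QQ: "Q * Q\<^sup>T *\<^sub>v ?x = ?x"
    proof -
      have "Q * Q\<^sup>T *\<^sub>v ?x = Q *\<^sub>v (Q\<^sup>T *\<^sub>v ?x)" using Q(1) x by (intro assoc_mult_mat_vec) auto
      thus ?thesis by (simp only: orthonormal_cols_mult_vec[OF Q c])
    qed
    have cm: "(1\<^sub>m p - P * P\<^sup>T) * (Q * Q\<^sup>T) \<in> carrier_mat p p" using P(1) Q(1) by auto
    have "vnorm (?x - P *\<^sub>v (P\<^sup>T *\<^sub>v ?x)) = vnorm ((1\<^sub>m p - P * P\<^sup>T) *\<^sub>v (Q * Q\<^sup>T *\<^sub>v ?x))"
      by (simp only: QQ complement_mult_vec[OF P(1) x])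
    also have "\<dots> = vnorm ((1\<^sub>m p - P * P\<^sup>T) * (Q * Q\<^sup>T) *\<^sub>v ?x)"
      using P(1) Q(1) x by (intro arg_cong[of _ _ vnorm] assoc_mult_mat_vec[symmetric]) auto
    also have "\<dots> \<le> e * vnorm ?x"
      using vnorm_mult_le[OF cm x] P(1) by (simp only: e_def subspace_dist_def carrier_matD)
    also have "\<dots> = e * vnorm c" by (simp only: vnorm_orthonormal_cols[OF Q c])
    finally have "(vnorm (?x - P *\<^sub>v (P\<^sup>T *\<^sub>v ?x)))\<^sup>2 \<le> (e * vnorm c)\<^sup>2" by (intro power_mono) auto
    thus ?thesis
      unfolding orthonormal_cols_complement_sq[OF P x] Kv[OF c] vnorm_orthonormal_cols[OF Q c]
      by (simp add: power_mult_distrib algebra_simps)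
  qed
  have e1: "0 < 1 - e\<^sup>2" using e by (simp add: power_less_one_iff abs_square_less_1)
  have "det K \<noteq> 0"
  proof
    assume "det K = 0"
    then obtain c where c: "c \<in> carrier_vec r" "c \<noteq> 0\<^sub>v r" "K *\<^sub>v c = 0\<^sub>v r"
      using det_0_iff_vec_prod_zero_field[OF K] by auto
    have "(1 - e\<^sup>2) * (vnorm c)\<^sup>2 \<le> 0" using low[OF c(1)] c(3) by simp
    hence "vnorm c = 0" using e1 by (simp add: mult_le_0_iff)
    thus False using c vnorm_eq_0 by blast
  qed
  then obtain L where L: "L \<in> carrier_mat r r" "K * L = 1\<^sub>m r"
    using det_non_zero_imp_unit[OF K, of "()"] by (auto simp: Units_def ring_mat_def)
  define z where "z = L *\<^sub>v y"
  have z: "z \<in> carrier_vec r" using L y by (auto simp: z_def)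
  have "K *\<^sub>v z = K * L *\<^sub>v y" unfolding z_def using K L(1) y by (intro assoc_mult_mat_vec[symmetric]) auto
  hence Kz: "K *\<^sub>v z = y" using L(2) y by simp
  let ?w = "K\<^sup>T *\<^sub>v y"
  have w: "?w \<in> carrier_vec r" using K y by (auto intro!: mult_mat_vec_carrier)
  \<comment> \<open>Duality passes the lower bound to the transpose: pairing y = K z with itself
    gives |y|^2 <= |z| |K^T y|, and \<open>low\<close> controls |z| by |y|.\<close>
  have "(vnorm y)\<^sup>2 = (K *\<^sub>v z) \<bullet> y" by (simp only: Kz vnorm_sq_scalar_prod)
  also have "\<dots> = z \<bullet> ?w" by (rule scalar_prod_adjoint[OF K z y])
  also have "\<dots> \<le> vnorm z * vnorm ?w" using scalar_prod_le_vnorm[OF z w] by linarith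
  finally have "((vnorm y)\<^sup>2)\<^sup>2 \<le> (vnorm z * vnorm ?w)\<^sup>2" by (intro power_mono) auto
  hence "(1 - e\<^sup>2) * ((vnorm y)\<^sup>2)\<^sup>2 \<le> ((1 - e\<^sup>2) * (vnorm z)\<^sup>2) * (vnorm ?w)\<^sup>2"
    using e1 by (simp add: power_mult_distrib)
  also have "\<dots> \<le> (vnorm y)\<^sup>2 * (vnorm ?w)\<^sup>2"
    using low[OF z] unfolding Kz by (intro mult_right_mono) auto
  finally have "((1 - e\<^sup>2) * (vnorm y)\<^sup>2) * (vnorm y)\<^sup>2 \<le> (vnorm ?w)\<^sup>2 * (vnorm y)\<^sup>2"
    by (simp add: power2_eq_square mult_ac)
  hence le: "(1 - e\<^sup>2) * (vnorm y)\<^sup>2 \<le> (vnorm ?w)\<^sup>2"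
    by (cases "vnorm y = 0") (auto simp: mult_le_cancel_right)
  have Py: "P *\<^sub>v y \<in> carrier_vec p" using P(1) y by auto
  have "(vnorm (P *\<^sub>v y - Q *\<^sub>v (Q\<^sup>T *\<^sub>v (P *\<^sub>v y))))\<^sup>2 \<le> (e * vnorm y)\<^sup>2"
    unfolding orthonormal_cols_complement_sq[OF Q Py] vnorm_orthonormal_cols[OF P y]
    using le unfolding KTv[OF y] by (simp add: power_mult_distrib algebra_simps)
  thus ?thesis unfolding e_def[symmetric] by (rule power2_le_imp_le) (use e in simp)
qed

text \<open>On vectors with Q^T A x = 0 the deflated matrix agrees with \<open>A\<close>. In the
  span of the first \<open>r + j\<close> right singular vectors of \<open>A\<close> these are only
  \<open>r\<close> equations, and \<open>A\<close> stretches that span by at least its singular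
  value of index \<open>r + j\<close>.\<close>

lemma sval_deflate_ge:
  assumes A: "A \<in> carrier_mat m n" and Q: "Q \<in> carrier_mat m r" and j: "1 \<le> j"
  shows "sval A (r + j) \<le> sval ((1\<^sub>m m - Q * Q\<^sup>T) * A) j"
proof (cases "r + j \<le> n")
  case False
  hence "sval A (r + j) = 0" using A by (simp add: sval_def)
  thus ?thesis by (simp add: sval_nonneg)
next
  case True
  define B where "B = (1\<^sub>m m - Q * Q\<^sup>T) * A"
  have B: "B \<in> carrier_mat m n" using A Q by (auto simp: B_def)
  obtain i where i: "j = Suc i" using j by (cases j) auto
  obtain U S V where svdA: "is_svd A U S V" using svd_exists by blast
  obtain U' S' V' where svdB: "is_svd B U' S' V'" using svd_exists by blast
  note D = is_svdD[OF svdA A]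
  define W where "W = first_cols (r + j) V"
  have W: "W \<in> carrier_mat n (r + j)" using D(3) by (simp add: W_def first_cols_carrier)
  have oW: "orthonormal_cols W" unfolding W_def by (rule orthonormal_cols_first_cols[OF D(3) True D(4)])
  define N where "N = Q\<^sup>T * (A * W)"
  have N: "N \<in> carrier_mat r (r + j)" using Q A W by (auto simp: N_def)
  have "svd_diag S (r + i) \<le> svd_diag S' i"
  proof (rule svd_maxmin[OF svdB B W _ N])
    fix c :: "real vec" assume c: "c \<in> carrier_vec (r + j)" "c \<noteq> 0\<^sub>v (r + j)"
    thus "W *\<^sub>v c \<noteq> 0\<^sub>v n"
      using vnorm_orthonormal_cols[OF W oW c(1)] vnorm_eq_0[OF c(1)] by auto
  next
    fix c assume c: "c \<in> carrier_vec (r + j)" "N *\<^sub>v c = 0\<^sub>v r"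
    let ?x = "W *\<^sub>v c"
    have x: "?x \<in> carrier_vec n" using W c by auto
    hence Ax: "A *\<^sub>v ?x \<in> carrier_vec m" using A by auto
    have "N *\<^sub>v c = Q\<^sup>T *\<^sub>v (A *\<^sub>v ?x)"
    proof -
      have "N *\<^sub>v c = Q\<^sup>T *\<^sub>v (A * W *\<^sub>v c)" unfolding N_def using Q A W c by (intro assoc_mult_mat_vec) auto
      also have "A * W *\<^sub>v c = A *\<^sub>v ?x" using A W c by (intro assoc_mult_mat_vec) auto
      finally show ?thesis .
    qed
    hence QAx: "Q\<^sup>T *\<^sub>v (A *\<^sub>v ?x) = 0\<^sub>v r" using c(2) by simp
    have "B *\<^sub>v ?x = (1\<^sub>m m - Q * Q\<^sup>T) *\<^sub>v (A *\<^sub>v ?x)"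
      unfolding B_def using Q A x by (intro assoc_mult_mat_vec) auto
    also have "\<dots> = A *\<^sub>v ?x - Q *\<^sub>v 0\<^sub>v r" by (simp only: complement_mult_vec[OF Q Ax] QAx)
    also have "Q *\<^sub>v 0\<^sub>v r = 0\<^sub>v m" using Q by (intro eq_vecI) auto
    also have "A *\<^sub>v ?x - 0\<^sub>v m = A *\<^sub>v ?x" using Ax by simp
    finally have Bx: "B *\<^sub>v ?x = A *\<^sub>v ?x" .
    define y where "y = vec n (\<lambda>i. if i < r + j then c $ i else 0)"
    have y: "y \<in> carrier_vec n" by (simp add: y_def)
    have xy: "?x = V *\<^sub>v y" unfolding W_def y_def by (rule first_cols_mult_vec[OF D(3) True c(1)])
    have "V\<^sup>T *\<^sub>v ?x = y" unfolding xy by (rule orthonormal_cols_mult_vec[OF D(3,4) y])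
    hence "svd_diag S (r + i) * vnorm ?x \<le> vnorm (A *\<^sub>v ?x)"
      by (intro svd_lower[OF svdA A x]) (simp add: y_def i)
    thus "svd_diag S (r + i) * vnorm ?x \<le> vnorm (B *\<^sub>v ?x)" by (simp only: Bx)
  qed (simp add: i)
  thus ?thesis unfolding B_def[symmetric] i
    using sval_eq_svd_diag[OF svdA, of "r + i"] sval_eq_svd_diag[OF svdB, of i] by simp
qed

text \<open>\<open>x\<close> is split along the right singular vectors of \<open>A\<close>. The
  leading \<open>r\<close> directions are mapped into the span of the leading left singular vectors,
  which \<open>Q\<close> captures up to \<open>e\<close>. The equations of the test space remove the
  next \<open>j - 1\<close> directions, so the rest is stretched by at most
  \<open>sval A (r + j)\<close>.\<close>

lemma sval_deflate_le:
  assumes A: "A \<in> carrier_mat m n" "n \<le> m" and svdA: "is_svd A U S V"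
    and Q: "Q \<in> carrier_mat m r" "orthonormal_cols Q" "r \<le> n" and j: "1 \<le> j"
    and e: "e = subspace_dist Q (first_cols r U)" "e < 1"
  shows "sval ((1\<^sub>m m - Q * Q\<^sup>T) * A) j \<le> sval A (r + j) + e * spec_norm A"
proof -
  define B where "B = (1\<^sub>m m - Q * Q\<^sup>T) * A"
  have B: "B \<in> carrier_mat m n" using A Q by (auto simp: B_def)
  obtain i where i: "j = Suc i" using j by (cases j) auto
  obtain U' S' V' where svdB: "is_svd B U' S' V'" using svd_exists by blast
  note D = is_svdD[OF svdA A(1)]
  have e0: "0 \<le> e" by (simp add: e subspace_dist_def)
  define P where "P = first_cols r U"
  have rm: "r \<le> m" using Q(3) A(2) by simp
  have P: "P \<in> carrier_mat m r" "orthonormal_cols P"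
    using first_cols_carrier[OF D(1)] orthonormal_cols_first_cols[OF D(1) rm D(2)] by (auto simp: P_def)
  have Bv: "B *\<^sub>v x = A *\<^sub>v x - Q *\<^sub>v (Q\<^sup>T *\<^sub>v (A *\<^sub>v x))" if x: "x \<in> carrier_vec n" for x
  proof -
    have Ax: "A *\<^sub>v x \<in> carrier_vec m" using A x by auto
    have "B *\<^sub>v x = (1\<^sub>m m - Q * Q\<^sup>T) *\<^sub>v (A *\<^sub>v x)"
      unfolding B_def using Q(1) A(1) x by (intro assoc_mult_mat_vec) auto
    thus ?thesis by (simp only: complement_mult_vec[OF Q(1) Ax])
  qed
  \<comment> \<open>Row \<open>k\<close> of \<open>N\<close> is the right singular vector
    \<open>r + k\<close>, counted from 0; beyond \<open>n\<close> it is an empty equation.\<close>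
  define N where "N = mat i n (\<lambda>(k,c). if r + k < n then V $$ (c, r + k) else 0)"
  have N: "N \<in> carrier_mat i n" by (simp add: N_def)
  have "svd_diag S' i \<le> svd_diag S (r + i) + e * spec_norm A"
  proof (rule svd_minmax[OF svdB B N])
    show "0 \<le> svd_diag S (r + i) + e * spec_norm A" using D(8) e0 by simp
    fix x :: "real vec" assume x: "x \<in> carrier_vec n" "N *\<^sub>v x = 0\<^sub>v i"
    define y where "y = V\<^sup>T *\<^sub>v x"
    have y: "y \<in> carrier_vec n" unfolding y_def using D(3) x(1) by (auto intro!: mult_mat_vec_carrier)
    have Vy: "V *\<^sub>v y = x"
      using orthonormal_cols_mult_vec[OF _ orthogonal_mat_transpose(2)[OF D(3,4)] x(1)] D(3) by (simp add: y_def)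
    have y0: "y $ (r + k) = 0" if "k < i" "r + k < n" for k
    proof -
      have "(N *\<^sub>v x) $ k = y $ (r + k)"
        using that x(1) D(3) by (simp add: N_def y_def scalar_prod_def)
      thus ?thesis using x(2) that by simp
    qed
    define y1 y2 where "y1 = vec n (\<lambda>k. if k < r then y $ k else 0)"
      and "y2 = vec n (\<lambda>k. if k < r then 0 else y $ k)"
    have y12: "y1 \<in> carrier_vec n" "y2 \<in> carrier_vec n" by (auto simp: y1_def y2_def)
    define x1 x2 where "x1 = V *\<^sub>v y1" and "x2 = V *\<^sub>v y2"
    have x12: "x1 \<in> carrier_vec n" "x2 \<in> carrier_vec n" unfolding x1_def x2_def using D(3) y12 by auto
    have "y = y1 + y2" using y by (intro eq_vecI) (auto simp: y1_def y2_def)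
    hence xx: "x = x1 + x2" unfolding x1_def x2_def
      using Vy mult_add_distrib_mat_vec[OF D(3) y12] by simp
    have nle: "vnorm x1 \<le> vnorm x" "vnorm x2 \<le> vnorm x"
    proof -
      have n: "vnorm x = vnorm y" "vnorm x1 = vnorm y1" "vnorm x2 = vnorm y2"
        using vnorm_orthonormal_cols[OF D(3,4) y] vnorm_orthonormal_cols[OF D(3,4) y12(1)]
          vnorm_orthonormal_cols[OF D(3,4) y12(2)] Vy by (simp_all add: x1_def x2_def)
      show "vnorm x1 \<le> vnorm x" "vnorm x2 \<le> vnorm x" unfolding n using y
        by (auto simp: vnorm_def y1_def y2_def intro!: sum_mono)
    qed
    define c where "c = vec r (\<lambda>k. svd_diag S k * y $ k)"
    have c: "c \<in> carrier_vec r" by (simp add: c_def)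
    have "A *\<^sub>v x1 = U *\<^sub>v vec m (\<lambda>i. if i < n then svd_diag S i * y1 $ i else 0)"
      unfolding x1_def by (rule svd_mult_V[OF svdA A(1) y12(1)])
    also have "vec m (\<lambda>i. if i < n then svd_diag S i * y1 $ i else 0)
        = vec m (\<lambda>i. if i < r then c $ i else 0)"
      using Q(3) by (intro eq_vecI) (auto simp: y1_def c_def)
    also have "U *\<^sub>v \<dots> = P *\<^sub>v c" unfolding P_def by (rule first_cols_mult_vec[OF D(1) rm c, symmetric])
    finally have Ax1: "A *\<^sub>v x1 = P *\<^sub>v c" .
    have cle: "vnorm c \<le> spec_norm A * vnorm x"
    proof -
      have "vnorm c = vnorm (A *\<^sub>v x1)" by (simp only: Ax1 vnorm_orthonormal_cols[OF P c])
      also have "\<dots> \<le> spec_norm A * vnorm x1" by (rule vnorm_mult_le[OF A(1) x12(1)])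
      also have "\<dots> \<le> spec_norm A * vnorm x" using nle by (intro mult_left_mono) auto
      finally show ?thesis .
    qed
    have B1: "vnorm (B *\<^sub>v x1) \<le> e * spec_norm A * vnorm x"
    proof -
      \<comment> \<open>The distance is given for \<open>Q\<close> against \<open>P\<close>, whereas
        the residual of a vector in the range of \<open>P\<close> is wanted: hence the swapped
        form.\<close>
      have "vnorm (B *\<^sub>v x1) \<le> e * vnorm c"
        unfolding Bv[OF x12(1)] Ax1 using subspace_dist_swap[OF Q(1,2) P _ c] e by (simp add: P_def)
      also have "\<dots> \<le> e * (spec_norm A * vnorm x)" using cle e0 by (rule mult_left_mono)
      finally show ?thesis by simp
    qed
    have B2: "vnorm (B *\<^sub>v x2) \<le> svd_diag S (r + i) * vnorm x"
    proof -
      have Ax2: "A *\<^sub>v x2 \<in> carrier_vec m" using A(1) x12 by auto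
      have Vx2: "V\<^sup>T *\<^sub>v x2 = y2" unfolding x2_def by (rule orthonormal_cols_mult_vec[OF D(3,4) y12(2)])
      have z: "y2 $ k = 0" if "k < r + i" "k < n" for k
        using y0[of "k - r"] that by (auto simp: y2_def)
      have "vnorm (B *\<^sub>v x2) \<le> vnorm (A *\<^sub>v x2)"
        unfolding Bv[OF x12(2)] by (rule complement_norm_le[OF Q(1,2) Ax2])
      also have "\<dots> \<le> svd_diag S (r + i) * vnorm x2"
        by (rule svd_upper[OF svdA A(1) x12(2)]) (simp only: Vx2 z)
      also have "\<dots> \<le> svd_diag S (r + i) * vnorm x" using nle D(8) by (intro mult_left_mono) auto
      finally show ?thesis .
    qed
    have "B *\<^sub>v x = B *\<^sub>v x1 + B *\<^sub>v x2" unfolding xx by (rule mult_add_distrib_mat_vec[OF B x12])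
    also have "vnorm \<dots> \<le> vnorm (B *\<^sub>v x1) + vnorm (B *\<^sub>v x2)"
      using B x12 by (intro vnorm_add[of _ m]) auto
    finally show "vnorm (B *\<^sub>v x) \<le> (svd_diag S (r + i) + e * spec_norm A) * vnorm x"
      using B1 B2 by (simp add: algebra_simps)
  qed simp
  thus ?thesis unfolding B_def[symmetric] i
    using sval_eq_svd_diag[OF svdA, of "r + i"] sval_eq_svd_diag[OF svdB, of i] by simp
qed

section \<open>Sketching with a power iteration\<close>

lemma vnorm_scale_le:
  assumes "v \<in> carrier_vec k" "0 \<le> t" "\<And>i. i < k \<Longrightarrow> \<bar>e i\<bar> \<le> t"
  shows "vnorm (vec k (\<lambda>i. e i * v $ i)) \<le> t * vnorm v"
proof (rule power2_le_imp_le)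
  have "(\<Sum>i<k. (e i * v $ i)\<^sup>2) \<le> (\<Sum>i<k. t\<^sup>2 * (v $ i)\<^sup>2)"
  proof (intro sum_mono)
    fix i assume "i \<in> {..<k}"
    hence "\<bar>e i\<bar>\<^sup>2 \<le> t\<^sup>2" using assms(3) by (intro power_mono) auto
    thus "(e i * v $ i)\<^sup>2 \<le> t\<^sup>2 * (v $ i)\<^sup>2" by (simp add: power_mult_distrib mult_right_mono)
  qed
  thus "(vnorm (vec k (\<lambda>i. e i * v $ i)))\<^sup>2 \<le> (t * vnorm v)\<^sup>2"
    using assms(1) by (simp add: vnorm_sq power_mult_distrib sum_distrib_left)
qed (use assms in simp)

text \<open>Orthogonality to the leading right singular vectors of \<open>B\<close> bounds the image
  under \<open>B\<close>, therefore the image under \<open>M\<close>, and min-max for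
  \<open>M\<close> concludes.\<close>

lemma sval_le_of_vnorm_le:
  assumes M: "M \<in> carrier_mat p n" and B: "B \<in> carrier_mat m n" and j: "1 \<le> j"
    and le: "\<And>x. x \<in> carrier_vec n \<Longrightarrow> vnorm (M *\<^sub>v x) \<le> vnorm (B *\<^sub>v x)"
  shows "sval M j \<le> sval B j"
proof (cases "j \<le> n")
  case False
  thus ?thesis using M sval_nonneg[of B j] by (simp add: sval_def)
next
  case True
  obtain i where i: "j = Suc i" using j by (cases j) auto
  obtain U S V where svdM: "is_svd M U S V" using svd_exists by blast
  obtain U' S' V' where svdB: "is_svd B U' S' V'" using svd_exists by blast
  note D = is_svdD[OF svdB B]
  have "svd_diag S i \<le> svd_diag S' i"
  proof (rule svd_minmax[OF svdM M])
    show "first_rows i (V'\<^sup>T) \<in> carrier_mat i n" using D(3) by (intro first_rows_carrier) auto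
    fix x :: "real vec" assume x: "x \<in> carrier_vec n" "first_rows i (V'\<^sup>T) *\<^sub>v x = 0\<^sub>v i"
    have "vnorm (B *\<^sub>v x) \<le> svd_diag S' i * vnorm x"
    proof (rule svd_upper[OF svdB B x(1)])
      fix k assume "k < i" "k < n"
      thus "(V'\<^sup>T *\<^sub>v x) $ k = 0"
        using first_rows_zeroD[OF _ x(1) x(2), of n k] D(3) True i by auto
    qed
    thus "vnorm (M *\<^sub>v x) \<le> svd_diag S' i * vnorm x" using le[OF x(1)] by linarith
  qed (use D(8) in auto)
  thus ?thesis unfolding i by (simp only: sval_eq_svd_diag[OF svdM] sval_eq_svd_diag[OF svdB])
qed

lemma mat_eq_by_mult_vec:
  fixes M N :: "real mat"
  assumes "M \<in> carrier_mat p r" "N \<in> carrier_mat p r"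
    and "\<And>x. x \<in> carrier_vec r \<Longrightarrow> M *\<^sub>v x = N *\<^sub>v x"
  shows "M = N"
proof (rule mat_col_eqI)
  fix j assume "j < dim_col N"
  hence j: "j < r" using assms by simp
  show "col M j = col N j"
    unfolding mult_unit_vec_col[OF assms(1) j, symmetric] mult_unit_vec_col[OF assms(2) j, symmetric]
    by (rule assms(3)) simp
qed (use assms in auto)

lemma mat_inv_props:
  assumes "M \<in> carrier_mat k k" "invertible_mat M"
  shows "mat_inv M \<in> carrier_mat k k" "M * mat_inv M = 1\<^sub>m k"
proof -
  have "\<exists>N. inverts_mat M N \<and> inverts_mat N M" using assms(2) by (auto simp: invertible_mat_def)
  hence *: "inverts_mat M (mat_inv M) \<and> inverts_mat (mat_inv M) M"
    unfolding mat_inv_def by (rule someI_ex)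
  hence 1: "M * mat_inv M = 1\<^sub>m k" and 2: "mat_inv M * M = 1\<^sub>m (dim_row (mat_inv M))"
    using assms(1) by (auto simp: inverts_mat_def)
  have "dim_col (mat_inv M) = k" using arg_cong[OF 1, of dim_col] by simp
  moreover have "dim_row (mat_inv M) = k" using arg_cong[OF 2, of dim_col] assms(1) by simp
  ultimately show "mat_inv M \<in> carrier_mat k k" by auto
  show "M * mat_inv M = 1\<^sub>m k" by fact
qed

lemma svd_diag_transpose [simp]: "svd_diag (S\<^sup>T) i = svd_diag S i"
  by (auto simp: svd_diag_def)

text \<open>The induction removes the factor next to \<open>B\<close>, which multiplies the right
  singular coordinates by the squared singular values; therefore \<open>y\<close> must be arbitrary
  in it.\<close>

lemma svd_power_mult_V:
  assumes svd: "is_svd B U S V" and B: "B \<in> carrier_mat m n" and nm: "n \<le> m" and y: "y \<in> carrier_vec n"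
  shows "((B * B\<^sup>T) ^\<^sub>m q * B) *\<^sub>v (V *\<^sub>v y) =
    U *\<^sub>v vec m (\<lambda>i. if i < n then svd_diag S i ^ (2 * q + 1) * y $ i else 0)"
  using y
proof (induction q arbitrary: y)
  case 0
  have "(B * B\<^sup>T) ^\<^sub>m 0 * B = B" using B by simp
  thus ?case using svd_mult_V[OF svd B 0] by (simp cong: if_cong)
next
  case (Suc q)
  note D = is_svdD[OF svd B]
  have BT: "B\<^sup>T \<in> carrier_mat n m" using B by simp
  have BBT: "B * B\<^sup>T \<in> carrier_mat m m" using B by auto
  have P: "(B * B\<^sup>T) ^\<^sub>m q \<in> carrier_mat m m" using BBT by (rule pow_carrier_mat)
  let ?x = "V *\<^sub>v y"
  have x: "?x \<in> carrier_vec n" using D(3) Suc.prems by auto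
  have Bx: "B *\<^sub>v ?x \<in> carrier_vec m" using B x by auto
  have BBx: "B\<^sup>T *\<^sub>v (B *\<^sub>v ?x) \<in> carrier_vec n" using BT Bx by (rule mult_mat_vec_carrier)
  define y' where "y' = vec n (\<lambda>i. (svd_diag S i)\<^sup>2 * y $ i)"
  have y': "y' \<in> carrier_vec n" by (simp add: y'_def)
  let ?z = "vec m (\<lambda>i. if i < n then svd_diag S i * y $ i else 0)"
  have "B\<^sup>T *\<^sub>v (U *\<^sub>v ?z) = V *\<^sub>v vec n (\<lambda>i. if i < m then svd_diag (S\<^sup>T) i * ?z $ i else 0)"
    by (rule svd_mult_V[OF is_svd_transpose[OF svd] BT]) simp
  also have "vec n (\<lambda>i. if i < m then svd_diag (S\<^sup>T) i * ?z $ i else 0) = y'"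
    using nm by (intro eq_vecI) (auto simp: y'_def power2_eq_square)
  finally have e: "B\<^sup>T *\<^sub>v (B *\<^sub>v ?x) = V *\<^sub>v y'" by (simp only: svd_mult_V[OF svd B Suc.prems])
  have "((B * B\<^sup>T) ^\<^sub>m Suc q * B) *\<^sub>v ?x = ((B * B\<^sup>T) ^\<^sub>m q * (B * B\<^sup>T)) *\<^sub>v (B *\<^sub>v ?x)"
    unfolding pow_mat.simps using P BBT B x by (intro assoc_mult_mat_vec) auto
  also have "\<dots> = (B * B\<^sup>T) ^\<^sub>m q *\<^sub>v (B * B\<^sup>T *\<^sub>v (B *\<^sub>v ?x))"
    by (rule assoc_mult_mat_vec[OF P BBT Bx])
  also have "B * B\<^sup>T *\<^sub>v (B *\<^sub>v ?x) = B *\<^sub>v (B\<^sup>T *\<^sub>v (B *\<^sub>v ?x))"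
    by (rule assoc_mult_mat_vec[OF B BT Bx])
  also have "(B * B\<^sup>T) ^\<^sub>m q *\<^sub>v (B *\<^sub>v (B\<^sup>T *\<^sub>v (B *\<^sub>v ?x))) = ((B * B\<^sup>T) ^\<^sub>m q * B) *\<^sub>v (B\<^sup>T *\<^sub>v (B *\<^sub>v ?x))"
    by (rule assoc_mult_mat_vec[OF P B BBx, symmetric])
  also have "\<dots> = ((B * B\<^sup>T) ^\<^sub>m q * B) *\<^sub>v (V *\<^sub>v y')" by (simp only: e)
  also have "\<dots> = U *\<^sub>v vec m (\<lambda>i. if i < n then svd_diag S i ^ (2 * q + 1) * y' $ i else 0)"
    by (rule Suc.IH[OF y'])
  also have "vec m (\<lambda>i. if i < n then svd_diag S i ^ (2 * q + 1) * y' $ i else 0) =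
    vec m (\<lambda>i. if i < n then svd_diag S i ^ (2 * Suc q + 1) * y $ i else 0)"
    by (intro eq_vecI) (auto simp: y'_def power2_eq_square)
  finally show ?case .
qed

lemma rows_from_carrier: "M \<in> carrier_mat p r \<Longrightarrow> rows_from k M \<in> carrier_mat (p - k) r"
  by (auto simp: rows_from_def)

lemma rows_from_mult_vec:
  assumes "M \<in> carrier_mat p r" "x \<in> carrier_vec r" "i < p - k"
  shows "(rows_from k M *\<^sub>v x) $ i = (M *\<^sub>v x) $ (i + k)"
  using assms by (auto simp: rows_from_def scalar_prod_def intro!: sum.cong)

section \<open>The sketch as a graph over the leading left singular vectors\<close>

context
  fixes B U S V \<Omega> Y T X :: "real mat" and m n b q :: nat and d :: "nat \<Rightarrow> real"
  assumes B: "B \<in> carrier_mat m n" and nm: "n \<le> m" and svd: "is_svd B U S V"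
    and b: "0 < b" "b \<le> n" and \<Omega>: "\<Omega> \<in> carrier_mat n b"
    and T: "T \<in> carrier_mat b b" "first_rows b (V\<^sup>T * \<Omega>) * T = 1\<^sub>m b"
    and d_def: "d = svd_diag S" and dpos: "0 < d (b - 1)"
    and Y_def: "Y = (B * B\<^sup>T) ^\<^sub>m q * B * \<Omega>"
    and X_def: "X = rows_from b (V\<^sup>T * \<Omega>) * T"
begin

lemmas svd_facts = is_svdD[OF svd B, folded d_def]

lemma d_pos: "i < b \<Longrightarrow> 0 < d i"
  using svd_facts(9)[of i "b - 1"] dpos by fastforce

lemma Ot_carrier: "V\<^sup>T * \<Omega> \<in> carrier_mat n b"
  using svd_facts(3) \<Omega> by auto

lemma X_carrier: "X \<in> carrier_mat (n - b) b"
  unfolding X_def using rows_from_carrier[OF Ot_carrier, of b] T(1) by auto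

lemma Y_carrier: "Y \<in> carrier_mat m b"
  unfolding Y_def using B \<Omega> pow_carrier_mat[of "B * B\<^sup>T" m q] by auto

text \<open>Composing with the inverse \<open>T\<close> of the leading block makes the leading
  coordinates a free parameter \<open>a\<close> and the trailing ones its image under
  \<open>X\<close>; the power iteration merely weights coordinate \<open>i\<close> by
  \<open>d i ^ (2 * q + 1)\<close>.\<close>

lemma sketch_mult_vec:
  assumes a: "a \<in> carrier_vec b"
  shows "Y *\<^sub>v (T *\<^sub>v a) = U *\<^sub>v vec m (\<lambda>i. if i < b then d i ^ (2 * q + 1) * a $ i
    else if i < n then d i ^ (2 * q + 1) * (X *\<^sub>v a) $ (i - b) else 0)"
proof -
  let ?c = "T *\<^sub>v a" and ?Ot = "V\<^sup>T * \<Omega>"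
  have c: "?c \<in> carrier_vec b" using T(1) a by auto
  have P: "(B * B\<^sup>T) ^\<^sub>m q * B \<in> carrier_mat m n" using B pow_carrier_mat[of "B * B\<^sup>T" m q] by auto
  have Oc: "\<Omega> *\<^sub>v ?c \<in> carrier_vec n" using \<Omega> c by auto
  define y where "y = ?Ot *\<^sub>v ?c"
  have y: "y \<in> carrier_vec n" unfolding y_def using Ot_carrier c by (rule mult_mat_vec_carrier)
  have "V *\<^sub>v y = \<Omega> *\<^sub>v ?c"
  proof -
    have "y = V\<^sup>T *\<^sub>v (\<Omega> *\<^sub>v ?c)" unfolding y_def using svd_facts(3) \<Omega> c by (intro assoc_mult_mat_vec) auto
    thus ?thesis using orthonormal_cols_mult_vec[OF _ orthogonal_mat_transpose(2)[OF svd_facts(3,4)] Oc, of n] svd_facts(3)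
      by simp
  qed
  hence "Y *\<^sub>v ?c = ((B * B\<^sup>T) ^\<^sub>m q * B) *\<^sub>v (V *\<^sub>v y)"
    unfolding Y_def by (simp only: assoc_mult_mat_vec[OF P \<Omega> c])
  also have "\<dots> = U *\<^sub>v vec m (\<lambda>i. if i < n then d i ^ (2 * q + 1) * y $ i else 0)"
    unfolding d_def by (rule svd_power_mult_V[OF svd B nm y])
  also have "vec m (\<lambda>i. if i < n then d i ^ (2 * q + 1) * y $ i else 0) =
     vec m (\<lambda>i. if i < b then d i ^ (2 * q + 1) * a $ i
    else if i < n then d i ^ (2 * q + 1) * (X *\<^sub>v a) $ (i - b) else 0)"
  proof -
    have y1: "y $ i = a $ i" if "i < b" for i
    proof -
      have "y $ i = (first_rows b ?Ot *\<^sub>v ?c) $ i"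
        unfolding y_def by (rule first_rows_mult_vec[OF Ot_carrier c that b(2), symmetric])
      also have "first_rows b ?Ot *\<^sub>v ?c = first_rows b ?Ot * T *\<^sub>v a"
        by (rule assoc_mult_mat_vec[OF first_rows_carrier[OF Ot_carrier] T(1) a, symmetric])
      also have "\<dots> = a" using T(2) a by simp
      finally show ?thesis .
    qed
    have y2: "y $ i = (X *\<^sub>v a) $ (i - b)" if "b \<le> i" "i < n" for i
    proof -
      have "X *\<^sub>v a = rows_from b ?Ot *\<^sub>v ?c"
        unfolding X_def by (rule assoc_mult_mat_vec[OF rows_from_carrier[OF Ot_carrier] T(1) a])
      hence "(X *\<^sub>v a) $ (i - b) = (?Ot *\<^sub>v ?c) $ (i - b + b)"
        using that by (simp only:) (rule rows_from_mult_vec[OF Ot_carrier c], simp)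
      thus ?thesis using that by (simp add: y_def)
    qed
    show ?thesis using y1 y2 b(2) by (intro eq_vecI) (auto simp del: index_mult_mat_vec)
  qed
  finally show ?thesis .
qed

text \<open>The graph map: in the basis \<open>U\<close> the leading coordinates are
  \<open>a\<close> itself and the trailing ones depend linearly on it. With D1 and D2 the diagonal
  matrices of leading and trailing singular values, the slope is D2^(2q+1) X D1^(-2q-1).\<close>

definition sketch_vec :: "real vec \<Rightarrow> real vec" where
  "sketch_vec a = U *\<^sub>v vec m (\<lambda>i. if i < b then a $ i else if i < n then
      d i ^ (2 * q + 1) * (X *\<^sub>v vec b (\<lambda>i. a $ i / d i ^ (2 * q + 1))) $ (i - b) else 0)"

lemma sketch_vec_eq:
  assumes "a \<in> carrier_vec b"
  shows "sketch_vec a = Y *\<^sub>v (T *\<^sub>v vec b (\<lambda>i. a $ i / d i ^ (2 * q + 1)))"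
proof -
  have "d i \<noteq> 0" if "i < b" for i using d_pos[OF that] by simp
  thus ?thesis unfolding sketch_vec_def
    by (subst sketch_mult_vec) (auto intro!: arg_cong[of _ _ "\<lambda>z. U *\<^sub>v z"] eq_vecI simp del: index_mult_mat_vec)
qed

lemma sketch_vec_colsp: "a \<in> carrier_vec b \<Longrightarrow> sketch_vec a \<in> colsp Y"
  unfolding sketch_vec_eq colsp_def using Y_carrier T(1) by auto

text \<open>Everything rests on the factorisation C B = (C E2) S2 (Z V^T), with \<open>C\<close> the
  projector off the sketch. The outer factors have spectral norm at most 1 and
  \<open>\<gamma>\<close>, so one factorisation serves both norms. The exponent is 4q and not 4q +
  2: one power of D1 cancels against the image of \<open>x\<close> under \<open>B\<close>, and one
  power of D2 is kept in \<open>S2\<close>.\<close>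

lemma sketch_error_bounds:
  assumes Q: "Q \<in> carrier_mat m k" "orthonormal_cols Q" "colsp Q = colsp Y"
  defines "\<gamma> \<equiv> sqrt (1 + (d b / d (b - 1)) ^ (4 * q) * (spec_norm X)\<^sup>2)"
  shows "spec_norm ((1\<^sub>m m - Q * Q\<^sup>T) * B) \<le> \<gamma> * spec_norm (trailing_block b S)"
    and "frob_norm ((1\<^sub>m m - Q * Q\<^sup>T) * B) \<le> \<gamma> * frob_norm (trailing_block b S)"
proof -
  define C where "C = 1\<^sub>m m - Q * Q\<^sup>T"
  have C: "C \<in> carrier_mat m m" using Q(1) by (auto simp: C_def)
  have Cv: "C *\<^sub>v x = x - Q *\<^sub>v (Q\<^sup>T *\<^sub>v x)" if "x \<in> carrier_vec m" for x
    unfolding C_def by (rule complement_mult_vec[OF Q(1) that])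
  have C0: "C *\<^sub>v x = 0\<^sub>v m" if xY: "x \<in> colsp Y" for x
  proof -
    obtain c where c: "c \<in> carrier_vec k" "x = Q *\<^sub>v c" 
      using xY Q(1) by (auto simp: Q(3)[symmetric] colsp_def[of Q])
    have x: "x \<in> carrier_vec m" using c Q(1) by auto
    show ?thesis unfolding Cv[OF x] using x by (simp only: c(2) orthonormal_cols_mult_vec[OF Q(1,2) c(1)]) simp
  qed
  define S2 where "S2 = trailing_block b S"
  have S2: "S2 \<in> carrier_mat (m - b) (n - b)" using svd_facts(5) by (auto simp: S2_def trailing_block_def)
  define E2 where "E2 = mat m (m - b) (\<lambda>(i,j). U $$ (i, b + j))"
  have E2: "E2 \<in> carrier_mat m (m - b)" by (simp add: E2_def)
  have E2v: "E2 *\<^sub>v w = U *\<^sub>v vec m (\<lambda>i. if i < b then 0 else w $ (i - b))"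
    if w: "w \<in> carrier_vec (m - b)" for w
  proof (intro eq_vecI)
    fix i assume "i < dim_vec (U *\<^sub>v vec m (\<lambda>i. if i < b then 0 else w $ (i - b)))"
    hence i: "i < m" using svd_facts(1) by simp
    let ?f = "\<lambda>j. U $$ (i,j) * (if j < b then 0 else w $ (j - b))"
    have "(U *\<^sub>v vec m (\<lambda>i. if i < b then 0 else w $ (i - b))) $ i = (\<Sum>j\<in>{0..<m}. ?f j)"
      using i svd_facts(1) by (simp add: scalar_prod_def)
    also have "\<dots> = (\<Sum>j\<in>{0..<b}. ?f j) + (\<Sum>j\<in>{b..<m}. ?f j)"
      using b nm by (intro sum.atLeastLessThan_concat[symmetric]) auto
    also have "(\<Sum>j\<in>{0..<b}. ?f j) = 0" by simp
    also have "(\<Sum>j\<in>{b..<m}. ?f j) = (\<Sum>j\<in>{0..<m - b}. ?f (j + b))"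
      using sum.shift_bounds_nat_ivl[of ?f 0 b "m - b"] b nm by simp
    also have "0 + \<dots> = (E2 *\<^sub>v w) $ i"
      using i w by (simp add: E2_def scalar_prod_def add.commute)
    finally show "(E2 *\<^sub>v w) $ i = (U *\<^sub>v vec m (\<lambda>i. if i < b then 0 else w $ (i - b))) $ i" by simp
  qed (use svd_facts(1) in \<open>simp add: E2_def\<close>)
  \<comment> \<open>The block row [-D2^(2q) X D1^(-2q), I], with D1 and D2 the leading and trailing
    singular values: what is left of the right singular coordinates once the graph vector has been
    subtracted.\<close>
  define Z where "Z = mat (n - b) n (\<lambda>(i,j). if j < b then - (d (i + b) ^ (2 * q) * X $$ (i,j) / d j ^ (2 * q))
     else if j = i + b then 1 else 0)"
  have Z: "Z \<in> carrier_mat (n - b) n" by (simp add: Z_def)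
  let ?w = "\<lambda>y. vec b (\<lambda>j. y $ j / d j ^ (2 * q))"
  have Zv: "(Z *\<^sub>v y) $ i = y $ (i + b) - d (i + b) ^ (2 * q) * (X *\<^sub>v ?w y) $ i"
    if y: "y \<in> carrier_vec n" and i: "i < n - b" for y i
  proof -
    let ?f = "\<lambda>j. Z $$ (i,j) * y $ j"
    have "(Z *\<^sub>v y) $ i = (\<Sum>j\<in>{0..<n}. ?f j)" using i y Z by (simp add: scalar_prod_def)
    also have "\<dots> = (\<Sum>j\<in>{0..<b}. ?f j) + (\<Sum>j\<in>{b..<n}. ?f j)"
      using b by (intro sum.atLeastLessThan_concat[symmetric]) auto
    also have "(\<Sum>j\<in>{b..<n}. ?f j) = (\<Sum>j\<in>{b..<n}. if j = i + b then y $ j else 0)"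
      using i by (intro sum.cong) (auto simp: Z_def)
    also have "\<dots> = y $ (i + b)" using i by simp
    also have "(\<Sum>j\<in>{0..<b}. ?f j) = (\<Sum>j\<in>{0..<b}. - (d (i + b) ^ (2 * q) * (X $$ (i,j) * (y $ j / d j ^ (2 * q)))))"
      using i b by (intro sum.cong) (auto simp: Z_def)
    also have "\<dots> = - (d (i + b) ^ (2 * q) * (X *\<^sub>v ?w y) $ i)"
      using i X_carrier by (simp add: sum_negf sum_distrib_left scalar_prod_def)
    finally show ?thesis by simp
  qed
  have spZ: "spec_norm Z \<le> \<gamma>"
  proof (rule spec_norm_le[OF Z])
    have "0 \<le> d b" using svd_facts(8) by simp
    show "0 \<le> \<gamma>" unfolding \<gamma>_def using \<open>0 \<le> d b\<close> dpos by simp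
    fix y :: "real vec" assume y: "y \<in> carrier_vec n"
    define y1 y2 where "y1 = vec b (\<lambda>i. y $ i)" and "y2 = vec (n - b) (\<lambda>i. y $ (i + b))"
    have y12: "y1 \<in> carrier_vec b" "y2 \<in> carrier_vec (n - b)" by (auto simp: y1_def y2_def)
    have ysq: "(vnorm y)\<^sup>2 = (vnorm y1)\<^sup>2 + (vnorm y2)\<^sup>2"
    proof -
      have "(vnorm y)\<^sup>2 = (\<Sum>j\<in>{0..<n}. (y $ j)\<^sup>2)" using y by (simp add: vnorm_sq atLeast0LessThan)
      also have "\<dots> = (\<Sum>j\<in>{0..<b}. (y $ j)\<^sup>2) + (\<Sum>j\<in>{b..<n}. (y $ j)\<^sup>2)"
        using b by (intro sum.atLeastLessThan_concat[symmetric]) auto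
      also have "(\<Sum>j\<in>{b..<n}. (y $ j)\<^sup>2) = (\<Sum>j\<in>{0..<n - b}. (y $ (j + b))\<^sup>2)"
        using sum.shift_bounds_nat_ivl[of "\<lambda>j. (y $ j)\<^sup>2" 0 b "n - b"] b by simp
      finally show ?thesis by (simp add: vnorm_sq y1_def y2_def atLeast0LessThan)
    qed
    define \<kappa> where "\<kappa> = (d b / d (b - 1)) ^ (2 * q) * spec_norm X"
    have \<kappa>: "0 \<le> \<kappa>" using \<open>0 \<le> d b\<close> dpos by (simp add: \<kappa>_def)
    have \<kappa>2: "\<kappa>\<^sup>2 = (d b / d (b - 1)) ^ (4 * q) * (spec_norm X)\<^sup>2"
      by (simp add: \<kappa>_def power_mult_distrib power_mult[symmetric])
    have w1: "vnorm (?w y) \<le> 1 / d (b - 1) ^ (2 * q) * vnorm y1"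
    proof -
      have "?w y = vec b (\<lambda>i. (1 / d i ^ (2 * q)) * y1 $ i)" by (intro eq_vecI) (auto simp: y1_def)
      also have "vnorm \<dots> \<le> 1 / d (b - 1) ^ (2 * q) * vnorm y1"
      proof (rule vnorm_scale_le[OF y12(1)])
        fix i assume i: "i < b"
        have "d (b - 1) \<le> d i" using svd_facts(9)[of i "b - 1"] i by simp
        hence "d (b - 1) ^ (2 * q) \<le> d i ^ (2 * q)" using dpos by (intro power_mono) auto
        thus "\<bar>1 / d i ^ (2 * q)\<bar> \<le> 1 / d (b - 1) ^ (2 * q)"
          using dpos d_pos[OF i] by (simp add: frac_le)
      qed (use dpos in simp)
      finally show ?thesis .
    qed
    define v where "v = vec (n - b) (\<lambda>i. - (d (i + b) ^ (2 * q)) * (X *\<^sub>v ?w y) $ i)"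
    have v: "v \<in> carrier_vec (n - b)" by (simp add: v_def)
    have Xw: "X *\<^sub>v ?w y \<in> carrier_vec (n - b)" using X_carrier by auto
    have "vnorm v \<le> d b ^ (2 * q) * vnorm (X *\<^sub>v ?w y)"
      unfolding v_def
    proof (rule vnorm_scale_le[OF Xw])
      fix i show "\<bar>- (d (i + b) ^ (2 * q))\<bar> \<le> d b ^ (2 * q)"
        using svd_facts(8)[of "i + b"] svd_facts(9)[of b "i + b"] by (simp add: power_mono)
    qed (use \<open>0 \<le> d b\<close> in simp)
    also have "\<dots> \<le> d b ^ (2 * q) * (spec_norm X * (1 / d (b - 1) ^ (2 * q) * vnorm y1))"
      using \<open>0 \<le> d b\<close> X_carrier w1
      by (intro mult_left_mono order_trans[OF vnorm_mult_le[OF X_carrier]]) auto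
    also have "\<dots> = \<kappa> * vnorm y1" by (simp add: \<kappa>_def power_divide)
    finally have v1: "vnorm v \<le> \<kappa> * vnorm y1" .
    have "Z *\<^sub>v y = y2 + v"
      using Z Zv[OF y] by (intro eq_vecI) (auto simp: y2_def v_def simp del: index_mult_mat_vec)
    hence "vnorm (Z *\<^sub>v y) \<le> vnorm y2 + \<kappa> * vnorm y1" using vnorm_add[OF y12(2) v] v1 by simp
    also have "\<dots> \<le> sqrt (1 + \<kappa>\<^sup>2) * vnorm y"
    proof (rule power2_le_imp_le)
      \<comment> \<open>Cauchy-Schwarz for (1, \<kappa>) against (|y2|, |y1|), in expanded
        form.\<close>
      have "0 \<le> (\<kappa> * vnorm y2 - vnorm y1)\<^sup>2" by simp
      hence "2 * (\<kappa> * vnorm y2) * vnorm y1 \<le> \<kappa>\<^sup>2 * (vnorm y2)\<^sup>2 + (vnorm y1)\<^sup>2"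
        unfolding power2_diff power_mult_distrib by linarith
      thus "(vnorm y2 + \<kappa> * vnorm y1)\<^sup>2 \<le> (sqrt (1 + \<kappa>\<^sup>2) * vnorm y)\<^sup>2"
        by (simp add: power_mult_distrib ysq) (simp add: power2_eq_square algebra_simps)
    qed simp
    finally show "vnorm (Z *\<^sub>v y) \<le> \<gamma> * vnorm y" by (simp add: \<gamma>_def \<kappa>2)
  qed
  have ZV: "Z * V\<^sup>T \<in> carrier_mat (n - b) n" using Z svd_facts(3) by auto
  have spV: "spec_norm (V\<^sup>T) \<le> 1"
    using vnorm_orthonormal_cols[OF _ orthogonal_mat_transpose(2)[OF svd_facts(3,4)], of n n] svd_facts(3)
    by (intro spec_norm_le[of _ n n]) auto
  have spZV: "spec_norm (Z * V\<^sup>T) \<le> \<gamma>"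
  proof -
    have "spec_norm (Z * V\<^sup>T) \<le> spec_norm Z * spec_norm (V\<^sup>T)" using Z svd_facts(3) by (intro spec_norm_mult) auto
    also have "\<dots> \<le> spec_norm Z * 1" by (intro mult_left_mono spV) simp
    finally show ?thesis using spZ by simp
  qed
  define G where "G = C * E2"
  have G: "G \<in> carrier_mat m (m - b)" using C E2 by (auto simp: G_def)
  have spG: "spec_norm G \<le> 1"
  proof (rule spec_norm_le[OF G])
    fix w :: "real vec" assume w: "w \<in> carrier_vec (m - b)"
    have E2w: "E2 *\<^sub>v w \<in> carrier_vec m" using E2 w by auto
    let ?w = "vec m (\<lambda>i. if i < b then 0 else w $ (i - b))"
    have "(vnorm ?w)\<^sup>2 = (vnorm w)\<^sup>2"
    proof -
      let ?f = "\<lambda>j. (if j < b then 0 else (w $ (j - b))\<^sup>2)"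
      have "(vnorm ?w)\<^sup>2 = (\<Sum>j\<in>{0..<m}. ?f j)" by (auto simp: vnorm_sq atLeast0LessThan intro!: sum.cong)
      also have "\<dots> = (\<Sum>j\<in>{0..<b}. ?f j) + (\<Sum>j\<in>{b..<m}. ?f j)"
        using b nm by (intro sum.atLeastLessThan_concat[symmetric]) auto
      also have "(\<Sum>j\<in>{b..<m}. ?f j) = (\<Sum>j\<in>{0..<m - b}. ?f (j + b))"
        using sum.shift_bounds_nat_ivl[of ?f 0 b "m - b"] b nm by simp
      finally show ?thesis using w by (simp add: vnorm_sq atLeast0LessThan)
    qed
    hence nw: "vnorm ?w = vnorm w" by (simp add: power2_eq_iff_nonneg)
    have "G *\<^sub>v w = C *\<^sub>v (E2 *\<^sub>v w)" unfolding G_def by (rule assoc_mult_mat_vec[OF C E2 w])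
    hence "vnorm (G *\<^sub>v w) \<le> vnorm (E2 *\<^sub>v w)"
      using complement_norm_le[OF Q(1,2) E2w] by (simp only: Cv[OF E2w])
    also have "\<dots> = vnorm w"
      unfolding E2v[OF w] using vnorm_orthonormal_cols[OF svd_facts(1,2), of ?w] nw by simp
    finally show "vnorm (G *\<^sub>v w) \<le> 1 * vnorm w" by simp
  qed simp
  have SZ: "S2 * (Z * V\<^sup>T) \<in> carrier_mat (m - b) n" using S2 ZV by auto
  have key: "C * B = G * (S2 * (Z * V\<^sup>T))"
  proof (rule mat_eq_by_mult_vec[of _ m n])
    show "C * B \<in> carrier_mat m n" using C B by auto
    show "G * (S2 * (Z * V\<^sup>T)) \<in> carrier_mat m n" using G SZ by auto
    fix x :: "real vec" assume x: "x \<in> carrier_vec n"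
    define y where "y = V\<^sup>T *\<^sub>v x"
    have y: "y \<in> carrier_vec n" unfolding y_def using svd_facts(3) x by (auto intro!: mult_mat_vec_carrier)
    define z where "z = Z *\<^sub>v y"
    have z: "z \<in> carrier_vec (n - b)" unfolding z_def using Z y by (rule mult_mat_vec_carrier)
    have S2z: "S2 *\<^sub>v z \<in> carrier_vec (m - b)" using S2 z by (rule mult_mat_vec_carrier)
    \<comment> \<open>The graph vector to subtract is the one whose leading coordinates in
      \<open>U\<close> are those of the image of \<open>x\<close> under \<open>B\<close>, so that
      only trailing coordinates survive.\<close>
    define a where "a = vec b (\<lambda>i. d i * y $ i)"
    have a: "a \<in> carrier_vec b" by (simp add: a_def)
    let ?h = "vec b (\<lambda>i. a $ i / d i ^ (2 * q + 1))"
    have h: "?h = ?w y"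
    proof (intro eq_vecI)
      fix i assume "i < dim_vec (?w y)"
      hence i: "i < b" by simp
      thus "?h $ i = ?w y $ i" using d_pos[OF i] by (simp add: a_def)
    qed simp
    let ?u = "vec m (\<lambda>i. if i < b then a $ i else if i < n then
      d i ^ (2 * q + 1) * (X *\<^sub>v ?h) $ (i - b) else 0)"
    let ?r = "vec m (\<lambda>i. if i < b then 0 else (S2 *\<^sub>v z) $ (i - b))"
    have S2zi: "(S2 *\<^sub>v z) $ i = (if i < n - b then d (i + b) * z $ i else 0)" if "i < m - b" for i
      using svd_diag_mult_vec[OF S2 z that, of "\<lambda>i. d (i + b)"] svd_facts(5,7) by (simp add: S2_def trailing_block_def)
    have dec: "vec m (\<lambda>i. if i < n then d i * y $ i else 0) = ?u + ?r"
    proof (intro eq_vecI)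
      fix i assume "i < dim_vec (?u + ?r)"
      hence i: "i < m" by simp
      consider "i < b" | "b \<le> i" "i < n" | "n \<le> i" by linarith
      thus "vec m (\<lambda>i. if i < n then d i * y $ i else 0) $ i = (?u + ?r) $ i"
      proof cases
        case 1
        thus ?thesis using i b by (simp add: a_def)
      next
        case 2
        hence lt: "i - b < m - b" "i - b < n - b" "i - b + b = i" using i by auto
        have "(S2 *\<^sub>v z) $ (i - b) = d i * z $ (i - b)" by (simp only: S2zi[OF lt(1)] lt(2,3) if_True)
        also have "z $ (i - b) = y $ i - d i ^ (2 * q) * (X *\<^sub>v ?w y) $ (i - b)"
          unfolding z_def by (simp only: Zv[OF y lt(2)] lt(3))
        finally have "(S2 *\<^sub>v z) $ (i - b) = d i * (y $ i - d i ^ (2 * q) * (X *\<^sub>v ?w y) $ (i - b))" .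
        thus ?thesis using 2 i unfolding h by (simp add: algebra_simps del: index_mult_mat_vec)
      next
        case 3
        hence "(S2 *\<^sub>v z) $ (i - b) = 0" using S2zi[of "i - b"] i b by auto
        thus ?thesis using 3 i b by (simp del: index_mult_mat_vec)
      qed
    qed simp
    have u: "U *\<^sub>v ?u \<in> carrier_vec m" and r: "U *\<^sub>v ?r \<in> carrier_vec m" 
      using svd_facts(1) by (auto intro!: mult_mat_vec_carrier)
    have Bx: "B *\<^sub>v x \<in> carrier_vec m" using B x by auto
    have "B *\<^sub>v x = U *\<^sub>v (?u + ?r)"
      using svd_mult_vec[OF svd B x] unfolding d_def[symmetric] y_def[symmetric] dec .
    also have "\<dots> = U *\<^sub>v ?u + U *\<^sub>v ?r" by (rule mult_add_distrib_mat_vec[OF svd_facts(1)]) auto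
    also have "U *\<^sub>v ?u = sketch_vec a" by (simp only: sketch_vec_def)
    also have "U *\<^sub>v ?r = E2 *\<^sub>v (S2 *\<^sub>v z)" by (rule E2v[OF S2z, symmetric])
    finally have Bxd: "B *\<^sub>v x = sketch_vec a + E2 *\<^sub>v (S2 *\<^sub>v z)" .
    have E: "E2 *\<^sub>v (S2 *\<^sub>v z) \<in> carrier_vec m" using E2 S2z by (rule mult_mat_vec_carrier)
    have sk: "sketch_vec a \<in> carrier_vec m" using u by (simp only: sketch_vec_def)
    have "C * B *\<^sub>v x = C *\<^sub>v (B *\<^sub>v x)" by (rule assoc_mult_mat_vec[OF C B x])
    also have "\<dots> = C *\<^sub>v sketch_vec a + C *\<^sub>v (E2 *\<^sub>v (S2 *\<^sub>v z))"
      unfolding Bxd by (rule mult_add_distrib_mat_vec[OF C sk E])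
    also have "C *\<^sub>v sketch_vec a = 0\<^sub>v m" by (rule C0[OF sketch_vec_colsp[OF a]])
    also have "0\<^sub>v m + C *\<^sub>v (E2 *\<^sub>v (S2 *\<^sub>v z)) = C *\<^sub>v (E2 *\<^sub>v (S2 *\<^sub>v z))"
      using mult_mat_vec_carrier[OF C E] by simp
    also have "\<dots> = G *\<^sub>v (S2 *\<^sub>v z)" unfolding G_def by (rule assoc_mult_mat_vec[OF C E2 S2z, symmetric])
    also have "S2 *\<^sub>v z = S2 * (Z * V\<^sup>T) *\<^sub>v x"
    proof -
      have "Z * V\<^sup>T *\<^sub>v x = z" unfolding z_def y_def using Z svd_facts(3) x by (intro assoc_mult_mat_vec) auto
      thus ?thesis using assoc_mult_mat_vec[OF S2 ZV x] by simp
    qed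
    also have "G *\<^sub>v (S2 * (Z * V\<^sup>T) *\<^sub>v x) = G * (S2 * (Z * V\<^sup>T)) *\<^sub>v x"
      by (rule assoc_mult_mat_vec[OF G SZ x, symmetric])
    finally show "C * B *\<^sub>v x = G * (S2 * (Z * V\<^sup>T)) *\<^sub>v x" .
  qed
  have "spec_norm (C * B) \<le> spec_norm G * spec_norm (S2 * (Z * V\<^sup>T))"
    unfolding key by (rule spec_norm_mult[OF G SZ])
  also have "\<dots> \<le> 1 * spec_norm (S2 * (Z * V\<^sup>T))" by (intro mult_right_mono spG) simp
  also have "\<dots> \<le> spec_norm S2 * spec_norm (Z * V\<^sup>T)" using spec_norm_mult[OF S2 ZV] by simp
  also have "\<dots> \<le> spec_norm S2 * \<gamma>" by (intro mult_left_mono spZV) simp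
  finally show "spec_norm ((1\<^sub>m m - Q * Q\<^sup>T) * B) \<le> \<gamma> * spec_norm (trailing_block b S)"
    by (simp add: C_def S2_def mult.commute)
  have "frob_norm (C * B) \<le> spec_norm G * frob_norm (S2 * (Z * V\<^sup>T))"
    unfolding key by (rule frob_norm_mult_left[OF G SZ])
  also have "\<dots> \<le> 1 * frob_norm (S2 * (Z * V\<^sup>T))" by (intro mult_right_mono spG) simp
  also have "\<dots> \<le> frob_norm S2 * spec_norm (Z * V\<^sup>T)" using frob_norm_mult_right[OF S2 ZV] by simp
  also have "\<dots> \<le> frob_norm S2 * \<gamma>" by (intro mult_left_mono spZV) simp
  finally show "frob_norm ((1\<^sub>m m - Q * Q\<^sup>T) * B) \<le> \<gamma> * frob_norm (trailing_block b S)"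
    by (simp add: C_def S2_def mult.commute)
qed

text \<open>The test vectors are graph vectors u over the first \<open>j\<close> coordinates, seen
  through Q^T. As they lie in the range of \<open>Q\<close>, nothing is lost: Q^T u has length |u|,
  and \<open>M\<close> maps it to B^T u. A graph vector over \<open>c\<close> has squared length at
  most (1 + \<eta>) |c|^2, while B^T u has length at least \<open>d l\<close> times |c|. The
  exponent is 4q + 2 because the slope enters with its full power 2q + 1, squared.\<close>

lemma sketch_sval_lower:
  assumes Q: "Q \<in> carrier_mat m k" "orthonormal_cols Q" "colsp Q = colsp Y" and j: "1 \<le> j" "j \<le> b"
  shows "d (j - 1) / sqrt (1 + (spec_norm X)\<^sup>2 * (d b / d (j - 1)) ^ (4 * q + 2)) \<le> sval (Q\<^sup>T * B) j"
proof -
  obtain l where l: "j = Suc l" using j by (cases j) auto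
  have dl: "0 < d l" using d_pos[of l] l j by simp
  have db: "0 \<le> d b" using svd_facts(8) by simp
  define \<eta> where "\<eta> = (spec_norm X)\<^sup>2 * (d b / d l) ^ (4 * q + 2)"
  have \<eta>: "0 \<le> \<eta>" using db dl by (simp add: \<eta>_def)
  define t where "t = d l / sqrt (1 + \<eta>)"
  have t0: "0 < t" using dl \<eta> by (simp add: t_def)
  define Lam where "Lam = mat b j (\<lambda>(i,c). if i = c then 1 / d i ^ (2 * q + 1) else 0)"
  have Lam: "Lam \<in> carrier_mat b j" by (simp add: Lam_def)
  have TL: "T * Lam \<in> carrier_mat b j" using T(1) Lam by auto
  have YTL: "Y * (T * Lam) \<in> carrier_mat m j" using Y_carrier TL by auto
  have QT: "Q\<^sup>T \<in> carrier_mat k m" using Q(1) by simp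
  define W where "W = Q\<^sup>T * (Y * (T * Lam))"
  have W: "W \<in> carrier_mat k j" using QT YTL by (auto simp: W_def)
  \<comment> \<open>Transposing keeps the singular values and moves the test space to the left side,
    where the range of \<open>Q\<close> lives.\<close>
  define M where "M = (Q\<^sup>T * B)\<^sup>T"
  have BT: "B\<^sup>T \<in> carrier_mat n m" using B by simp
  have Meq: "M = B\<^sup>T * Q" unfolding M_def using Q(1) B by (simp add: transpose_mult[of _ k m _ n])
  have M: "M \<in> carrier_mat n k" unfolding Meq using BT Q(1) by auto
  have main: "t * vnorm (W *\<^sub>v c) \<le> vnorm (M *\<^sub>v (W *\<^sub>v c)) \<and> vnorm c \<le> vnorm (W *\<^sub>v c)"
    if c: "c \<in> carrier_vec j" for c
  proof -
    \<comment> \<open>Support in the first \<open>j\<close> coordinates keeps the divisors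
      \<open>d i\<close> at least \<open>d l\<close>; this is why the bound involves the
      \<open>j\<close>-th singular value and not the \<open>b\<close>-th.\<close>
    define a where "a = vec b (\<lambda>i. if i < j then c $ i else 0)"
    have a: "a \<in> carrier_vec b" by (simp add: a_def)
    let ?h = "vec b (\<lambda>i. a $ i / d i ^ (2 * q + 1))"
    have Lc: "Lam *\<^sub>v c = ?h"
    proof (intro eq_vecI)
      fix i assume "i < dim_vec ?h"
      hence i: "i < b" by simp
      have "(Lam *\<^sub>v c) $ i = (if i < j then (1 / d i ^ (2 * q + 1)) * c $ i else 0)"
        by (rule svd_diag_mult_vec[OF Lam c i]) (use j in \<open>auto simp: Lam_def\<close>)
      thus "(Lam *\<^sub>v c) $ i = ?h $ i" using i by (simp add: a_def)
    qed (simp add: Lam_def)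
    define u where "u = sketch_vec a"
    have "Y * (T * Lam) *\<^sub>v c = Y *\<^sub>v (T * Lam *\<^sub>v c)" by (rule assoc_mult_mat_vec[OF Y_carrier TL c])
    also have "T * Lam *\<^sub>v c = T *\<^sub>v ?h" by (simp only: assoc_mult_mat_vec[OF T(1) Lam c] Lc)
    finally have YTLc: "Y * (T * Lam) *\<^sub>v c = u" by (simp only: u_def sketch_vec_eq[OF a])
    have u: "u \<in> carrier_vec m" unfolding YTLc[symmetric] using YTL c by (rule mult_mat_vec_carrier)
    have Wc: "W *\<^sub>v c = Q\<^sup>T *\<^sub>v u" unfolding W_def by (simp only: assoc_mult_mat_vec[OF QT YTL c] YTLc)
    have QQu: "Q *\<^sub>v (Q\<^sup>T *\<^sub>v u) = u"
    proof -
      have "u \<in> colsp Q" unfolding u_def Q(3) by (rule sketch_vec_colsp[OF a])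
      then obtain e where e: "e \<in> carrier_vec k" "u = Q *\<^sub>v e" using Q(1) by (auto simp: colsp_def)
      show ?thesis by (simp only: e(2) orthonormal_cols_mult_vec[OF Q(1,2) e(1)])
    qed
    have QTu: "Q\<^sup>T *\<^sub>v u \<in> carrier_vec k" using QT u by (rule mult_mat_vec_carrier)
    have nW: "vnorm (W *\<^sub>v c) = vnorm u"
      unfolding Wc using vnorm_orthonormal_cols[OF Q(1,2) QTu] by (simp only: QQu)
    have MW: "M *\<^sub>v (W *\<^sub>v c) = B\<^sup>T *\<^sub>v u"
      unfolding Meq Wc by (simp only: assoc_mult_mat_vec[OF BT Q(1) QTu] QQu)
    define z where "z = vec m (\<lambda>i. if i < b then a $ i else if i < n then
      d i ^ (2 * q + 1) * (X *\<^sub>v ?h) $ (i - b) else 0)"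
    have z: "z \<in> carrier_vec m" by (simp add: z_def)
    have uz: "u = U *\<^sub>v z" by (simp only: u_def sketch_vec_def z_def)
    have nu: "vnorm u = vnorm z" unfolding uz by (rule vnorm_orthonormal_cols[OF svd_facts(1,2) z])
    have nc: "(vnorm c)\<^sup>2 = (\<Sum>i<j. (c $ i)\<^sup>2)" using c by (simp add: vnorm_sq)
    let ?v = "vec (n - b) (\<lambda>i. d (i + b) ^ (2 * q + 1) * (X *\<^sub>v ?h) $ i)"
    have Xh: "X *\<^sub>v ?h \<in> carrier_vec (n - b)" using X_carrier by auto
    have sq: "(vnorm z)\<^sup>2 = (vnorm c)\<^sup>2 + (vnorm ?v)\<^sup>2"
    proof -
      have "(vnorm z)\<^sup>2 = (\<Sum>i\<in>{0..<m}. (z $ i)\<^sup>2)" using z by (simp add: vnorm_sq atLeast0LessThan)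
      also have "\<dots> = (\<Sum>i\<in>{0..<n}. (z $ i)\<^sup>2)"
        using nm b by (intro sum.mono_neutral_right) (auto simp: z_def)
      also have "\<dots> = (\<Sum>i\<in>{0..<b}. (z $ i)\<^sup>2) + (\<Sum>i\<in>{b..<n}. (z $ i)\<^sup>2)"
        using b by (intro sum.atLeastLessThan_concat[symmetric]) auto
      also have "(\<Sum>i\<in>{0..<b}. (z $ i)\<^sup>2) = (\<Sum>i<j. (c $ i)\<^sup>2)"
        using j b nm by (intro sum.mono_neutral_cong_right) (auto simp: z_def a_def)
      also have "(\<Sum>i\<in>{b..<n}. (z $ i)\<^sup>2) = (\<Sum>i\<in>{0..<n - b}. (z $ (i + b))\<^sup>2)"
        using sum.shift_bounds_nat_ivl[of "\<lambda>i. (z $ i)\<^sup>2" 0 b "n - b"] b by simp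
      also have "\<dots> = (\<Sum>i\<in>{0..<n - b}. (?v $ i)\<^sup>2)"
        using nm b by (intro sum.cong) (auto simp: z_def simp del: index_mult_mat_vec)
      also have "\<dots> = (vnorm ?v)\<^sup>2" by (simp only: vnorm_sq dim_vec atLeast0LessThan)
      finally show ?thesis by (simp add: nc)
    qed
    have "vnorm ?v \<le> d b ^ (2 * q + 1) * vnorm (X *\<^sub>v ?h)"
    proof (rule vnorm_scale_le[OF Xh])
      fix i show "\<bar>d (i + b) ^ (2 * q + 1)\<bar> \<le> d b ^ (2 * q + 1)"
        using svd_facts(8)[of "i + b"] svd_facts(9)[of b "i + b"] power_mono[of "d (i + b)" "d b" "2 * q + 1"] by simp
    qed (use db in simp)
    also have "\<dots> \<le> d b ^ (2 * q + 1) * (spec_norm X * vnorm ?h)"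
      using db by (intro mult_left_mono vnorm_mult_le[OF X_carrier]) auto
    also have "\<dots> \<le> d b ^ (2 * q + 1) * (spec_norm X * (1 / d l ^ (2 * q + 1) * vnorm a))"
    proof -
      have "?h = vec b (\<lambda>i. (if i < j then 1 / d i ^ (2 * q + 1) else 0) * a $ i)"
        by (intro eq_vecI) (auto simp: a_def)
      also have "vnorm \<dots> \<le> 1 / d l ^ (2 * q + 1) * vnorm a"
      proof (rule vnorm_scale_le[OF a])
        fix i assume i: "i < b"
        show "\<bar>if i < j then 1 / d i ^ (2 * q + 1) else 0\<bar> \<le> 1 / d l ^ (2 * q + 1)"
        proof (cases "i < j")
          case True
          hence "d l ^ (2 * q + 1) \<le> d i ^ (2 * q + 1)" using dl l svd_facts(9)[of i l] by (intro power_mono) auto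
          moreover have "0 < d l ^ (2 * q + 1)" using dl by (rule zero_less_power)
          ultimately show ?thesis using True d_pos[OF i] by (simp only: if_True abs_of_pos zero_less_divide_1_iff) (simp add: frac_le)
        qed (use dl in simp)
      qed (use dl in simp)
      finally show ?thesis using db by (intro mult_left_mono) auto
    qed
    finally have "vnorm ?v \<le> d b ^ (2 * q + 1) * (spec_norm X * (1 / d l ^ (2 * q + 1) * vnorm a))" .
    hence "vnorm ?v \<le> (d b / d l) ^ (2 * q + 1) * spec_norm X * vnorm a" by (simp add: power_divide mult_ac)
    hence "(vnorm ?v)\<^sup>2 \<le> ((d b / d l) ^ (2 * q + 1) * spec_norm X * vnorm a)\<^sup>2" by (intro power_mono) auto
    also have "\<dots> = ((d b / d l) ^ (2 * q + 1))\<^sup>2 * (spec_norm X)\<^sup>2 * (vnorm a)\<^sup>2" by (simp only: power_mult_distrib)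
    also have "((d b / d l) ^ (2 * q + 1))\<^sup>2 = (d b / d l) ^ (4 * q + 2)"
      by (simp only: power_mult[symmetric]) (simp add: algebra_simps)
    also have "(vnorm a)\<^sup>2 = (vnorm c)\<^sup>2"
    proof -
      have "(vnorm a)\<^sup>2 = (\<Sum>i<b. (a $ i)\<^sup>2)" using a by (simp add: vnorm_sq)
      also have "\<dots> = (\<Sum>i<j. (c $ i)\<^sup>2)" using j by (intro sum.mono_neutral_cong_right) (auto simp: a_def)
      finally show ?thesis by (simp add: nc)
    qed
    finally have v\<eta>: "(vnorm ?v)\<^sup>2 \<le> \<eta> * (vnorm c)\<^sup>2" by (simp add: \<eta>_def mult_ac)
    have low: "(d l)\<^sup>2 * (vnorm c)\<^sup>2 \<le> (vnorm (B\<^sup>T *\<^sub>v u))\<^sup>2"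
    proof -
      have "B\<^sup>T *\<^sub>v u = V *\<^sub>v vec n (\<lambda>i. if i < m then d i * z $ i else 0)"
        unfolding uz using svd_mult_V[OF is_svd_transpose[OF svd] BT z] by (simp only: svd_diag_transpose d_def)
      hence "(vnorm (B\<^sup>T *\<^sub>v u))\<^sup>2 = (vnorm (vec n (\<lambda>i. if i < m then d i * z $ i else 0)))\<^sup>2"
        using vnorm_orthonormal_cols[OF svd_facts(3,4)] by simp
      also have "\<dots> = (\<Sum>i<n. (d i * z $ i)\<^sup>2)" using nm by (auto simp: vnorm_sq intro!: sum.cong)
      finally have e: "(vnorm (B\<^sup>T *\<^sub>v u))\<^sup>2 = (\<Sum>i<n. (d i * z $ i)\<^sup>2)" .
      have "(d l)\<^sup>2 * (vnorm c)\<^sup>2 = (\<Sum>i<j. (d l)\<^sup>2 * (z $ i)\<^sup>2)"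
        unfolding nc sum_distrib_left using j b nm by (intro sum.cong) (auto simp: z_def a_def)
      also have "\<dots> \<le> (\<Sum>i<j. (d i * z $ i)\<^sup>2)"
        unfolding power_mult_distrib using dl l svd_facts(9)
        by (intro sum_mono mult_right_mono power_mono) auto
      also have "\<dots> \<le> (\<Sum>i<n. (d i * z $ i)\<^sup>2)" using j b by (intro sum_mono2) auto
      finally show ?thesis by (simp only: e)
    qed
    have "(t * vnorm u)\<^sup>2 = t\<^sup>2 * ((vnorm c)\<^sup>2 + (vnorm ?v)\<^sup>2)" by (simp only: power_mult_distrib nu sq)
    also have "\<dots> \<le> t\<^sup>2 * ((1 + \<eta>) * (vnorm c)\<^sup>2)" using v\<eta> by (intro mult_left_mono) (auto simp: algebra_simps)
    also have "\<dots> = (d l)\<^sup>2 * (vnorm c)\<^sup>2" using \<eta> by (simp add: t_def power_divide)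
    also note low
    finally have "t * vnorm u \<le> vnorm (B\<^sup>T *\<^sub>v u)" by (rule power2_le_imp_le) simp
    moreover have "vnorm c \<le> vnorm u" unfolding nu by (rule power2_le_imp_le) (simp_all add: sq)
    ultimately show ?thesis by (simp only: nW MW)
  qed
  obtain U' S' V' where svdM: "is_svd M U' S' V'" using svd_exists by blast
  have "t \<le> svd_diag S' l"
  \<comment> \<open>No extra equations: the test space has dimension \<open>j\<close>, one more than
    the index \<open>l\<close>.\<close>
  proof (rule svd_maxmin[OF svdM M W, of "0\<^sub>m 0 j" 0])
    fix c :: "real vec" assume c: "c \<in> carrier_vec j" "c \<noteq> 0\<^sub>v j"
    have "0 < vnorm c" using vnorm_eq_0[OF c(1)] c(2) vnorm_nonneg[of c] by linarith
    hence "vnorm (W *\<^sub>v c) \<noteq> 0" using main[OF c(1)] by linarith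
    thus "W *\<^sub>v c \<noteq> 0\<^sub>v k" by auto
  qed (use main l in auto)
  hence "t \<le> sval (Q\<^sup>T * B) j"
    using sval_eq_svd_diag[OF svdM, of l] unfolding l M_def sval_transpose by simp
  thus ?thesis unfolding t_def \<eta>_def l by simp
qed

end

section \<open>Gaussian measures\<close>

definition leb :: "'i set \<Rightarrow> ('i \<Rightarrow> real) measure" where
  "leb I = PiM I (\<lambda>_. lborel)"

definition gauss :: "'i set \<Rightarrow> ('i \<Rightarrow> real) measure" where
  "gauss I = PiM I (\<lambda>_. density lborel std_normal_density)"

lemma sets_leb [measurable_cong]: "sets (leb I) = sets (PiM I (\<lambda>_. borel :: real measure))"
  unfolding leb_def by (intro sets_PiM_cong) auto

lemma sets_gauss [measurable_cong]: "sets (gauss I) = sets (PiM I (\<lambda>_. borel :: real measure))"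
  unfolding gauss_def by (intro sets_PiM_cong) auto

lemma space_leb: "space (leb I) = extensional I"
  by (simp add: leb_def space_PiM PiE_def)

lemma space_gauss: "space (gauss I) = extensional I"
  by (simp add: gauss_def space_PiM PiE_def)

lemma gauss_prob_space: "prob_space (gauss I)"
  unfolding gauss_def by (auto intro!: prob_space_PiM prob_space_normal_density)

lemma leb_sigma_finite: "finite I \<Longrightarrow> sigma_finite_measure (leb I)"
proof -
  interpret product_sigma_finite "\<lambda>_. lborel :: real measure" by standard
  show "finite I \<Longrightarrow> ?thesis" unfolding leb_def by (rule sigma_finite)
qed

text \<open>Translations and reflections act coordinatewise, so their invariance follows from one
  dimension by testing boxes. Rotations mix coordinates and need a separate argument.\<close>

lemma leb_distr_coordinatewise:
  assumes fin: "finite I" and \<phi>: "\<And>i. i \<in> I \<Longrightarrow> distr lborel borel (\<phi> i) = (lborel :: real measure)"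
    and m: "\<And>i. i \<in> I \<Longrightarrow> \<phi> i \<in> borel_measurable borel"
  shows "distr (leb I) (leb I) (\<lambda>x. \<lambda>i\<in>I. \<phi> i (x i)) = leb I"
proof -
  interpret product_sigma_finite "\<lambda>_. lborel :: real measure" by standard
  have meas: "(\<lambda>x. \<lambda>i\<in>I. \<phi> i (x i)) \<in> measurable (PiM I (\<lambda>_. lborel)) (PiM I (\<lambda>_. lborel))"
    using m by (intro measurable_restrict measurable_compose[OF measurable_component_singleton]) auto
  show ?thesis unfolding leb_def
  proof (rule PiM_eqI[OF fin])
    fix A :: "'a \<Rightarrow> real set" assume A: "\<And>i. i \<in> I \<Longrightarrow> A i \<in> sets lborel"
    have vs: "\<phi> i -` A i \<in> sets borel" if "i \<in> I" for i
      using measurable_sets[OF m[OF that], of "A i"] A[OF that] by simp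
    have "emeasure (distr (PiM I (\<lambda>_. lborel)) (PiM I (\<lambda>_. lborel)) (\<lambda>x. \<lambda>i\<in>I. \<phi> i (x i))) (Pi\<^sub>E I A)
      = emeasure (PiM I (\<lambda>_. lborel)) ((\<lambda>x. \<lambda>i\<in>I. \<phi> i (x i)) -` Pi\<^sub>E I A \<inter> space (PiM I (\<lambda>_. lborel)))"
      using A fin by (intro emeasure_distr meas sets_PiM_I_finite) auto
    also have "(\<lambda>x. \<lambda>i\<in>I. \<phi> i (x i)) -` Pi\<^sub>E I A \<inter> space (PiM I (\<lambda>_. lborel)) = Pi\<^sub>E I (\<lambda>i. \<phi> i -` A i)"
      by (auto simp: space_PiM PiE_iff)
    also have "emeasure (PiM I (\<lambda>_. lborel)) (Pi\<^sub>E I (\<lambda>i. \<phi> i -` A i)) = (\<Prod>i\<in>I. emeasure lborel (\<phi> i -` A i))"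
      using vs by (intro emeasure_PiM fin) simp_all
    also have "\<dots> = (\<Prod>i\<in>I. emeasure lborel (A i))"
    proof (intro prod.cong refl)
      fix i assume i: "i \<in> I"
      have "emeasure lborel (A i) = emeasure (distr lborel borel (\<phi> i)) (A i)" by (simp add: \<phi>[OF i])
      also have "\<dots> = emeasure lborel (\<phi> i -` A i)" using A[OF i] m[OF i] by (subst emeasure_distr) auto
      finally show "emeasure lborel (\<phi> i -` A i) = emeasure lborel (A i)" by simp
    qed
    finally show "emeasure (distr (PiM I (\<lambda>_. lborel)) (PiM I (\<lambda>_. lborel)) (\<lambda>x. \<lambda>i\<in>I. \<phi> i (x i))) (Pi\<^sub>E I A)
      = (\<Prod>i\<in>I. emeasure lborel (A i))" .
  qed simp
qed

lemma nn_integral_leb_coordinatewise: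
  assumes fin: "finite I" and \<phi>: "\<And>i. i \<in> I \<Longrightarrow> distr lborel borel (\<phi> i) = (lborel :: real measure)"
    and m: "\<And>i. i \<in> I \<Longrightarrow> \<phi> i \<in> borel_measurable borel"
    and f: "f \<in> borel_measurable (leb I)"
  shows "(\<integral>\<^sup>+x. f (\<lambda>i\<in>I. \<phi> i (x i)) \<partial>leb I) = (\<integral>\<^sup>+x. f x \<partial>leb I)"
proof -
  have meas: "(\<lambda>x. \<lambda>i\<in>I. \<phi> i (x i)) \<in> measurable (leb I) (leb I)" unfolding leb_def
    using m by (intro measurable_restrict measurable_compose[OF measurable_component_singleton]) auto
  have "(\<integral>\<^sup>+x. f x \<partial>distr (leb I) (leb I) (\<lambda>x. \<lambda>i\<in>I. \<phi> i (x i))) = (\<integral>\<^sup>+x. f (\<lambda>i\<in>I. \<phi> i (x i)) \<partial>leb I)"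
    by (rule nn_integral_distr[OF meas]) (simp add: f)
  thus ?thesis by (simp only: leb_distr_coordinatewise[OF fin \<phi> m])
qed

lemma nn_integral_leb_translate:
  assumes "finite I" "f \<in> borel_measurable (leb I)"
  shows "(\<integral>\<^sup>+x. f (\<lambda>i\<in>I. x i + v i) \<partial>leb I) = (\<integral>\<^sup>+x. f x \<partial>leb I)"
  by (rule nn_integral_leb_coordinatewise[OF assms(1) _ _ assms(2)])
    (simp_all add: lborel_distr_plus[of "v _", unfolded fun_eq_iff] add.commute[of _ "v _"])

lemma nn_integral_leb_reflect:
  assumes "finite I" "f \<in> borel_measurable (leb I)"
  shows "(\<integral>\<^sup>+x. f (\<lambda>i\<in>I. v i - x i) \<partial>leb I) = (\<integral>\<^sup>+x. f x \<partial>leb I)"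
proof (rule nn_integral_leb_coordinatewise[OF assms(1) _ _ assms(2)])
  fix i
  have "distr lborel borel (\<lambda>x. v i - x) = distr (distr lborel borel uminus) borel ((+) (v i))"
    by (subst distr_distr) (auto simp: comp_def)
  thus "distr lborel borel (\<lambda>x. v i - x) = lborel" by (simp add: lborel_distr_uminus lborel_distr_plus)
qed simp

definition gauss_density :: "'i set \<Rightarrow> ('i \<Rightarrow> real) \<Rightarrow> ennreal" where
  "gauss_density I x = (\<Prod>i\<in>I. ennreal (std_normal_density (x i)))"

lemma gauss_density_measurable [measurable]: "gauss_density I \<in> borel_measurable (PiM I (\<lambda>_. borel))"
  unfolding gauss_density_def by measurable

text \<open>The product density sees only the Euclidean length, which is all that rotation
  invariance of the Gaussian measure needs beyond that of Lebesgue measure.\<close>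

lemma gauss_density_cong:
  assumes "(\<Sum>i\<in>I. (x i)\<^sup>2) = (\<Sum>i\<in>I. (y i)\<^sup>2)"
  shows "gauss_density I x = gauss_density I y"
proof -
  have *: "gauss_density I x = ennreal ((1 / sqrt (2 * pi)) ^ card I * exp (- (\<Sum>i\<in>I. (x i)\<^sup>2) / 2))" for x
  proof (cases "finite I")
    case True
    have "gauss_density I x = ennreal (\<Prod>i\<in>I. std_normal_density (x i))"
      unfolding gauss_density_def by (rule prod_ennreal) simp
    also have "(\<Prod>i\<in>I. std_normal_density (x i)) = (1 / sqrt (2 * pi)) ^ card I * exp (\<Sum>i\<in>I. - (x i)\<^sup>2 / 2)"
      unfolding std_normal_density_def by (simp only: prod.distrib prod_constant exp_sum[OF True])
    finally show ?thesis by (simp add: sum_negf sum_divide_distrib)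
  qed (simp add: gauss_density_def)
  show ?thesis unfolding * assms ..
qed

lemma gauss_eq_density:
  assumes fin: "finite I"
  shows "gauss I = density (leb I) (gauss_density I)"
  unfolding gauss_def
proof -
  interpret L: product_sigma_finite "\<lambda>_. lborel :: real measure" by standard
  interpret N: prob_space "density lborel std_normal_density" by (auto intro!: prob_space_normal_density)
  interpret G: product_sigma_finite "\<lambda>_. density lborel std_normal_density" by standard
  show "PiM I (\<lambda>_. density lborel std_normal_density) = density (leb I) (gauss_density I)"
  proof (rule G.PiM_eqI[symmetric, OF fin])
    show "sets (density (leb I) (gauss_density I)) = sets (PiM I (\<lambda>_. density lborel (\<lambda>x. ennreal (std_normal_density x))))"
      by (simp add: sets_leb) (intro sets_PiM_cong, auto)
    fix A :: "'a \<Rightarrow> real set"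
    assume "\<And>i. i \<in> I \<Longrightarrow> A i \<in> sets (density lborel (\<lambda>x. ennreal (std_normal_density x)))"
    hence A: "\<And>i. i \<in> I \<Longrightarrow> A i \<in> sets borel" by simp
    have sA: "Pi\<^sub>E I A \<in> sets (leb I)" unfolding sets_leb using A fin by (intro sets_PiM_I_finite) auto
    have "emeasure (density (leb I) (gauss_density I)) (Pi\<^sub>E I A) = (\<integral>\<^sup>+x. gauss_density I x * indicator (Pi\<^sub>E I A) x \<partial>leb I)"
      by (rule emeasure_density[OF _ sA]) measurable
    also have "\<dots> = (\<integral>\<^sup>+x. (\<Prod>i\<in>I. ennreal (std_normal_density (x i)) * indicator (A i) (x i)) \<partial>leb I)"
    proof (rule nn_integral_cong)
      fix x assume "x \<in> space (leb I)"
      hence x: "x \<in> extensional I" by (simp add: space_leb)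
      have "(\<Prod>i\<in>I. indicator (A i) (x i)) = (indicator (Pi\<^sub>E I A) x :: ennreal)"
        using fin x by (auto simp: indicator_def PiE_iff prod_zero_iff)
      thus "gauss_density I x * indicator (Pi\<^sub>E I A) x =
        (\<Prod>i\<in>I. ennreal (std_normal_density (x i)) * indicator (A i) (x i))"
        by (simp add: gauss_density_def prod.distrib)
    qed
    also have "\<dots> = (\<Prod>i\<in>I. \<integral>\<^sup>+x. ennreal (std_normal_density x) * indicator (A i) x \<partial>lborel)"
      unfolding leb_def using A fin by (intro L.product_nn_integral_prod) auto
    also have "\<dots> = (\<Prod>i\<in>I. emeasure (density lborel (\<lambda>x. ennreal (std_normal_density x))) (A i))"
      using A by (intro prod.cong refl) (simp add: emeasure_density)
    finally show "emeasure (density (leb I) (gauss_density I)) (Pi\<^sub>E I A) =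
      (\<Prod>i\<in>I. emeasure (density lborel (\<lambda>x. ennreal (std_normal_density x))) (A i))" .
  qed
qed

lemma nn_integral_gauss_leb:
  assumes "finite I" and [measurable]: "f \<in> borel_measurable (PiM I (\<lambda>_. borel))"
  shows "(\<integral>\<^sup>+x. f x \<partial>gauss I) = (\<integral>\<^sup>+x. gauss_density I x * f x \<partial>leb I)"
  unfolding gauss_eq_density[OF assms(1)] by (rule nn_integral_density) measurable

text \<open>The Fubini computation behind the uniqueness of Haar measure, with the Gaussian weight as the
  test function that fixes the constant.\<close>

lemma gauss_rotation_invariant:
  fixes R R' :: "('i \<Rightarrow> real) \<Rightarrow> 'i \<Rightarrow> real"
  assumes fin: "finite I"
    and Rm [measurable]: "R \<in> measurable (PiM I (\<lambda>_. borel)) (PiM I (\<lambda>_. borel))"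
    and R': "\<And>y. y \<in> extensional I \<Longrightarrow> R' y \<in> extensional I \<and> R (R' y) = y"
    and add: "\<And>x y. x \<in> extensional I \<Longrightarrow> y \<in> extensional I \<Longrightarrow>
      R (\<lambda>i\<in>I. x i + y i) = (\<lambda>i\<in>I. R x i + R y i)"
    and norm: "\<And>x. x \<in> extensional I \<Longrightarrow> (\<Sum>i\<in>I. (R x i)\<^sup>2) = (\<Sum>i\<in>I. (x i)\<^sup>2)"
    and f [measurable]: "f \<in> borel_measurable (PiM I (\<lambda>_. borel))"
  shows "(\<integral>\<^sup>+x. f (R x) \<partial>gauss I) = (\<integral>\<^sup>+x. f x \<partial>gauss I)"
proof -
  let ?g = "gauss_density I"
  interpret L: sigma_finite_measure "leb I" by (rule leb_sigma_finite[OF fin])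
  interpret LL: pair_sigma_finite "leb I" "leb I" by standard
  interpret G: prob_space "gauss I" by (rule gauss_prob_space)
  have g1: "(\<integral>\<^sup>+x. ?g x \<partial>leb I) = 1"
    using nn_integral_gauss_leb[OF fin, of "\<lambda>_. 1"] G.emeasure_space_1 by simp
  have gR: "?g (R x) = ?g x" if "x \<in> space (leb I)" for x
    using gauss_density_cong[OF norm] that by (simp add: space_leb)
  have Rs: "R x \<in> extensional I" if "x \<in> extensional I" for x
    using measurable_space[OF Rm, of x] that by (simp add: space_PiM PiE_def)
  \<comment> \<open>Invariance of Lebesgue measure is derived from its translations and reflections:
    the weight \<open>?g\<close> of mass 1 is inserted, and shifts move the map \<open>R\<close>
    from \<open>F\<close> onto the weight, which does not see it.\<close>
  have leb_inv: "(\<integral>\<^sup>+x. F (R x) \<partial>leb I) = (\<integral>\<^sup>+x. F x \<partial>leb I)"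
    if F [measurable]: "F \<in> borel_measurable (PiM I (\<lambda>_. borel))" for F
  proof -
    have Fl: "F \<in> borel_measurable (leb I)" and gl: "?g \<in> borel_measurable (leb I)" by measurable
    have "(\<integral>\<^sup>+x. F (R x) \<partial>leb I) = (\<integral>\<^sup>+x. F (R x) * (\<integral>\<^sup>+y. ?g y \<partial>leb I) \<partial>leb I)"
      by (simp add: g1)
    also have "\<dots> = (\<integral>\<^sup>+x. F (R x) * (\<integral>\<^sup>+y. ?g (\<lambda>i\<in>I. y i + R x i) \<partial>leb I) \<partial>leb I)"
      by (simp add: nn_integral_leb_translate[OF fin gl])
    also have "\<dots> = (\<integral>\<^sup>+x. (\<integral>\<^sup>+y. F (R x) * ?g (\<lambda>i\<in>I. y i + R x i) \<partial>leb I) \<partial>leb I)"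
      by (intro nn_integral_cong nn_integral_cmult[symmetric]) measurable
    also have "\<dots> = (\<integral>\<^sup>+y. (\<integral>\<^sup>+x. F (R x) * ?g (\<lambda>i\<in>I. y i + R x i) \<partial>leb I) \<partial>leb I)"
      by (rule LL.Fubini'[symmetric]) measurable
    also have "\<dots> = (\<integral>\<^sup>+y. (\<integral>\<^sup>+x. F (\<lambda>i\<in>I. R x i - y i) * ?g (R x) \<partial>leb I) \<partial>leb I)"
    proof (rule nn_integral_cong)
      fix y assume "y \<in> space (leb I)"
      hence y: "y \<in> extensional I" by (simp add: space_leb)
      \<comment> \<open>Shifting \<open>x\<close> by a preimage of the reflected \<open>y\<close>
        turns \<open>R x\<close> into its difference with \<open>y\<close>, so \<open>y\<close>
        passes from the weight to \<open>F\<close>.\<close>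
      define w where "w = R' (\<lambda>i\<in>I. - y i)"
      have w: "w \<in> extensional I" "R w = (\<lambda>i\<in>I. - y i)" using R' by (auto simp: w_def)
      let ?H = "\<lambda>x. F (R x) * ?g (\<lambda>i\<in>I. y i + R x i)"
      have "(\<integral>\<^sup>+x. ?H x \<partial>leb I) = (\<integral>\<^sup>+x. ?H (\<lambda>i\<in>I. x i + w i) \<partial>leb I)"
        by (rule nn_integral_leb_translate[OF fin, symmetric]) measurable
      also have "\<dots> = (\<integral>\<^sup>+x. F (\<lambda>i\<in>I. R x i - y i) * ?g (R x) \<partial>leb I)"
      proof (rule nn_integral_cong)
        fix x assume "x \<in> space (leb I)"
        hence x: "x \<in> extensional I" by (simp add: space_leb)
        have 1: "R (\<lambda>i\<in>I. x i + w i) = (\<lambda>i\<in>I. R x i - y i)"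
          unfolding add[OF x w(1)] w(2) by (intro restrict_ext) simp
        have 2: "(\<lambda>i\<in>I. y i + (\<lambda>i\<in>I. R x i - y i) i) = R x"
          using Rs[OF x] by (intro extensionalityI[of _ I]) auto
        show "?H (\<lambda>i\<in>I. x i + w i) = F (\<lambda>i\<in>I. R x i - y i) * ?g (R x)" unfolding 1 2 ..
      qed
      finally show "(\<integral>\<^sup>+x. ?H x \<partial>leb I) = (\<integral>\<^sup>+x. F (\<lambda>i\<in>I. R x i - y i) * ?g (R x) \<partial>leb I)" .
    qed
    also have "\<dots> = (\<integral>\<^sup>+x. (\<integral>\<^sup>+y. F (\<lambda>i\<in>I. R x i - y i) * ?g (R x) \<partial>leb I) \<partial>leb I)"
      by (rule LL.Fubini') measurable
    also have "\<dots> = (\<integral>\<^sup>+x. (\<integral>\<^sup>+y. F (\<lambda>i\<in>I. R x i - y i) \<partial>leb I) * ?g (R x) \<partial>leb I)"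
      by (intro nn_integral_cong nn_integral_multc) measurable
    also have "\<dots> = (\<integral>\<^sup>+x. (\<integral>\<^sup>+y. F y \<partial>leb I) * ?g x \<partial>leb I)"
      using gR by (intro nn_integral_cong) (simp add: nn_integral_leb_reflect[OF fin Fl])
    also have "\<dots> = (\<integral>\<^sup>+y. F y \<partial>leb I)" by (simp add: nn_integral_cmult gl g1)
    finally show ?thesis .
  qed
  have "(\<integral>\<^sup>+x. f (R x) \<partial>gauss I) = (\<integral>\<^sup>+x. ?g x * f (R x) \<partial>leb I)"
    by (rule nn_integral_gauss_leb[OF fin]) measurable
  also have "\<dots> = (\<integral>\<^sup>+x. ?g (R x) * f (R x) \<partial>leb I)"
    using gR by (intro nn_integral_cong) simp
  also have "\<dots> = (\<integral>\<^sup>+x. ?g x * f x \<partial>leb I)" by (rule leb_inv) measurable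
  also have "\<dots> = (\<integral>\<^sup>+x. f x \<partial>gauss I)" by (rule nn_integral_gauss_leb[OF fin f, symmetric])
  finally show ?thesis .
qed

section \<open>Gaussian matrices under orthogonal multiplication\<close>

lemma gauss_space_eq: "gauss_space n b = gauss ({0..<n} \<times> {0..<b})"
  by (simp add: gauss_space_def gauss_def)

text \<open>Inverse of \<open>gauss_mat\<close> on extensional functions; the restriction keeps the
  values inside the product space.\<close>

definition unmat :: "nat \<Rightarrow> nat \<Rightarrow> real mat \<Rightarrow> nat \<times> nat \<Rightarrow> real" where
  "unmat n b M = (\<lambda>p\<in>{0..<n} \<times> {0..<b}. M $$ p)"

lemma gauss_mat_carrier [simp]: "gauss_mat n b x \<in> carrier_mat n b"
  by (simp add: gauss_mat_def)

lemma gauss_mat_unmat: "M \<in> carrier_mat n b \<Longrightarrow> gauss_mat n b (unmat n b M) = M"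
  by (intro eq_matI) (auto simp: gauss_mat_def unmat_def)

lemma unmat_gauss_mat: "x \<in> extensional ({0..<n} \<times> {0..<b}) \<Longrightarrow> unmat n b (gauss_mat n b x) = x"
  by (rule extensionalityI[of _ "{0..<n} \<times> {0..<b}"]) (auto simp: gauss_mat_def unmat_def)

lemma sum_sq_gauss_mat:
  "(\<Sum>p\<in>{0..<n} \<times> {0..<b}. (x p)\<^sup>2) = (frob_norm (gauss_mat n b x))\<^sup>2"
proof -
  have "(frob_norm (gauss_mat n b x))\<^sup>2 = (\<Sum>i<n. \<Sum>j<b. (gauss_mat n b x $$ (i,j))\<^sup>2)"
    unfolding frob_norm_def by (simp add: sum_nonneg gauss_mat_def)
  also have "\<dots> = (\<Sum>i<n. \<Sum>j<b. (x (i,j))\<^sup>2)"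
    by (intro sum.cong refl) (simp add: gauss_mat_def)
  finally show ?thesis by (simp add: sum.cartesian_product atLeast0LessThan)
qed

lemma frob_norm_orthonormal_mult:
  assumes "R \<in> carrier_mat n n" "orthonormal_cols R" "M \<in> carrier_mat n b"
  shows "(frob_norm (R * M))\<^sup>2 = (frob_norm M)\<^sup>2"
  unfolding frob_norm_sq_cols
proof (rule sum.cong)
  fix j assume "j \<in> {..<dim_col M}"
  hence j: "j < b" using assms by simp
  have c: "col M j \<in> carrier_vec n" using assms by auto
  have "col (R * M) j = R *\<^sub>v col M j" by (rule col_mult2[OF assms(1,3) j])
  thus "(vnorm (col (R * M) j))\<^sup>2 = (vnorm (col M j))\<^sup>2"
    by (simp only: vnorm_orthonormal_cols[OF assms(1,2) c])
qed simp

lemma left_mult_measurable: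
  assumes "R \<in> carrier_mat n n"
  shows "(\<lambda>x. unmat n b (R * gauss_mat n b x)) \<in>
    PiM ({0..<n} \<times> {0..<b}) (\<lambda>_. borel) \<rightarrow>\<^sub>M PiM ({0..<n} \<times> {0..<b}) (\<lambda>_. borel)"
    unfolding unmat_def
  proof (rule measurable_restrict)
    fix p assume "p \<in> ({0..<n} \<times> {0..<b})"
    then obtain i j where p: "p = (i,j)" "i < n" "j < b" by auto
    have e: "(R * gauss_mat n b x) $$ p = (\<Sum>k\<in>{0..<n}. R $$ (i,k) * x (k,j))" for x
      using p assms by (simp add: gauss_mat_def scalar_prod_def)
    show "(\<lambda>x. (R * gauss_mat n b x) $$ p) \<in> borel_measurable (PiM ({0..<n} \<times> {0..<b}) (\<lambda>_. borel))"
      unfolding e using p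
      by (intro borel_measurable_sum borel_measurable_times borel_measurable_const measurable_component_singleton) auto
  qed

text \<open>The sum of squares over all entries is the squared Frobenius norm, so left
  multiplication by an orthogonal matrix is an isometry of the space of entries, undone by
  R^T.\<close>

lemma gauss_left_mult_invariant:
  assumes R: "R \<in> carrier_mat n n" "orthonormal_cols R"
    and f: "f \<in> borel_measurable (PiM ({0..<n} \<times> {0..<b}) (\<lambda>_. borel))"
  shows "(\<integral>\<^sup>+x. f (unmat n b (R * gauss_mat n b x)) \<partial>gauss ({0..<n} \<times> {0..<b}))
    = (\<integral>\<^sup>+x. f x \<partial>gauss ({0..<n} \<times> {0..<b}))"
proof (rule gauss_rotation_invariant[where R' = "\<lambda>y. unmat n b (R\<^sup>T * gauss_mat n b y)", OF _ _ _ _ _ f])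
  let ?I = "{0..<n} \<times> {0..<b}"
  have RT: "R\<^sup>T \<in> carrier_mat n n" using R by simp
  show "finite ?I" by simp
  show "(\<lambda>x. unmat n b (R * gauss_mat n b x)) \<in> PiM ?I (\<lambda>_. borel) \<rightarrow>\<^sub>M PiM ?I (\<lambda>_. borel)"
    by (rule left_mult_measurable[OF R(1)])
  fix x :: "nat \<times> nat \<Rightarrow> real" assume x: "x \<in> extensional ?I"
  have "R * gauss_mat n b (unmat n b (R\<^sup>T * gauss_mat n b x)) = gauss_mat n b x"
  proof -
    have "R * gauss_mat n b (unmat n b (R\<^sup>T * gauss_mat n b x)) = R * (R\<^sup>T * gauss_mat n b x)"
      using RT by (simp add: gauss_mat_unmat)
    also have "\<dots> = R * R\<^sup>T * gauss_mat n b x" by (rule assoc_mult_mat[OF R(1) RT gauss_mat_carrier, symmetric])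
    finally show ?thesis unfolding orthogonal_mat_transpose(1)[OF R] by (simp add: left_mult_one_mat[of _ n b])
  qed
  thus "unmat n b (R\<^sup>T * gauss_mat n b x) \<in> extensional ?I \<and>
     unmat n b (R * gauss_mat n b (unmat n b (R\<^sup>T * gauss_mat n b x))) = x"
    using unmat_gauss_mat[OF x] by (simp add: unmat_def)
  show "(\<Sum>i\<in>?I. (unmat n b (R * gauss_mat n b x) i)\<^sup>2) = (\<Sum>i\<in>?I. (x i)\<^sup>2)"
    unfolding sum_sq_gauss_mat gauss_mat_unmat[OF mult_carrier_mat[OF R(1) gauss_mat_carrier]]
    by (rule frob_norm_orthonormal_mult[OF R gauss_mat_carrier])
  fix y :: "nat \<times> nat \<Rightarrow> real" assume y: "y \<in> extensional ?I"
  have "gauss_mat n b (\<lambda>i\<in>?I. x i + y i) = gauss_mat n b x + gauss_mat n b y"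
    by (intro eq_matI) (auto simp: gauss_mat_def)
  hence "R * gauss_mat n b (\<lambda>i\<in>?I. x i + y i) = R * gauss_mat n b x + R * gauss_mat n b y"
    using R by (simp add: mult_add_distrib_mat[of _ n n _ b])
  thus "unmat n b (R * gauss_mat n b (\<lambda>i\<in>?I. x i + y i)) =
    (\<lambda>i\<in>?I. unmat n b (R * gauss_mat n b x) i + unmat n b (R * gauss_mat n b y) i)"
    using R by (auto simp: unmat_def carrier_matD[OF gauss_mat_carrier] intro!: restrict_ext simp del: index_mult_mat(1))
qed

section \<open>Linear forms and norms of Gaussian vectors\<close>

lemma gauss_component_distributed:
  assumes "i \<in> I"
  shows "distributed (gauss I) lborel (\<lambda>x. x i) std_normal_density"
proof -
  interpret prob_space "gauss I" by (rule gauss_prob_space)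
  have d: "distr (gauss I) (density lborel std_normal_density) (\<lambda>x. x i) = density lborel std_normal_density"
    unfolding gauss_def using assms by (intro distr_PiM_component) (auto intro!: prob_space_normal_density)
  have "distr (gauss I) lborel (\<lambda>x. x i) = distr (gauss I) (density lborel std_normal_density) (\<lambda>x. x i)"
    by (rule distr_cong) simp_all
  thus ?thesis using d assms by (auto simp: distributed_def)
qed

lemma gauss_unit_form_distributed:
  assumes fin: "finite I" and a: "(\<Sum>i\<in>I. (a i)\<^sup>2) = 1"
  shows "distributed (gauss I) lborel (\<lambda>x. \<Sum>i\<in>I. a i * x i) std_normal_density"
proof -
  interpret prob_space "gauss I" by (rule gauss_prob_space)
  \<comment> \<open>Zero coefficients are dropped because a normal density requires a positive
    standard deviation; the unit length of \<open>a\<close> keeps \<open>J\<close> nonempty.\<close>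
  define J where "J = {i\<in>I. a i \<noteq> 0}"
  have J: "finite J" "J \<subseteq> I" using fin by (auto simp: J_def)
  have aJ: "(\<Sum>i\<in>J. (a i)\<^sup>2) = 1" unfolding a[symmetric] J_def using fin by (intro sum.mono_neutral_left) auto
  hence ne: "J \<noteq> {}" by auto
  let ?N = "density lborel (\<lambda>x. ennreal (std_normal_density x))"
  have dc: "distr (gauss I) borel (\<lambda>x. x i) = ?N" if "i \<in> I" for i
  proof -
    have "distr (gauss I) lborel (\<lambda>x. x i) = ?N"
      using gauss_component_distributed[OF that] by (simp add: distributed_def)
    moreover have "distr (gauss I) borel (\<lambda>x. x i) = distr (gauss I) lborel (\<lambda>x. x i)" by (rule distr_cong) simp_all
    ultimately show ?thesis by simp
  qed
  have "indep_vars (\<lambda>_. borel) (\<lambda>i x. x i) J"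
  proof (subst indep_vars_iff_distr_eq_PiM'[OF ne])
    fix i assume "i \<in> J"
    thus "random_variable borel (\<lambda>x. x i)" using J by (auto intro!: measurable_component_singleton simp: measurable_cong_sets[OF sets_gauss refl])
  next
    have "distr (gauss I) (PiM J (\<lambda>_. borel)) (\<lambda>x. \<lambda>i\<in>J. x i) = distr (gauss I) (PiM J (\<lambda>_. ?N)) (\<lambda>x. \<lambda>i\<in>J. x i)"
      by (rule distr_cong) (auto intro!: sets_PiM_cong)
    also have "\<dots> = PiM J (\<lambda>_. ?N)"
      unfolding gauss_def using distr_PiM_reindex[of I "\<lambda>_. ?N" id J] J
      by (auto simp: prob_space_normal_density Pi_def)
    also have "\<dots> = PiM J (\<lambda>i. distr (gauss I) borel (\<lambda>x. x i))"
      using J dc by (intro PiM_cong) auto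
    finally show "distr (gauss I) (PiM J (\<lambda>_. borel)) (\<lambda>x. \<lambda>i\<in>J. x i) = PiM J (\<lambda>i. distr (gauss I) borel (\<lambda>x. x i))" .
  qed
  hence ind: "indep_vars (\<lambda>_. borel) (\<lambda>i x. a i * x i) J"
    by (rule indep_vars_compose2[where Y = "\<lambda>i y. a i * y"]) simp
  have dist: "distributed (gauss I) lborel (\<lambda>x. a i * x i) (normal_density 0 \<bar>a i\<bar>)" if "i \<in> J" for i
  proof -
    have "distributed (gauss I) lborel (\<lambda>x. 0 + a i * x i) (normal_density (0 + a i * 0) (\<bar>a i\<bar> * 1))"
      using that by (intro normal_density_affine gauss_component_distributed) (auto simp: J_def)
    thus ?thesis by simp
  qed
  have "distributed (gauss I) lborel (\<lambda>x. \<Sum>i\<in>J. a i * x i)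
    (normal_density (\<Sum>i\<in>J. 0) (sqrt (\<Sum>i\<in>J. \<bar>a i\<bar>\<^sup>2)))"
    by (rule sum_indep_normal[OF J(1) ne ind _ dist]) (auto simp: J_def)
  moreover have "(\<Sum>i\<in>J. a i * x i) = (\<Sum>i\<in>I. a i * x i)" for x
    unfolding J_def using fin by (intro sum.mono_neutral_left) auto
  ultimately show ?thesis using aJ by simp
qed

text \<open>The maximum 1 / sqrt(2 pi) is rounded up to 2/5, which is allowed because (5/2)^2 = 6.25
  lies below 2 pi.\<close>

lemma std_normal_density_le: "std_normal_density x \<le> 2 / 5"
proof -
  have "(5/2)\<^sup>2 \<le> 2 * pi" using pi_gt3 pi_approx by (simp add: power2_eq_square)
  hence "5/2 \<le> sqrt (2 * pi)" by (rule real_le_rsqrt)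
  hence "1 / sqrt (2 * pi) \<le> 1 / (5/2)" by (intro divide_left_mono) auto
  hence "(1 / sqrt (2 * pi)) * exp (- x\<^sup>2 / 2) \<le> (2/5) * 1" by (intro mult_mono) auto
  thus ?thesis by (simp add: std_normal_density_def)
qed

lemma gauss_form_measurable [measurable]:
  "(\<lambda>x. \<Sum>i\<in>I. a i * x i) \<in> borel_measurable (PiM I (\<lambda>_. borel :: real measure))"
  by measurable

text \<open>After normalisation the event is an interval of length \<open>2 * t\<close> for a
  standard normal variable, whose density is at most 2/5.\<close>

lemma gauss_small_ball:
  assumes fin: "finite I" and N: "0 < (\<Sum>i\<in>I. (a i)\<^sup>2)" and t: "0 \<le> t"
  shows "emeasure (gauss I) {x\<in>space (gauss I). \<bar>\<Sum>i\<in>I. a i * x i\<bar> \<le> t * sqrt (\<Sum>i\<in>I. (a i)\<^sup>2)} \<le> ennreal (4/5 * t)"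
proof -
  define s where "s = sqrt (\<Sum>i\<in>I. (a i)\<^sup>2)"
  have s: "0 < s" "s\<^sup>2 = (\<Sum>i\<in>I. (a i)\<^sup>2)" using N by (auto simp: s_def)
  have u: "(\<Sum>i\<in>I. (a i / s)\<^sup>2) = 1" using s N by (simp add: power_divide sum_divide_distrib[symmetric])
  let ?Z = "\<lambda>x. \<Sum>i\<in>I. a i / s * x i"
  note D = gauss_unit_form_distributed[OF fin u]
  have Z: "(\<Sum>i\<in>I. a i * x i) = s * ?Z x" for x using s by (simp add: sum_distrib_left)
  have "{x\<in>space (gauss I). \<bar>\<Sum>i\<in>I. a i * x i\<bar> \<le> t * s} = ?Z -` {-t..t} \<inter> space (gauss I)"
    unfolding Z using s by (auto simp: abs_mult mult.commute[of t] abs_le_iff)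
  also have "emeasure (gauss I) \<dots> = (\<integral>\<^sup>+x. ennreal (std_normal_density x) * indicator {-t..t} x \<partial>lborel)"
    by (rule distributed_emeasure[OF D]) simp
  also have "\<dots> \<le> (\<integral>\<^sup>+x. ennreal (2/5) * indicator {-t..t} x \<partial>lborel)"
    by (intro nn_integral_mono mult_right_mono ennreal_leI std_normal_density_le) simp
  also have "\<dots> = ennreal (2/5) * ennreal (2 * t)" using t by (simp add: nn_integral_cmult_indicator)
  also have "\<dots> = ennreal (4/5 * t)" using t by (simp add: ennreal_mult[symmetric])
  finally show ?thesis by (simp add: s_def)
qed

text \<open>The first absolute moment of a standard normal variable is sqrt(2 / pi), rounded up to
  1.\<close>

lemma gauss_form_abs_le:
  assumes fin: "finite I"
  shows "(\<integral>\<^sup>+x. ennreal \<bar>\<Sum>i\<in>I. a i * x i\<bar> \<partial>gauss I) \<le> ennreal (sqrt (\<Sum>i\<in>I. (a i)\<^sup>2))"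
proof (cases "(\<Sum>i\<in>I. (a i)\<^sup>2) = 0")
  case True
  hence "\<forall>i\<in>I. a i = 0" using fin by (subst (asm) sum_nonneg_eq_0_iff) auto
  thus ?thesis by simp
next
  case False
  hence N: "0 < (\<Sum>i\<in>I. (a i)\<^sup>2)" by (meson le_less not_less sum_nonneg zero_le_power2)
  define s where "s = sqrt (\<Sum>i\<in>I. (a i)\<^sup>2)"
  have s: "0 < s" "s\<^sup>2 = (\<Sum>i\<in>I. (a i)\<^sup>2)" using N by (auto simp: s_def)
  have u: "(\<Sum>i\<in>I. (a i / s)\<^sup>2) = 1" using s N by (simp add: power_divide sum_divide_distrib[symmetric])
  let ?Z = "\<lambda>x. \<Sum>i\<in>I. a i / s * x i"
  note D = gauss_unit_form_distributed[OF fin u]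
  have Z: "(\<Sum>i\<in>I. a i * x i) = s * ?Z x" for x using s by (simp add: sum_distrib_left)
  have "(\<integral>\<^sup>+x. ennreal \<bar>?Z x\<bar> \<partial>gauss I) = (\<integral>\<^sup>+x. ennreal (std_normal_density x) * ennreal \<bar>x\<bar> \<partial>lborel)"
    by (rule distributed_nn_integral[OF D, symmetric]) simp
  also have "\<dots> = (\<integral>\<^sup>+x. ennreal (std_normal_density x * \<bar>x\<bar> ^ (2 * 0 + 1)) \<partial>lborel)"
    by (simp add: ennreal_mult)
  also have "\<dots> = ennreal (\<integral>x. std_normal_density x * \<bar>x\<bar> ^ (2 * 0 + 1) \<partial>lborel)"
    by (intro nn_integral_eq_integral integrable_std_normal_moment_abs) simp
  also have "\<dots> = ennreal (sqrt (2 / pi))" unfolding integral_std_normal_moment_abs_odd by simp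
  also have "\<dots> \<le> ennreal 1" using pi_gt3 by (intro ennreal_leI) simp
  finally have 1: "(\<integral>\<^sup>+x. ennreal \<bar>?Z x\<bar> \<partial>gauss I) \<le> 1" by simp
  have "(\<integral>\<^sup>+x. ennreal \<bar>\<Sum>i\<in>I. a i * x i\<bar> \<partial>gauss I) = (\<integral>\<^sup>+x. ennreal s * ennreal \<bar>?Z x\<bar> \<partial>gauss I)"
    unfolding Z using s by (simp add: abs_mult ennreal_mult)
  also have "\<dots> = ennreal s * (\<integral>\<^sup>+x. ennreal \<bar>?Z x\<bar> \<partial>gauss I)" by (rule nn_integral_cmult) measurable
  also have "\<dots> \<le> ennreal s * 1" by (intro mult_left_mono 1) simp
  finally show ?thesis by (simp add: s_def)
qed

lemma gauss_norm_le:
  assumes fin: "finite I"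
  shows "(\<integral>\<^sup>+x. ennreal (sqrt (\<Sum>i\<in>I. (x i)\<^sup>2)) \<partial>gauss I) \<le> ennreal (sqrt (real (card I)))"
proof (cases "I = {}")
  case True
  thus ?thesis by simp
next
  case False
  interpret prob_space "gauss I" by (rule gauss_prob_space)
  \<comment> \<open>In place of Jensen: r <= s/2 + r^2 / (2 s), with equality at r = s. Taking for
    \<open>s\<close> the root mean square length makes the integrated right side exactly
    \<open>s\<close>.\<close>
  define s where "s = sqrt (real (card I))"
  have s: "0 < s" "s\<^sup>2 = real (card I)" using False fin by (auto simp: s_def card_gt_0_iff)
  have sq: "(\<integral>\<^sup>+x. ennreal ((x i)\<^sup>2) \<partial>gauss I) = 1" if "i \<in> I" for i
  proof -
    have "(\<integral>\<^sup>+x. ennreal ((x i)\<^sup>2) \<partial>gauss I) = (\<integral>\<^sup>+x. ennreal (std_normal_density x) * ennreal (x\<^sup>2) \<partial>lborel)"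
      by (rule distributed_nn_integral[OF gauss_component_distributed[OF that], symmetric]) simp
    also have "\<dots> = (\<integral>\<^sup>+x. ennreal (std_normal_density x * x ^ (2 * 1)) \<partial>lborel)"
      by (simp add: ennreal_mult)
    also have "\<dots> = ennreal (\<integral>x. std_normal_density x * x ^ (2 * 1) \<partial>lborel)"
      using std_normal_moment_even[of 1] by (intro nn_integral_eq_integral) (auto simp: has_bochner_integral_iff)
    also have "\<dots> = 1" unfolding integral_std_normal_moment_even by (simp add: fact_numeral)
    finally show ?thesis .
  qed
  have "(\<integral>\<^sup>+x. ennreal (sqrt (\<Sum>i\<in>I. (x i)\<^sup>2)) \<partial>gauss I)
      \<le> (\<integral>\<^sup>+x. ennreal (s/2) + (\<Sum>i\<in>I. ennreal (1/(2 * s)) * ennreal ((x i)\<^sup>2)) \<partial>gauss I)"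
  proof (intro nn_integral_mono)
    fix x
    define r where "r = sqrt (\<Sum>i\<in>I. (x i)\<^sup>2)"
    have r: "r\<^sup>2 = (\<Sum>i\<in>I. (x i)\<^sup>2)" by (simp add: r_def sum_nonneg)
    have "2 * r * s \<le> r\<^sup>2 + s\<^sup>2" by (rule sum_squares_bound)
    hence "r \<le> s/2 + 1/(2 * s) * r\<^sup>2" using s by (simp add: field_simps power2_eq_square)
    hence "r \<le> s/2 + (\<Sum>i\<in>I. 1/(2 * s) * (x i)\<^sup>2)" by (simp only: r sum_distrib_left)
    hence "ennreal r \<le> ennreal (s/2 + (\<Sum>i\<in>I. 1/(2 * s) * (x i)\<^sup>2))" by (rule ennreal_leI)
    also have "\<dots> = ennreal (s/2) + (\<Sum>i\<in>I. ennreal (1/(2 * s)) * ennreal ((x i)\<^sup>2))"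
      (is "_ = ?rhs")
    proof -
      have "(\<Sum>i\<in>I. ennreal (1/(2 * s)) * ennreal ((x i)\<^sup>2)) = ennreal (\<Sum>i\<in>I. 1/(2 * s) * (x i)\<^sup>2)"
        using s by (subst sum_ennreal[symmetric]) (auto simp: ennreal_mult[symmetric] intro!: sum.cong)
      thus ?thesis using s by (simp add: ennreal_plus sum_nonneg)
    qed
    finally show "ennreal (sqrt (\<Sum>i\<in>I. (x i)\<^sup>2)) \<le> ?rhs" by (simp add: r_def)
  qed
  also have "\<dots> = ennreal (s/2) + (\<Sum>i\<in>I. ennreal (1/(2 * s)) * (\<integral>\<^sup>+x. ennreal ((x i)\<^sup>2) \<partial>gauss I))"
  proof -
    have [measurable]: "(\<lambda>x. x i) \<in> borel_measurable (gauss I)" if "i \<in> I" for i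
      unfolding measurable_cong_sets[OF sets_gauss refl] using that by simp
    have "(\<integral>\<^sup>+x. ennreal (s/2) + (\<Sum>i\<in>I. ennreal (1/(2 * s)) * ennreal ((x i)\<^sup>2)) \<partial>gauss I)
       = (\<integral>\<^sup>+x. ennreal (s/2) \<partial>gauss I) + (\<integral>\<^sup>+x. (\<Sum>i\<in>I. ennreal (1/(2 * s)) * ennreal ((x i)\<^sup>2)) \<partial>gauss I)"
      by (intro nn_integral_add) auto
    also have "(\<integral>\<^sup>+x. ennreal (s/2) \<partial>gauss I) = ennreal (s/2)" by (simp add: emeasure_space_1)
    also have "(\<integral>\<^sup>+x. (\<Sum>i\<in>I. ennreal (1/(2 * s)) * ennreal ((x i)\<^sup>2)) \<partial>gauss I)
       = (\<Sum>i\<in>I. \<integral>\<^sup>+x. ennreal (1/(2 * s)) * ennreal ((x i)\<^sup>2) \<partial>gauss I)"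
      by (intro nn_integral_sum) auto
    also have "\<dots> = (\<Sum>i\<in>I. ennreal (1/(2 * s)) * (\<integral>\<^sup>+x. ennreal ((x i)\<^sup>2) \<partial>gauss I))"
      by (intro sum.cong refl nn_integral_cmult) auto
    finally show ?thesis .
  qed
  also have "\<dots> = ennreal (s/2) + ennreal (real (card I) * (1/(2 * s)))"
  proof -
    have "ennreal (real (card I) * (1/(2 * s))) = of_nat (card I) * ennreal (1/(2 * s))"
      using s by (subst ennreal_mult) (auto simp: ennreal_of_nat_eq_real_of_nat)
    thus ?thesis by (simp add: sq)
  qed
  also have "\<dots> = ennreal s"
    unfolding s(2)[symmetric] using s(1) by (simp add: ennreal_plus[symmetric] power2_eq_square del: ennreal_plus)
  finally show ?thesis by (simp add: s_def)
qed

section \<open>The quotient of two Gaussian blocks\<close>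

lemma det_borel_measurable:
  assumes c: "\<And>x. F x \<in> carrier_mat k k"
    and m: "\<And>i j. i < k \<Longrightarrow> j < k \<Longrightarrow> (\<lambda>x. F x $$ (i,j)) \<in> borel_measurable M"
  shows "(\<lambda>x. det (F x) :: real) \<in> borel_measurable M"
proof -
  have "(\<lambda>x. \<Sum>p\<in>{p. p permutes {0..<k}}. signof p * (\<Prod>i = 0..<k. F x $$ (i, p i))) \<in> borel_measurable M"
  proof (intro borel_measurable_sum borel_measurable_times borel_measurable_const borel_measurable_prod m)
    fix p i assume "p \<in> {p. p permutes {0..<k}}" "i \<in> {0..<k}"
    thus "i < k" "p i < k" using permutes_in_image[of p "{0..<k}" i] by auto
  qed
  thus ?thesis by (simp add: det_def'[OF c])
qed

lemma cofactor_borel_measurable: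
  assumes c: "\<And>x. F x \<in> carrier_mat k k"
    and m: "\<And>i j. i < k \<Longrightarrow> j < k \<Longrightarrow> (\<lambda>x. F x $$ (i,j)) \<in> borel_measurable M"
    and rs: "r < k" "s < k"
  shows "(\<lambda>x. cofactor (F x) r s :: real) \<in> borel_measurable M"
proof -
  have "(\<lambda>x. det (mat_delete (F x) r s)) \<in> borel_measurable M"
  proof (rule det_borel_measurable)
    show "mat_delete (F x) r s \<in> carrier_mat (k - 1) (k - 1)" for x using c by (rule mat_delete_carrier)
    fix i j assume ij: "i < k - 1" "j < k - 1"
    have "mat_delete (F x) r s $$ (i,j) = F x $$ (if i < r then i else Suc i, if j < s then j else Suc j)" for x
      using ij c[of x] unfolding mat_delete_def by simp
    thus "(\<lambda>x. mat_delete (F x) r s $$ (i,j)) \<in> borel_measurable M" using ij by (simp add: m)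
  qed
  thus ?thesis unfolding cofactor_def by simp
qed

section \<open>Almost sure invertibility of the leading block\<close>

definition top_block :: "nat \<Rightarrow> nat \<Rightarrow> (nat \<times> nat \<Rightarrow> real) \<Rightarrow> real mat" where
  "top_block n b x = first_rows b (gauss_mat n b x)"

lemma top_block_carrier [simp]: "top_block n b x \<in> carrier_mat b b"
  by (auto simp: top_block_def first_rows_def gauss_mat_def)

lemma top_block_index: "b \<le> n \<Longrightarrow> i < b \<Longrightarrow> j < b \<Longrightarrow> top_block n b x $$ (i,j) = x (i,j)"
  by (auto simp: top_block_def first_rows_def gauss_mat_def)

lemma top_block_index_measurable:
  assumes "b \<le> n" "i < b" "j < b" "{..<b} \<times> {..<b} \<subseteq> J"
  shows "(\<lambda>x. top_block n b x $$ (i,j)) \<in> borel_measurable (PiM J (\<lambda>_. borel))"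
  using assms by (simp add: top_block_index subset_iff)

text \<open>The zeros are the negatives of the eigenvalues of \<open>A\<close>.\<close>

lemma det_add_smult_one_finite_zeros:
  fixes A :: "real mat"
  assumes A: "A \<in> carrier_mat k k"
  shows "finite {s. det (A + s \<cdot>\<^sub>m 1\<^sub>m k) = 0}"
proof -
  have "det (A + s \<cdot>\<^sub>m 1\<^sub>m k) = 0 \<longleftrightarrow> eigenvalue A (- s)" for s
    unfolding eigenvalue_det[OF A] char_matrix_def carrier_matD(1)[OF A] by simp
  hence "{s. det (A + s \<cdot>\<^sub>m 1\<^sub>m k) = 0} = uminus -` spectrum A"
    by (auto simp: spectrum_def)
  thus ?thesis using finite_vimageI[OF card_finite_spectrum(1)[OF A], of uminus] by simp
qed

text \<open>Lebesgue measure is invariant under translation along the identity matrix, and every such line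
  meets the singular matrices in finitely many points.\<close>

lemma gauss_top_block_det_nonzero:
  assumes bn: "b \<le> n"
  defines "I \<equiv> {0..<n} \<times> {0..<b}"
  shows "AE x in gauss I. det (top_block n b x) \<noteq> 0"
proof -
  have fin: "finite I" by (simp add: I_def)
  interpret L: sigma_finite_measure "leb I" by (rule leb_sigma_finite[OF fin])
  interpret LL: pair_sigma_finite lborel "leb I" ..
  let ?D = "\<lambda>x. det (top_block n b x)"
  have sub: "{..<b} \<times> {..<b} \<subseteq> I" using bn by (auto simp: I_def)
  have Dm [measurable]: "?D \<in> borel_measurable (PiM I (\<lambda>_. borel))"
    by (rule det_borel_measurable[OF top_block_carrier top_block_index_measurable[OF bn _ _ sub]])
  define f :: "(nat \<times> nat \<Rightarrow> real) \<Rightarrow> ennreal" where "f = (\<lambda>x. if ?D x = 0 then 1 else 0)"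
  have fm [measurable]: "f \<in> borel_measurable (PiM I (\<lambda>_. borel))" unfolding f_def by measurable
  have fl: "f \<in> borel_measurable (leb I)" by measurable
  define e :: "nat \<times> nat \<Rightarrow> real" where "e = (\<lambda>(i,j). if i = j then 1 else 0)"
  have Dshift: "top_block n b (\<lambda>p\<in>I. x p + s * e p) = top_block n b x + s \<cdot>\<^sub>m 1\<^sub>m b" for x s
    using bn by (intro eq_matI) (auto simp: top_block_def first_rows_def gauss_mat_def e_def I_def)
  \<comment> \<open>The indicator of the unit interval has integral 1 and allows averaging over the
    shift \<open>s\<close>; after exchanging the integrals, each inner one is supported on a finite
    set of shifts.\<close>
  have "(\<integral>\<^sup>+x. f x \<partial>leb I) = (\<integral>\<^sup>+s. indicator {0..1} s * (\<integral>\<^sup>+x. f x \<partial>leb I) \<partial>(lborel::real measure))"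
    by (simp add: nn_integral_multc)
  also have "\<dots> = (\<integral>\<^sup>+s. indicator {0..1} s * (\<integral>\<^sup>+x. f (\<lambda>p\<in>I. x p + s * e p) \<partial>leb I) \<partial>(lborel::real measure))"
    by (simp only: nn_integral_leb_translate[OF fin fl])
  also have "\<dots> = (\<integral>\<^sup>+s. (\<integral>\<^sup>+x. indicator {0..1} s * f (\<lambda>p\<in>I. x p + s * e p) \<partial>leb I) \<partial>(lborel::real measure))"
    by (intro nn_integral_cong nn_integral_cmult[symmetric]) measurable
  also have "\<dots> = (\<integral>\<^sup>+x. (\<integral>\<^sup>+s. indicator {0..1} s * f (\<lambda>p\<in>I. x p + s * e p) \<partial>(lborel::real measure)) \<partial>leb I)"
    by (rule LL.Fubini'[symmetric]) measurable
  also have "\<dots> = (\<integral>\<^sup>+x. 0 \<partial>leb I)"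
  proof (rule nn_integral_cong)
    fix x
    let ?Z = "{s. det (top_block n b x + s \<cdot>\<^sub>m 1\<^sub>m b) = 0}"
    have fz: "finite ?Z" by (rule det_add_smult_one_finite_zeros) simp
    have "AE s in lborel. s \<notin> ?Z" using fz by (intro AE_not_in countable_imp_null_set_lborel countable_finite)
    hence "(\<integral>\<^sup>+s. indicator {0..1} s * f (\<lambda>p\<in>I. x p + s * e p) \<partial>(lborel::real measure)) = (\<integral>\<^sup>+s. 0 \<partial>(lborel::real measure))"
      by (intro nn_integral_cong_AE) (auto simp: f_def Dshift)
    thus "(\<integral>\<^sup>+s. indicator {0..1} s * f (\<lambda>p\<in>I. x p + s * e p) \<partial>(lborel::real measure)) = 0" by simp
  qed
  finally have "(\<integral>\<^sup>+x. f x \<partial>leb I) = 0" by simp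
  hence "AE x in leb I. f x = 0" using fl by (subst (asm) nn_integral_0_iff_AE) auto
  hence "AE x in leb I. ?D x \<noteq> 0" by (rule AE_mp) (auto simp: f_def split: if_splits)
  moreover have "gauss_density I \<in> borel_measurable (leb I)" by measurable
  ultimately show ?thesis unfolding gauss_eq_density[OF fin] by (subst AE_density) auto
qed

lemma nn_integral_gauss_union:
  assumes "finite I" "finite J" "I \<inter> J = {}"
    and f: "f \<in> borel_measurable (PiM (I \<union> J) (\<lambda>_. borel))"
  shows "(\<integral>\<^sup>+x. f x \<partial>gauss (I \<union> J)) = (\<integral>\<^sup>+x. (\<integral>\<^sup>+y. f (merge I J (x,y)) \<partial>gauss J) \<partial>gauss I)"
proof -
  interpret N: prob_space "density lborel std_normal_density" by (auto intro!: prob_space_normal_density)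
  interpret G: product_sigma_finite "\<lambda>_. density lborel std_normal_density" by standard
  have "f \<in> borel_measurable (gauss (I \<union> J))" using f by (simp add: measurable_cong_sets[OF sets_gauss refl])
  thus ?thesis unfolding gauss_def using assms by (intro G.product_nn_integral_fold) auto
qed

section \<open>One entry of the quotient as a ratio of normal variables\<close>

lemma cofactor_row_cong:
  fixes A B :: "real mat"
  assumes A: "A \<in> carrier_mat k k" and B: "B \<in> carrier_mat k k"
    and eq: "\<And>i j. 0 < i \<Longrightarrow> i < k \<Longrightarrow> j < k \<Longrightarrow> A $$ (i,j) = B $$ (i,j)"
  shows "cofactor A 0 s = cofactor B 0 s"
proof -
  have "mat_delete A 0 s = mat_delete B 0 s"
    using A B eq by (intro eq_matI) (auto simp: mat_delete_def)
  thus ?thesis by (simp add: cofactor_def)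
qed

text \<open>Cofactors along the first row depend neither on row 0 nor on row \<open>b\<close>; they
  will be the common coefficient vector of two linear forms in these independent rows.\<close>

definition top_cofactor :: "nat \<Rightarrow> nat \<Rightarrow> (nat \<times> nat \<Rightarrow> real) \<Rightarrow> nat \<Rightarrow> real" where
  "top_cofactor n b x j = cofactor (top_block n b x) 0 j"

lemma top_cofactor_cong:
  assumes "b \<le> n" "\<And>i j. 0 < i \<Longrightarrow> i < b \<Longrightarrow> j < b \<Longrightarrow> x (i,j) = y (i,j)"
  shows "top_cofactor n b x j = top_cofactor n b y j"
  unfolding top_cofactor_def using assms by (intro cofactor_row_cong[of _ b]) (auto simp: top_block_index)

lemma det_top_block_laplace:
  assumes "0 < b" "b \<le> n"
  shows "det (top_block n b x) = (\<Sum>j<b. x (0,j) * top_cofactor n b x j)"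
  using laplace_expansion_row[OF top_block_carrier[of n b x] assms(1)] assms
  by (simp add: top_cofactor_def top_block_index)

lemma top_cofactor_measurable:
  assumes "b \<le> n" "{0<..<b} \<times> {..<b} \<subseteq> J" "j < b"
  shows "(\<lambda>x. top_cofactor n b x j) \<in> borel_measurable (PiM J (\<lambda>_. borel))"
proof -
  \<comment> \<open>Overwriting row 0 by zeros changes none of its cofactors and makes measurability
    hold over index sets \<open>J\<close> that omit this row.\<close>
  let ?F = "\<lambda>x :: nat \<times> nat \<Rightarrow> real. mat b b (\<lambda>(i,j). if i = 0 then 0 else x (i,j))"
  have "top_cofactor n b x j = cofactor (?F x) 0 j" for x
    unfolding top_cofactor_def using assms by (intro cofactor_row_cong[of _ b]) (auto simp: top_block_index)
  moreover have "(\<lambda>x. cofactor (?F x) 0 j) \<in> borel_measurable (PiM J (\<lambda>_. borel))"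
  proof (rule cofactor_borel_measurable[where k = b])
    fix i k assume ik: "i < b" "k < b"
    show "(\<lambda>x. ?F x $$ (i,k)) \<in> borel_measurable (PiM J (\<lambda>_. borel))"
    proof (cases "i = 0")
      case False
      hence "(i,k) \<in> J" using ik assms(2) by auto
      thus ?thesis using ik False by simp
    qed (use ik in simp)
  qed (use assms in auto)
  ultimately show ?thesis by simp
qed

text \<open>By Cramer's rule the sum divided by the determinant is the (0,0) entry of the quotient
  of the blocks. Given the other rows, numerator and denominator are linear forms in rows
  \<open>b\<close> and 0 with the same coefficients. Row 0 is integrated first, by the small ball
  estimate, then row \<open>b\<close>, by the first absolute moment; the length \<open>nc\<close> of
  the coefficient vector cancels.\<close>

lemma gauss_ratio_tail:
  assumes b: "0 < b" "b < n" and t: "0 < t"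
  defines "I \<equiv> {0..<n} \<times> {0..<b}"
  shows "emeasure (gauss I) {x\<in>space (gauss I). det (top_block n b x) \<noteq> 0 \<and>
      t * \<bar>det (top_block n b x)\<bar> \<le> \<bar>\<Sum>j<b. x (b,j) * top_cofactor n b x j\<bar>} \<le> ennreal (4/5 / t)"
proof -
  define I0 I1 R where "I0 = {0} \<times> {0..<b}" and "I1 = {b} \<times> {0..<b}" and "R = I - I0 - I1"
  have fin: "finite I0" "finite I1" "finite R" "finite (R \<union> I1)" by (auto simp: I0_def I1_def R_def I_def)
  have I: "I = (R \<union> I1) \<union> I0" using b by (auto simp: I0_def I1_def R_def I_def)
  have disj: "(R \<union> I1) \<inter> I0 = {}" "R \<inter> I1 = {}" using b by (auto simp: I0_def I1_def R_def)
  have subR: "{0<..<b} \<times> {..<b} \<subseteq> R" using b by (auto simp: I0_def I1_def R_def I_def)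
  hence sub1: "{0<..<b} \<times> {..<b} \<subseteq> R \<union> I1" and subI: "{0<..<b} \<times> {..<b} \<subseteq> I" by (auto simp: I)
  note cm [measurable] = top_cofactor_measurable[OF less_imp_le[OF b(2)] subR]
    top_cofactor_measurable[OF less_imp_le[OF b(2)] sub1] top_cofactor_measurable[OF less_imp_le[OF b(2)] subI]
  define num den where "num x = (\<Sum>j<b. x (b,j) * top_cofactor n b x j)" and "den x = (\<Sum>j<b. x (0,j) * top_cofactor n b x j)"
    for x :: "nat \<times> nat \<Rightarrow> real"
  define nc where "nc x = sqrt (\<Sum>j<b. (top_cofactor n b x j)\<^sup>2)" for x
  have dd: "det (top_block n b x) = den x" for x
    unfolding den_def using b by (intro det_top_block_laplace) auto
  have mem: "(0,j) \<in> I" "(b,j) \<in> I" "(b,j) \<in> R \<union> I1" "(b,j) \<in> I1" if "j < b" for j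
    using that b by (auto simp: I_def I1_def)
  have numI [measurable]: "num \<in> borel_measurable (PiM I (\<lambda>_. borel))"
    unfolding num_def by (intro borel_measurable_sum borel_measurable_times cm measurable_component_singleton mem) auto
  have denI [measurable]: "den \<in> borel_measurable (PiM I (\<lambda>_. borel))"
    unfolding den_def by (intro borel_measurable_sum borel_measurable_times cm measurable_component_singleton mem) auto
  have num1 [measurable]: "num \<in> borel_measurable (PiM (R \<union> I1) (\<lambda>_. borel))"
    unfolding num_def by (intro borel_measurable_sum borel_measurable_times cm measurable_component_singleton mem) auto
  have nc1 [measurable]: "nc \<in> borel_measurable (PiM (R \<union> I1) (\<lambda>_. borel))"
  proof -
    have [measurable]: "(\<lambda>x. \<Sum>j<b. (top_cofactor n b x j)\<^sup>2) \<in> borel_measurable (PiM (R \<union> I1) (\<lambda>_. borel))"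
      by (intro borel_measurable_sum borel_measurable_power cm) auto
    show ?thesis unfolding nc_def by measurable
  qed
  define E where "E = {x\<in>space (gauss I). den x \<noteq> 0 \<and> t * \<bar>den x\<bar> \<le> \<bar>num x\<bar>}"
  have numG: "num \<in> borel_measurable (gauss I)" and denG: "den \<in> borel_measurable (gauss I)"
    using numI denI by (simp_all add: measurable_cong_sets[OF sets_gauss refl])
  have E: "E \<in> sets (gauss I)" unfolding E_def
    by (intro sets.sets_Collect_conj borel_measurable_neq borel_measurable_le borel_measurable_times
        borel_measurable_abs borel_measurable_const numG denG)
  have sumI0: "(\<Sum>p\<in>I0. h p) = (\<Sum>j<b. h (0,j))" for h :: "nat \<times> nat \<Rightarrow> real"
  proof -
    have "I0 = Pair 0 ` {..<b}" by (auto simp: I0_def)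
    thus ?thesis by (simp add: sum.reindex inj_on_def)
  qed
  have sumI1: "(\<Sum>p\<in>I1. h p) = (\<Sum>j<b. h (b,j))" for h :: "nat \<times> nat \<Rightarrow> real"
  proof -
    have "I1 = Pair b ` {..<b}" by (auto simp: I1_def)
    thus ?thesis by (simp add: sum.reindex inj_on_def)
  qed
  have inner: "(\<integral>\<^sup>+y. indicator E (merge (R \<union> I1) I0 (x,y)) \<partial>gauss I0) \<le> ennreal (4/5 / t * (\<bar>num x\<bar> / nc x))" for x
  proof -
    have c: "top_cofactor n b (merge (R \<union> I1) I0 (x,y)) j = top_cofactor n b x j" for y j
    proof (rule top_cofactor_cong)
      fix i k assume "0 < i" "i < b" "k < b"
      hence "(i,k) \<in> R \<union> I1" by (intro subsetD[OF sub1]) auto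
      thus "merge (R \<union> I1) I0 (x,y) (i,k) = x (i,k)" by (simp add: merge_def)
    qed (use b in simp)
    have nm: "num (merge (R \<union> I1) I0 (x,y)) = num x" for y
      unfolding num_def c using mem by (intro sum.cong refl) (auto simp: merge_def)
    have dn: "den (merge (R \<union> I1) I0 (x,y)) = (\<Sum>p\<in>I0. top_cofactor n b x (snd p) * y p)" for y
      unfolding den_def c sumI0 using disj by (intro sum.cong refl) (auto simp: merge_def I0_def)
    show ?thesis
    \<comment> \<open>If all cofactors vanish, so does the determinant, and such points are outside
      the event.\<close>
    proof (cases "nc x = 0")
      case True
      hence "top_cofactor n b x j = 0" if "j < b" for j
        using that by (simp add: nc_def sum_nonneg_eq_0_iff)
      hence "den (merge (R \<union> I1) I0 (x,y)) = 0" for y unfolding dn by (auto simp: I0_def intro!: sum.neutral)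
      thus ?thesis by (simp add: E_def)
    next
      case False
      hence ncp: "0 < nc x" unfolding nc_def by (simp add: sum_nonneg less_le)
      hence N: "0 < (\<Sum>p\<in>I0. (top_cofactor n b x (snd p))\<^sup>2)" unfolding sumI0 by (simp add: nc_def)
      \<comment> \<open>The threshold for the denominator in units of its standard deviation
        \<open>nc x\<close>.\<close>
      define \<tau> where "\<tau> = \<bar>num x\<bar> / (t * nc x)"
      have ncs: "sqrt (\<Sum>p\<in>I0. (top_cofactor n b x (snd p))\<^sup>2) = nc x" unfolding sumI0 by (simp add: nc_def)
      have \<tau>: "0 \<le> \<tau>" "\<tau> * nc x = \<bar>num x\<bar> / t" using t ncp by (auto simp: \<tau>_def)
      let ?B = "{y\<in>space (gauss I0). \<bar>\<Sum>p\<in>I0. top_cofactor n b x (snd p) * y p\<bar> \<le> \<tau> * sqrt (\<Sum>p\<in>I0. (top_cofactor n b x (snd p))\<^sup>2)}"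
      have "(\<integral>\<^sup>+y. indicator E (merge (R \<union> I1) I0 (x,y)) \<partial>gauss I0) \<le> (\<integral>\<^sup>+y. indicator ?B y \<partial>gauss I0)"
      proof (rule nn_integral_mono)
        fix y assume y: "y \<in> space (gauss I0)"
        show "indicator E (merge (R \<union> I1) I0 (x,y)) \<le> (indicator ?B y :: ennreal)"
          using y t unfolding ncs \<tau>(2) by (auto simp: E_def nm dn indicator_def field_simps)
      qed
      also have "\<dots> = emeasure (gauss I0) ?B" by (rule nn_integral_indicator) measurable
      also have "\<dots> \<le> ennreal (4/5 * \<tau>)" by (rule gauss_small_ball[OF fin(1) N \<tau>(1)])
      finally show ?thesis by (simp add: \<tau>_def mult.assoc)
    qed
  qed
  have inner2: "(\<integral>\<^sup>+y. ennreal (4/5 / t * (\<bar>num (merge R I1 (x,y))\<bar> / nc (merge R I1 (x,y)))) \<partial>gauss I1) \<le> ennreal (4/5 / t)" for x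
  proof -
    have c: "top_cofactor n b (merge R I1 (x,y)) j = top_cofactor n b x j" for y j
    proof (rule top_cofactor_cong)
      fix i k assume "0 < i" "i < b" "k < b"
      hence "(i,k) \<in> R" by (intro subsetD[OF subR]) auto
      thus "merge R I1 (x,y) (i,k) = x (i,k)" by (simp add: merge_def)
    qed (use b in simp)
    have nm: "num (merge R I1 (x,y)) = (\<Sum>p\<in>I1. top_cofactor n b x (snd p) * y p)" for y
      unfolding num_def c sumI1 using disj by (intro sum.cong refl) (auto simp: merge_def I1_def R_def)
    have ncm: "nc (merge R I1 (x,y)) = nc x" for y by (simp add: nc_def c)
    have nc0: "0 \<le> nc x" by (simp add: nc_def sum_nonneg)
    have ncs: "sqrt (\<Sum>p\<in>I1. (top_cofactor n b x (snd p))\<^sup>2) = nc x" unfolding sumI1 by (simp add: nc_def)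
    have "(\<integral>\<^sup>+y. ennreal (4/5 / t * (\<bar>num (merge R I1 (x,y))\<bar> / nc (merge R I1 (x,y)))) \<partial>gauss I1)
      = (\<integral>\<^sup>+y. ennreal (4/5 / t / nc x) * ennreal \<bar>\<Sum>p\<in>I1. top_cofactor n b x (snd p) * y p\<bar> \<partial>gauss I1)"
      unfolding nm ncm using t nc0 by (simp add: ennreal_mult[symmetric])
    also have "\<dots> = ennreal (4/5 / t / nc x) * (\<integral>\<^sup>+y. ennreal \<bar>\<Sum>p\<in>I1. top_cofactor n b x (snd p) * y p\<bar> \<partial>gauss I1)"
      by (rule nn_integral_cmult) measurable
    also have "\<dots> \<le> ennreal (4/5 / t / nc x) * ennreal (nc x)"
      using gauss_form_abs_le[OF fin(2), of "\<lambda>p. top_cofactor n b x (snd p)"] unfolding ncs by (rule mult_left_mono) simp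
    also have "\<dots> = ennreal (4/5 / t / nc x * nc x)" using t nc0 by (subst ennreal_mult) auto
    \<comment> \<open>For \<open>nc x = 0\<close> the left side is 0 by the convention on
      division.\<close>
    also have "\<dots> \<le> ennreal (4/5 / t)" using t by (intro ennreal_leI) (cases "nc x = 0", auto)
    finally show ?thesis .
  qed
  have Em: "(indicator E :: _ \<Rightarrow> ennreal) \<in> borel_measurable (PiM (R \<union> I1 \<union> I0) (\<lambda>_. borel))"
    using E unfolding I[symmetric] sets_gauss by simp
  have gm: "(\<lambda>x. ennreal (4/5 / t * (\<bar>num x\<bar> / nc x))) \<in> borel_measurable (PiM (R \<union> I1) (\<lambda>_. borel))" by measurable
  have "emeasure (gauss I) E = (\<integral>\<^sup>+x. indicator E x \<partial>gauss (R \<union> I1 \<union> I0))"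
    unfolding I[symmetric] using E by simp
  also have "\<dots> = (\<integral>\<^sup>+x. (\<integral>\<^sup>+y. indicator E (merge (R \<union> I1) I0 (x,y)) \<partial>gauss I0) \<partial>gauss (R \<union> I1))"
    by (rule nn_integral_gauss_union[OF fin(4,1) disj(1) Em])
  also have "\<dots> \<le> (\<integral>\<^sup>+x. ennreal (4/5 / t * (\<bar>num x\<bar> / nc x)) \<partial>gauss (R \<union> I1))"
    by (intro nn_integral_mono inner)
  also have "\<dots> = (\<integral>\<^sup>+x. (\<integral>\<^sup>+y. ennreal (4/5 / t * (\<bar>num (merge R I1 (x,y))\<bar> / nc (merge R I1 (x,y)))) \<partial>gauss I1) \<partial>gauss R)"
    by (rule nn_integral_gauss_union[OF fin(3,2) disj(2) gm])
  also have "\<dots> \<le> (\<integral>\<^sup>+x. ennreal (4/5 / t) \<partial>gauss R)" by (intro nn_integral_mono inner2)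
  also have "\<dots> = ennreal (4/5 / t)"
    using prob_space.emeasure_space_1[OF gauss_prob_space, of R] by simp
  finally show ?thesis unfolding E_def dd num_def .
qed

section \<open>Bilinear forms in the quotient\<close>

text \<open>With A the leading block and O the rows below it, this is det(A) times h . (O A^(-1) g),
  written with the adjugate. Being a polynomial in the entries of all arguments, it is jointly
  measurable and makes sense for singular A.\<close>

definition quotient_form :: "nat \<Rightarrow> nat \<Rightarrow> (nat \<times> nat \<Rightarrow> real) \<Rightarrow> (nat \<Rightarrow> real) \<Rightarrow> (nat \<Rightarrow> real) \<Rightarrow> real" where
  "quotient_form n b x h g = (\<Sum>i<n - b. h i * (\<Sum>j<b. x (i + b, j) * (\<Sum>l<b. cofactor (top_block n b x) l j * g l)))"

lemma rows_from_gauss_mat_index: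
  "i < n - b \<Longrightarrow> j < b \<Longrightarrow> rows_from b (gauss_mat n b x) $$ (i,j) = x (i + b, j)"
  by (simp add: rows_from_def gauss_mat_def)

text \<open>The inverse of the leading block appears only through a solution \<open>y\<close> of a
  linear system; applying the adjugate to that system turns the cofactor sums into the determinant
  times \<open>y\<close>.\<close>

lemma quotient_form_eq:
  assumes y: "y \<in> carrier_vec b" "top_block n b x *\<^sub>v y = vec b g"
  shows "quotient_form n b x h g = det (top_block n b x) *
    (vec (n - b) h \<bullet> (rows_from b (gauss_mat n b x) *\<^sub>v y))"
proof -
  let ?A = "top_block n b x" and ?O = "rows_from b (gauss_mat n b x)"
  have O: "?O \<in> carrier_mat (n - b) b" by (rule rows_from_carrier) simp
  note adj = adj_mat[OF top_block_carrier[of n b x]]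
  have "adj_mat ?A *\<^sub>v vec b g = adj_mat ?A * ?A *\<^sub>v y"
    unfolding y(2)[symmetric] by (rule assoc_mult_mat_vec[OF adj(1) top_block_carrier y(1), symmetric])
  also have "\<dots> = det ?A \<cdot>\<^sub>v y"
    unfolding adj(3) using y(1) by (intro eq_vecI) (auto simp: scalar_prod_def if_distrib if_distribR sum.delta cong: if_cong)
  finally have ay: "adj_mat ?A *\<^sub>v vec b g = det ?A \<cdot>\<^sub>v y" .
  have l: "(\<Sum>l<b. cofactor ?A l j * g l) = det ?A * y $ j" if "j < b" for j
  proof -
    have "(\<Sum>l<b. cofactor ?A l j * g l) = (adj_mat ?A *\<^sub>v vec b g) $ j"
      using that carrier_matD[OF top_block_carrier[of n b x]] by (simp add: adj_mat_def scalar_prod_def atLeast0LessThan)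
    thus ?thesis unfolding ay using that y(1) by simp
  qed
  have "(?O *\<^sub>v y) $ i = (\<Sum>j<b. x (i + b, j) * y $ j)" if "i < n - b" for i
    using that O y(1) rows_from_gauss_mat_index[OF that]
    by (simp add: scalar_prod_def atLeast0LessThan)
  hence "vec (n - b) h \<bullet> (?O *\<^sub>v y) = (\<Sum>i<n - b. h i * (\<Sum>j<b. x (i + b, j) * y $ j))"
    unfolding scalar_prod_def using O by (simp add: atLeast0LessThan del: index_mult_mat_vec)
  moreover have "quotient_form n b x h g = (\<Sum>i<n - b. h i * (\<Sum>j<b. x (i + b, j) * (det ?A * y $ j)))"
    unfolding quotient_form_def by (intro sum.cong refl arg_cong2[of _ _ _ _ "(*)"]) (simp add: l)
  ultimately show ?thesis by (simp add: sum_distrib_left mult_ac)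
qed

lemma four_block_orthonormal:
  assumes P: "P \<in> carrier_mat b b" "orthonormal_cols P" and Q: "Q \<in> carrier_mat k k" "orthonormal_cols Q"
  shows "orthonormal_cols (four_block_mat P (0\<^sub>m b k) (0\<^sub>m k b) Q)"
proof -
  let ?F = "four_block_mat P (0\<^sub>m b k) (0\<^sub>m k b) Q"
  have "?F\<^sup>T = four_block_mat (P\<^sup>T) (0\<^sub>m b k) (0\<^sub>m k b) (Q\<^sup>T)"
    using P Q by (subst transpose_four_block_mat[of _ b b _ k _ k]) auto
  hence "?F\<^sup>T * ?F = four_block_mat (P\<^sup>T * P) (0\<^sub>m b k) (0\<^sub>m k b) (Q\<^sup>T * Q)"
    using P Q by (simp only:) (subst mult_four_block_mat[of _ b b _ k _ k _ _ b _ k], auto)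
  also have "\<dots> = 1\<^sub>m (b + k)" using P Q by (simp add: orthonormal_cols_def)
  finally show ?thesis using P Q by (simp add: orthonormal_cols_def)
qed

lemma append_rows_blocks:
  fixes X Y :: "real mat"
  assumes "X \<in> carrier_mat b c" "Y \<in> carrier_mat k c"
  shows "first_rows b (X @\<^sub>r Y) = X" "rows_from b (X @\<^sub>r Y) = Y"
  using assms by (auto simp: append_rows_def first_rows_def rows_from_def intro!: eq_matI)

text \<open>A block diagonal factor acts on the two blocks separately; for invertible
  \<open>P\<close> their quotient X becomes Q X P^(-1).\<close>

lemma four_block_mult_blocks:
  fixes M :: "real mat"
  assumes P: "P \<in> carrier_mat b b" and Q: "Q \<in> carrier_mat k k" and M: "M \<in> carrier_mat (b + k) c"
  defines "F \<equiv> four_block_mat P (0\<^sub>m b k) (0\<^sub>m k b) Q"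
  shows "first_rows b (F * M) = P * first_rows b M" "rows_from b (F * M) = Q * rows_from b M"
proof -
  have M12: "first_rows b M \<in> carrier_mat b c" "rows_from b M \<in> carrier_mat k c"
    using first_rows_carrier[OF M] rows_from_carrier[OF M, of b] by auto
  have Meq: "M = first_rows b M @\<^sub>r rows_from b M"
    using M M12 by (intro eq_matI) (auto simp: append_rows_def first_rows_def rows_from_def)
  have "F * M = F * (first_rows b M @\<^sub>r rows_from b M)" using Meq by simp
  also have "\<dots> = (P * first_rows b M) @\<^sub>r (Q * rows_from b M)"
    unfolding F_def append_rows_def using P Q M12
    by (simp add: mult_four_block_mat[of _ b b _ k _ k _ _ c _ 0])
  finally have FM: "F * M = (P * first_rows b M) @\<^sub>r (Q * rows_from b M)" .
  have c: "P * first_rows b M \<in> carrier_mat b c" "Q * rows_from b M \<in> carrier_mat k c" using P Q M12 by auto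
  show "first_rows b (F * M) = P * first_rows b M" "rows_from b (F * M) = Q * rows_from b M"
    unfolding FM by (rule append_rows_blocks[OF c])+
qed

lemma det_orthonormal_abs:
  assumes "P \<in> carrier_mat b b" "orthonormal_cols P"
  shows "\<bar>det P :: real\<bar> = 1"
proof -
  have "det (P\<^sup>T * P) = 1" using assms by (simp add: orthonormal_cols_def)
  hence "det P * det P = 1"
    using assms(1) by (simp add: det_mult[of _ b] det_transpose)
  hence "\<bar>det P\<bar>\<^sup>2 = 1" by (simp add: power2_eq_square)
  thus ?thesis by (auto simp: power2_eq_1_iff)
qed

lemma det_nonzero_solve:
  fixes A :: "real mat"
  assumes A: "A \<in> carrier_mat k k" "det A \<noteq> 0" and g: "g \<in> carrier_vec k"
  shows "\<exists>y\<in>carrier_vec k. A *\<^sub>v y = g"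
proof -
  obtain L where L: "L \<in> carrier_mat k k" "A * L = 1\<^sub>m k"
    using det_non_zero_imp_unit[OF A, of "()"] by (auto simp: Units_def ring_mat_def)
  have "A *\<^sub>v (L *\<^sub>v g) = A * L *\<^sub>v g" by (rule assoc_mult_mat_vec[OF A(1) L(1) g, symmetric])
  also have "\<dots> = g" using L(2) g by simp
  finally show ?thesis using L(1) g by (intro bexI[of _ "L *\<^sub>v g"]) auto
qed

lemma cofactor_top_block_measurable:
  assumes "b \<le> n" "l < b" "j < b"
  shows "(\<lambda>x. cofactor (top_block n b x) l j) \<in> borel_measurable (PiM ({0..<n} \<times> {0..<b}) (\<lambda>_. borel))"
  by (rule cofactor_borel_measurable[OF top_block_carrier top_block_index_measurable[OF assms(1)] assms(2,3)])
    (use assms in auto)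

lemma det_top_block_measurable:
  assumes "b \<le> n"
  shows "(\<lambda>x. det (top_block n b x)) \<in> borel_measurable (PiM ({0..<n} \<times> {0..<b}) (\<lambda>_. borel))"
  by (rule det_borel_measurable[OF top_block_carrier top_block_index_measurable[OF assms(1)]]) (use assms in auto)

text \<open>The inequality |h . X g| >= u for the quotient X, cleared of its denominator.\<close>

definition form_exceeds :: "nat \<Rightarrow> nat \<Rightarrow> real \<Rightarrow> (nat \<times> nat \<Rightarrow> real) \<Rightarrow> (nat \<Rightarrow> real) \<times> (nat \<Rightarrow> real) \<Rightarrow> bool" where
  "form_exceeds n b u x hg \<longleftrightarrow> det (top_block n b x) \<noteq> 0 \<and>
     u * \<bar>det (top_block n b x)\<bar> \<le> \<bar>quotient_form n b x (fst hg) (snd hg)\<bar>"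

lemma form_exceeds_measurable:
  assumes bn: "b \<le> n"
  shows "Measurable.pred (PiM ({0..<n} \<times> {0..<b}) (\<lambda>_. borel) \<Otimes>\<^sub>M
     (PiM {..<n - b} (\<lambda>_. borel) \<Otimes>\<^sub>M PiM {..<b} (\<lambda>_. borel))) (\<lambda>z. form_exceeds n b u (fst z) (snd z))"
proof -
  let ?I = "{0..<n} \<times> {0..<b}"
  let ?P = "PiM ?I (\<lambda>_. borel :: real measure) \<Otimes>\<^sub>M (PiM {..<n - b} (\<lambda>_. borel :: real measure) \<Otimes>\<^sub>M PiM {..<b} (\<lambda>_. borel :: real measure))"
  have d [measurable]: "(\<lambda>z. det (top_block n b (fst z))) \<in> borel_measurable ?P"
    by (rule measurable_compose[OF measurable_fst det_top_block_measurable[OF bn]])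
  have c: "(\<lambda>z. cofactor (top_block n b (fst z)) l j) \<in> borel_measurable ?P" if "l < b" "j < b" for l j
    by (rule measurable_compose[OF measurable_fst cofactor_top_block_measurable[OF bn that]])
  have x: "(\<lambda>z. fst z p) \<in> borel_measurable ?P" if "p \<in> ?I" for p
    by (rule measurable_compose[OF measurable_fst measurable_component_singleton[OF that]])
  have h: "(\<lambda>z. fst (snd z) i) \<in> borel_measurable ?P" if "i \<in> {..<n - b}" for i
    by (rule measurable_compose[OF measurable_snd measurable_compose[OF measurable_fst measurable_component_singleton[OF that]]])
  have g: "(\<lambda>z. snd (snd z) i) \<in> borel_measurable ?P" if "i \<in> {..<b}" for i
    by (rule measurable_compose[OF measurable_snd measurable_compose[OF measurable_snd measurable_component_singleton[OF that]]])
  have [measurable]: "(\<lambda>z. quotient_form n b (fst z) (fst (snd z)) (snd (snd z))) \<in> borel_measurable ?P"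
    unfolding quotient_form_def by (intro borel_measurable_sum borel_measurable_times c x h g) auto
  have "{z\<in>space ?P. form_exceeds n b u (fst z) (snd z)} \<in> sets ?P"
    unfolding form_exceeds_def
    by (intro sets.sets_Collect_conj borel_measurable_neq borel_measurable_le borel_measurable_times
        borel_measurable_abs borel_measurable_const) measurable
  thus ?thesis by (simp add: pred_def)
qed

lemma form_exceeds_fixed_measurable:
  assumes bn: "b \<le> n"
  shows "{x\<in>space (gauss ({0..<n} \<times> {0..<b})). form_exceeds n b u x hg} \<in> sets (gauss ({0..<n} \<times> {0..<b}))"
proof -
  let ?I = "{0..<n} \<times> {0..<b}"
  let ?P = "PiM ?I (\<lambda>_. borel :: real measure)"
  have d: "(\<lambda>z. det (top_block n b z)) \<in> borel_measurable (gauss ?I)"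
    unfolding measurable_cong_sets[OF sets_gauss refl] by (rule det_top_block_measurable[OF bn])
  have "(\<lambda>z. quotient_form n b z (fst hg) (snd hg)) \<in> borel_measurable (gauss ?I)"
    unfolding measurable_cong_sets[OF sets_gauss refl] quotient_form_def
    by (intro borel_measurable_sum borel_measurable_times borel_measurable_const
        cofactor_top_block_measurable[OF bn] measurable_component_singleton) auto
  with d show ?thesis unfolding form_exceeds_def
    by (intro sets.sets_Collect_conj borel_measurable_neq borel_measurable_le borel_measurable_times
        borel_measurable_abs borel_measurable_const)
qed

lemma unmat_extensional: "unmat n b M \<in> extensional ({0..<n} \<times> {0..<b})"
  by (simp add: unmat_def)

text \<open>Householder reflections of the top and bottom rows turn the bilinear form into one entry of the
  quotient, and that entry is a ratio of two independent normal variables.\<close>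

lemma gauss_form_exceeds_fixed:
  fixes h g :: "nat \<Rightarrow> real"
  assumes b: "0 < b" "b < n" and u: "0 < u"
  defines "I \<equiv> {0..<n} \<times> {0..<b}"
    and "w \<equiv> vnorm (vec (n - b) h) * vnorm (vec b g)"
  shows "emeasure (gauss I) {x\<in>space (gauss I). form_exceeds n b u x (h,g)} \<le> ennreal (4/5 / u * w)"
proof -
  let ?h = "vec (n - b) h" and ?g = "vec b g"
  obtain Hg where Hg: "Hg \<in> carrier_mat b b" "orthonormal_cols Hg" "Hg\<^sup>T = Hg" "Hg *\<^sub>v ?g = vnorm ?g \<cdot>\<^sub>v unit_vec b 0"
    using householder[of ?g b] b by auto
  obtain Hh where Hh: "Hh \<in> carrier_mat (n - b) (n - b)" "orthonormal_cols Hh" "Hh\<^sup>T = Hh"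
    "Hh *\<^sub>v ?h = vnorm ?h \<cdot>\<^sub>v unit_vec (n - b) 0"
    using householder[of ?h "n - b"] b by auto
  define F where "F = four_block_mat Hg (0\<^sub>m b (n - b)) (0\<^sub>m (n - b) b) Hh"
  have nb: "b + (n - b) = n" using b by simp
  have F: "F \<in> carrier_mat n n" using four_block_carrier_mat[OF Hg(1) Hh(1)] nb by (simp add: F_def)
  have oF: "orthonormal_cols F" unfolding F_def by (rule four_block_orthonormal[OF Hg(1,2) Hh(1,2)])
  define num where "num x = (\<Sum>j<b. x (b,j) * top_cofactor n b x j)" for x :: "nat \<times> nat \<Rightarrow> real"
  \<comment> \<open>The reflections send \<open>g\<close> and \<open>h\<close> to multiples of first
    unit vectors, so the form becomes |h| |g| times the (0,0) entry of the quotient. The determinant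
    changes at most its sign, which the absolute values absorb.\<close>
  have rot: "form_exceeds n b u (unmat n b (F * gauss_mat n b x)) (h,g) \<longleftrightarrow>
     det (top_block n b x) \<noteq> 0 \<and> u * \<bar>det (top_block n b x)\<bar> \<le> w * \<bar>num x\<bar>" for x
  proof -
    let ?A = "top_block n b x" and ?O = "rows_from b (gauss_mat n b x)" and ?x' = "unmat n b (F * gauss_mat n b x)"
    have O: "?O \<in> carrier_mat (n - b) b" by (rule rows_from_carrier) simp
    have gm: "gauss_mat n b ?x' = F * gauss_mat n b x" using F by (intro gauss_mat_unmat) auto
    have M: "gauss_mat n b x \<in> carrier_mat (b + (n - b)) b" unfolding nb by simp
    have A': "top_block n b ?x' = Hg * ?A" and O': "rows_from b (gauss_mat n b ?x') = Hh * ?O"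
      unfolding top_block_def gm using four_block_mult_blocks[OF Hg(1) Hh(1) M, folded F_def] by auto
    have d': "det (top_block n b ?x') = det Hg * det ?A"
      unfolding A' by (rule det_mult[OF Hg(1) top_block_carrier])
    have dHg: "\<bar>det Hg\<bar> = 1" by (rule det_orthonormal_abs[OF Hg(1,2)])
    hence dHg0: "det Hg \<noteq> 0" by auto
    have "\<bar>quotient_form n b ?x' h g\<bar> = w * \<bar>num x\<bar>" if d0: "det ?A \<noteq> 0"
    proof -
      \<comment> \<open>\<open>y0\<close> is the first column of the inverse of the leading
        block.\<close>
      obtain y0 where y0: "y0 \<in> carrier_vec b" "?A *\<^sub>v y0 = unit_vec b 0"
        using det_nonzero_solve[OF top_block_carrier d0, of "unit_vec b 0"] by auto
      define y where "y = vnorm ?g \<cdot>\<^sub>v y0"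
      have y: "y \<in> carrier_vec b" using y0 by (simp add: y_def)
      have Ay: "?A *\<^sub>v y = vnorm ?g \<cdot>\<^sub>v unit_vec b 0"
        unfolding y_def using mult_mat_vec[OF top_block_carrier y0(1)] y0(2) by simp
      have "top_block n b ?x' *\<^sub>v y = Hg *\<^sub>v (?A *\<^sub>v y)"
        unfolding A' by (rule assoc_mult_mat_vec[OF Hg(1) top_block_carrier y])
      also have "\<dots> = Hg\<^sup>T *\<^sub>v (Hg *\<^sub>v ?g)" by (simp only: Ay Hg(3,4))
      also have "\<dots> = ?g" by (rule orthonormal_cols_mult_vec[OF Hg(1,2)]) simp
      finally have sol: "top_block n b ?x' *\<^sub>v y = ?g" .
      have Oy: "?O *\<^sub>v y \<in> carrier_vec (n - b)" using O y by (rule mult_mat_vec_carrier)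
      have "quotient_form n b ?x' h g = det (top_block n b ?x') * (?h \<bullet> (Hh * ?O *\<^sub>v y))"
        using quotient_form_eq[OF y sol] unfolding O' .
      also have "Hh * ?O *\<^sub>v y = Hh\<^sup>T *\<^sub>v (?O *\<^sub>v y)"
        unfolding Hh(3) by (rule assoc_mult_mat_vec[OF Hh(1) O y])
      also have "?h \<bullet> (Hh\<^sup>T *\<^sub>v (?O *\<^sub>v y)) = (Hh *\<^sub>v ?h) \<bullet> (?O *\<^sub>v y)"
        by (rule scalar_prod_adjoint[OF Hh(1) _ Oy, symmetric]) simp
      also have "\<dots> = vnorm ?h * (unit_vec (n - b) 0 \<bullet> (?O *\<^sub>v y))"
        unfolding Hh(4) using Oy by (simp add: smult_scalar_prod_distrib[of _ "n - b"] del: scalar_prod_left_unit)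
      also have "unit_vec (n - b) 0 \<bullet> (?O *\<^sub>v y) = (?O *\<^sub>v y) $ 0"
        using Oy b by (intro scalar_prod_left_unit) auto
      also have "?O *\<^sub>v y = vnorm ?g \<cdot>\<^sub>v (?O *\<^sub>v y0)" unfolding y_def by (rule mult_mat_vec[OF O y0(1)])
      also have "(vnorm ?g \<cdot>\<^sub>v (?O *\<^sub>v y0)) $ 0 = vnorm ?g * (?O *\<^sub>v y0) $ 0"
        using O b by (intro index_smult_vec) simp
      finally have 1: "\<bar>quotient_form n b ?x' h g\<bar> = w * \<bar>det ?A * (?O *\<^sub>v y0) $ 0\<bar>"
        unfolding d' w_def by (simp only: abs_mult dHg abs_of_nonneg[OF vnorm_nonneg]) simp
      have "num x = det ?A * (?O *\<^sub>v y0) $ 0"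
      proof -
        \<comment> \<open>Evaluating the form at first unit vectors identifies \<open>num\<close> as
          the determinant times the (0,0) entry.\<close>
        let ?e = "\<lambda>i::nat. if i = 0 then 1 else (0::real)"
        have e: "unit_vec b 0 = vec b ?e" and e': "unit_vec (n - b) 0 = vec (n - b) ?e"
          by (auto simp: unit_vec_def)
        have "quotient_form n b x ?e ?e = det ?A * (vec (n - b) ?e \<bullet> (?O *\<^sub>v y0))"
          using quotient_form_eq[OF y0(1), of n x ?e ?e] y0(2) e by simp
        also have "vec (n - b) ?e \<bullet> (?O *\<^sub>v y0) = (?O *\<^sub>v y0) $ 0"
          unfolding e'[symmetric] using mult_mat_vec_carrier[OF O y0(1)] b by (intro scalar_prod_left_unit) auto
        also have "quotient_form n b x ?e ?e = num x"
        proof -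
          have "quotient_form n b x ?e ?e = (\<Sum>i<n - b. if i = 0 then (\<Sum>j<b. x (b,j) * (\<Sum>l<b. cofactor ?A l j * ?e l)) else 0)"
            unfolding quotient_form_def by (intro sum.cong) auto
          also have "\<dots> = (\<Sum>j<b. x (b,j) * (\<Sum>l<b. cofactor ?A l j * ?e l))" using b by simp
          also have "\<dots> = num x" unfolding num_def
          proof (intro sum.cong refl)
            fix j
            have "(\<Sum>l<b. cofactor ?A l j * ?e l) = (\<Sum>l<b. if l = 0 then cofactor ?A 0 j else 0)"
              by (intro sum.cong) auto
            also have "\<dots> = top_cofactor n b x j" using b by (simp add: top_cofactor_def)
            finally show "x (b,j) * (\<Sum>l<b. cofactor ?A l j * ?e l) = x (b,j) * top_cofactor n b x j" by simp
          qed
          finally show ?thesis .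
        qed
        finally show ?thesis .
      qed
      thus ?thesis unfolding 1 by simp
    qed
    thus ?thesis unfolding form_exceeds_def d' using dHg0 by (auto simp: abs_mult dHg)
  qed
  let ?E = "{x\<in>space (gauss I). form_exceeds n b u x (h,g)}"
  have E: "?E \<in> sets (gauss I)" unfolding I_def using b by (intro form_exceeds_fixed_measurable) simp
  have Em: "(indicator ?E :: _ \<Rightarrow> ennreal) \<in> borel_measurable (PiM I (\<lambda>_. borel))"
    using E unfolding sets_gauss by simp
  have "emeasure (gauss I) ?E = (\<integral>\<^sup>+x. indicator ?E x \<partial>gauss I)" using E by simp
  also have "\<dots> = (\<integral>\<^sup>+x. indicator ?E (unmat n b (F * gauss_mat n b x)) \<partial>gauss I)"
    unfolding I_def by (rule gauss_left_mult_invariant[OF F oF Em[unfolded I_def], symmetric])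
  also have "\<dots> = (\<integral>\<^sup>+x. indicator {x\<in>space (gauss I). det (top_block n b x) \<noteq> 0 \<and>
       u * \<bar>det (top_block n b x)\<bar> \<le> w * \<bar>num x\<bar>} x \<partial>gauss I)"
    by (intro nn_integral_cong) (auto simp: indicator_def rot space_gauss unmat_extensional I_def)
  also have "\<dots> \<le> ennreal (4/5 / u * w)"
  proof (cases "w = 0")
    case True
    hence "{x\<in>space (gauss I). det (top_block n b x) \<noteq> 0 \<and>
       u * \<bar>det (top_block n b x)\<bar> \<le> w * \<bar>num x\<bar>} = {}"
      using u by (auto simp: mult_le_0_iff)
    thus ?thesis by simp
  next
    case False
    hence w: "0 < w" by (simp add: w_def less_le)
    have eq: "{x\<in>space (gauss I). det (top_block n b x) \<noteq> 0 \<and>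
       u * \<bar>det (top_block n b x)\<bar> \<le> w * \<bar>num x\<bar>} =
       {x\<in>space (gauss I). det (top_block n b x) \<noteq> 0 \<and>
       u / w * \<bar>det (top_block n b x)\<bar> \<le> \<bar>\<Sum>j<b. x (b,j) * top_cofactor n b x j\<bar>}" (is "?X = ?Y")
      using w by (auto simp: num_def field_simps)
    have "(\<lambda>x. det (top_block n b x)) \<in> borel_measurable (gauss I)"
      unfolding measurable_cong_sets[OF sets_gauss refl] I_def using b by (intro det_top_block_measurable) auto
    moreover have "(\<lambda>x. \<Sum>j<b. x (b,j) * top_cofactor n b x j) \<in> borel_measurable (gauss I)"
      unfolding measurable_cong_sets[OF sets_gauss refl] I_def top_cofactor_def using b
      by (intro borel_measurable_sum borel_measurable_times cofactor_top_block_measurable measurable_component_singleton) auto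
    ultimately have "?Y \<in> sets (gauss I)"
      by (intro sets.sets_Collect_conj borel_measurable_neq borel_measurable_le borel_measurable_times
        borel_measurable_abs borel_measurable_const)
    hence "(\<integral>\<^sup>+x. indicator ?Y x \<partial>gauss I) = emeasure (gauss I) ?Y" by simp
    also have "\<dots> \<le> ennreal (4/5 / (u / w))"
      unfolding I_def using b u w by (intro gauss_ratio_tail) auto
    finally show ?thesis unfolding eq using u w by simp
  qed
  finally show ?thesis .
qed

lemma vnorm_vec_eq: "vnorm (vec k f) = sqrt (\<Sum>i<k. (f i)\<^sup>2)"
  by (simp add: vnorm_def)

lemma gauss_vnorm_le: "(\<integral>\<^sup>+h. ennreal (vnorm (vec k h)) \<partial>gauss {..<k}) \<le> ennreal (sqrt (real k))"
  using gauss_norm_le[of "{..<k}"] by (simp add: vnorm_vec_eq)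

text \<open>The small ball estimate at \<open>t = 1/2\<close> costs 4/5 * 1/2 = 2/5 and leaves
  3/5.\<close>

lemma gauss_away_from_hyperplane:
  assumes a: "a \<in> carrier_vec k" "vnorm a \<noteq> 0"
  defines "H \<equiv> {h\<in>space (gauss {..<k}). vnorm a / 2 < \<bar>vec k h \<bullet> a\<bar>}"
  shows "H \<in> sets (gauss {..<k})" "ennreal (3/5) \<le> emeasure (gauss {..<k}) H"
proof -
  interpret prob_space "gauss {..<k}" by (rule gauss_prob_space)
  let ?N = "{h\<in>space (gauss {..<k}). \<bar>\<Sum>i\<in>{..<k}. a $ i * h i\<bar> \<le> 1/2 * sqrt (\<Sum>i\<in>{..<k}. (a $ i)\<^sup>2)}"
  have va: "vnorm a = sqrt (\<Sum>i\<in>{..<k}. (a $ i)\<^sup>2)" using a(1) by (simp add: vnorm_def)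
  have sp: "vec k h \<bullet> a = (\<Sum>i\<in>{..<k}. a $ i * h i)" for h
    using a(1) by (simp add: scalar_prod_def atLeast0LessThan mult.commute)
  have N: "?N \<in> sets (gauss {..<k})" by measurable
  have HN: "H = space (gauss {..<k}) - ?N" unfolding H_def va sp by auto
  show "H \<in> sets (gauss {..<k})" unfolding HN using N by auto
  have "0 < (\<Sum>i\<in>{..<k}. (a $ i)\<^sup>2)" using a(2) va by (simp add: sum_nonneg less_le)
  hence "emeasure (gauss {..<k}) ?N \<le> ennreal (4/5 * (1/2))" by (intro gauss_small_ball) auto
  hence "prob ?N \<le> 2/5" by (simp add: emeasure_eq_measure)
  hence "3/5 \<le> prob H" unfolding HN using prob_compl[OF N] by simp
  thus "ennreal (3/5) \<le> emeasure (gauss {..<k}) H" by (simp add: emeasure_eq_measure ennreal_leI)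
qed

text \<open>A random bilinear form detects a large operator norm with probability at least 9/25; this turns
  a tail bound for the form into one for the norm without any measurability question about the norm.\<close>

lemma form_exceeds_of_large_norm:
  assumes b: "0 < b" "b < n" and C: "0 \<le> C" and d0: "det (top_block n b x) \<noteq> 0"
    and T: "T \<in> carrier_mat b b" "top_block n b x * T = 1\<^sub>m b"
    and big: "C < spec_norm (rows_from b (gauss_mat n b x) * T)"
  shows "ennreal (9/25) \<le> (\<integral>\<^sup>+hg. indicator {hg. form_exceeds n b (C/4) x hg} hg \<partial>(gauss {..<n - b} \<Otimes>\<^sub>M gauss {..<b}))"
proof -
  let ?K = "{..<n - b}" and ?L = "{..<b}"
  interpret G: prob_space "gauss ?K" by (rule gauss_prob_space)
  interpret H: prob_space "gauss ?L" by (rule gauss_prob_space)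
  interpret HG: pair_sigma_finite "gauss ?K" "gauss ?L" ..
  let ?O = "rows_from b (gauss_mat n b x)"
  have O: "?O \<in> carrier_mat (n - b) b" by (rule rows_from_carrier) simp
  define X where "X = ?O * T"
  have X: "X \<in> carrier_mat (n - b) b" using O T(1) by (auto simp: X_def)
  \<comment> \<open>A vector stretched by more than \<open>C\<close> suffices; the norm need not be
    attained.\<close>
  have "\<exists>z\<in>carrier_vec b. C * vnorm z < vnorm (X *\<^sub>v z)"
  proof (rule ccontr)
    assume "\<not> ?thesis"
    hence "spec_norm X \<le> C" using C by (intro spec_norm_le[OF X]) (auto simp: not_less)
    thus False using big by (simp add: X_def)
  qed
  then obtain z where z: "z \<in> carrier_vec b" "C * vnorm z < vnorm (X *\<^sub>v z)" by auto
  let ?a = "X *\<^sub>v z"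
  have a: "?a \<in> carrier_vec (n - b)" using X z(1) by (rule mult_mat_vec_carrier)
  have "0 \<le> C * vnorm z" using C by simp
  hence a0: "vnorm ?a \<noteq> 0" using z(2) by linarith
  have bil: "quotient_form n b x h g = det (top_block n b x) * (vec b g \<bullet> (X\<^sup>T *\<^sub>v vec (n - b) h))" for h g
  proof -
    let ?g = "vec b g" and ?h = "vec (n - b) h"
    have g: "?g \<in> carrier_vec b" and h: "?h \<in> carrier_vec (n - b)" by auto
    have y: "T *\<^sub>v ?g \<in> carrier_vec b" using T(1) g by (rule mult_mat_vec_carrier)
    have "top_block n b x *\<^sub>v (T *\<^sub>v ?g) = top_block n b x * T *\<^sub>v ?g"
      by (rule assoc_mult_mat_vec[OF top_block_carrier T(1) g, symmetric])
    also have "\<dots> = ?g" unfolding T(2) by simp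
    finally have "quotient_form n b x h g = det (top_block n b x) * (?h \<bullet> (?O *\<^sub>v (T *\<^sub>v ?g)))"
      by (rule quotient_form_eq[OF y])
    also have "?O *\<^sub>v (T *\<^sub>v ?g) = X *\<^sub>v ?g" unfolding X_def by (rule assoc_mult_mat_vec[OF O T(1) g, symmetric])
    also have "?h \<bullet> (X *\<^sub>v ?g) = (X *\<^sub>v ?g) \<bullet> ?h"
      by (rule comm_scalar_prod[OF h mult_mat_vec_carrier[OF X g]])
    also have "\<dots> = ?g \<bullet> (X\<^sup>T *\<^sub>v ?h)" by (rule scalar_prod_adjoint[OF X g h])
    finally show ?thesis .
  qed
  define HH where "HH = {h\<in>space (gauss ?K). vnorm ?a / 2 < \<bar>vec (n - b) h \<bullet> ?a\<bar>}"
  note HH = gauss_away_from_hyperplane[OF a a0, folded HH_def]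
  \<comment> \<open>For \<open>h\<close> in \<open>HH\<close> the vector X^T h is longer than C/2,
    since pairing it with \<open>z\<close> equals pairing \<open>h\<close> with the image of
    \<open>z\<close> under \<open>X\<close>. The second test, against an independent
    \<open>g\<close>, loses another factor 2. Hence the threshold C/4 and the probability
    (3/5)^2.\<close>
  have inner: "ennreal (3/5) * indicator HH h \<le> (\<integral>\<^sup>+g. indicator {hg. form_exceeds n b (C/4) x hg} (h,g) \<partial>gauss ?L)"
    if h: "h \<in> space (gauss ?K)" for h
  proof (cases "h \<in> HH")
    case True
    let ?h = "vec (n - b) h"
    have hc: "?h \<in> carrier_vec (n - b)" by simp
    define c where "c = X\<^sup>T *\<^sub>v ?h"
    have c: "c \<in> carrier_vec b" unfolding c_def using X by (auto intro!: mult_mat_vec_carrier)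
    have "\<bar>?h \<bullet> ?a\<bar> = \<bar>z \<bullet> c\<bar>"
      unfolding c_def using scalar_prod_adjoint[OF X z(1) hc] comm_scalar_prod[OF hc a] by simp
    also have "\<dots> \<le> vnorm z * vnorm c" by (rule scalar_prod_le_vnorm[OF z(1) c])
    finally have "C * vnorm z < 2 * vnorm c * vnorm z" using True z(2) by (simp add: HH_def mult_ac)
    hence Cc: "C < 2 * vnorm c" using mult_right_mono[of "2 * vnorm c" C "vnorm z"] vnorm_nonneg[of z] by linarith
    hence c0: "vnorm c \<noteq> 0" using C by linarith
    let ?G = "{g\<in>space (gauss ?L). vnorm c / 2 < \<bar>vec b g \<bullet> c\<bar>}"
    note G = gauss_away_from_hyperplane[OF c c0]
    have "ennreal (3/5) \<le> (\<integral>\<^sup>+g. indicator ?G g \<partial>gauss ?L)" using G by simp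
    also have "\<dots> \<le> (\<integral>\<^sup>+g. indicator {hg. form_exceeds n b (C/4) x hg} (h,g) \<partial>gauss ?L)"
    proof (rule nn_integral_mono)
      fix g
      show "indicator ?G g \<le> (indicator {hg. form_exceeds n b (C/4) x hg} (h,g) :: ennreal)"
      proof (cases "g \<in> ?G")
        case True
        hence "C / 4 \<le> \<bar>vec b g \<bullet> c\<bar>" using Cc by simp
        hence "form_exceeds n b (C/4) x (h,g)"
          unfolding form_exceeds_def fst_conv snd_conv bil c_def[symmetric] using d0
          by (simp add: abs_mult mult.commute mult_right_mono)
        thus ?thesis by (simp add: indicator_def)
      qed simp
    qed
    finally show ?thesis using True by simp
  qed simp
  have m: "indicator {hg. form_exceeds n b (C/4) x hg} \<in> borel_measurable (gauss ?K \<Otimes>\<^sub>M gauss ?L)"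
    (is "?ind \<in> _")
  proof -
    have "(\<lambda>z. quotient_form n b x (fst z) (snd z)) \<in> borel_measurable (gauss ?K \<Otimes>\<^sub>M gauss ?L)"
      unfolding quotient_form_def
    proof (intro borel_measurable_sum borel_measurable_times borel_measurable_const)
      fix i assume "i \<in> ?K"
      hence "(\<lambda>h. h i) \<in> borel_measurable (gauss ?K)" unfolding measurable_cong_sets[OF sets_gauss refl] by simp
      thus "(\<lambda>z. fst z i) \<in> borel_measurable (gauss ?K \<Otimes>\<^sub>M gauss ?L)" by (rule measurable_compose[OF measurable_fst])
    next
      fix l assume "l \<in> ?L"
      hence "(\<lambda>h. h l) \<in> borel_measurable (gauss ?L)" unfolding measurable_cong_sets[OF sets_gauss refl] by simp
      thus "(\<lambda>z. snd z l) \<in> borel_measurable (gauss ?K \<Otimes>\<^sub>M gauss ?L)" by (rule measurable_compose[OF measurable_snd])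
    qed
    hence "{hg\<in>space (gauss ?K \<Otimes>\<^sub>M gauss ?L). form_exceeds n b (C/4) x hg} \<in> sets (gauss ?K \<Otimes>\<^sub>M gauss ?L)"
      unfolding form_exceeds_def
      by (intro sets.sets_Collect_conj sets.sets_Collect_const borel_measurable_le borel_measurable_abs borel_measurable_const)
    thus ?thesis by (intro borel_measurable_indicator') auto
  qed
  have "ennreal (9/25) = ennreal (3/5) * ennreal (3/5)" by (simp add: ennreal_mult[symmetric])
  also have "\<dots> \<le> ennreal (3/5) * emeasure (gauss ?K) HH" by (intro mult_left_mono HH(2)) simp
  also have "\<dots> = (\<integral>\<^sup>+h. ennreal (3/5) * indicator HH h \<partial>gauss ?K)" using HH(1) by (simp add: nn_integral_cmult)
  also have "\<dots> \<le> (\<integral>\<^sup>+h. (\<integral>\<^sup>+g. indicator {hg. form_exceeds n b (C/4) x hg} (h,g) \<partial>gauss ?L) \<partial>gauss ?K)"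
    by (intro nn_integral_mono inner)
  also have "\<dots> = (\<integral>\<^sup>+hg. indicator {hg. form_exceeds n b (C/4) x hg} hg \<partial>(gauss ?K \<Otimes>\<^sub>M gauss ?L))"
    by (rule H.nn_integral_fst[OF m])
  finally show ?thesis .
qed

section \<open>Tail bound for the norm of the quotient\<close>

text \<open>Squaring 1 + 1/2 <= e^(1/2) gives just enough for 4 e >= 9.\<close>

lemma exp_1_ge: "9/4 \<le> exp (1::real)"
proof -
  have "3/2 \<le> exp (1/2 :: real)" using exp_ge_add_one_self[of "1/2 :: real"] by simp
  hence "3/2 * (3/2) \<le> exp (1/2) * exp (1/2 :: real)" by (intro mult_mono) auto
  thus ?thesis by (simp add: exp_add[symmetric])
qed

lemma invertible_mat_of_inverse:
  assumes "A \<in> carrier_mat k k" "L \<in> carrier_mat k k" "A * L = 1\<^sub>m k"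
  shows "invertible_mat (A :: real mat)"
  using assms mat_mult_left_right_inverse[OF assms]
  unfolding invertible_mat_def inverts_mat_def square_mat.simps by (intro conjI exI[of _ L]) auto

text \<open>The probability of a large form over blocks and test vectors together is estimated in
  both orders. For fixed test vectors it is at most of order |h| |g| / C; for a fixed nonsingular
  block with large quotient it is at least 9/25. The average \<open>\<psi>\<close> over test vectors
  is measurable, so the good set is cut out by \<open>\<psi>\<close> and the determinant, and not by
  the norm.\<close>

lemma gauss_quotient_tail:
  assumes b: "0 < b" "b < n" and \<delta>: "0 < \<delta>" and C: "9 * sqrt (real b * real (n - b)) / \<delta> \<le> C"
  defines "I \<equiv> {0..<n} \<times> {0..<b}"
  shows "\<exists>E\<in>sets (gauss I). 1 - \<delta> \<le> measure (gauss I) E \<and> (\<forall>x\<in>E. invertible_mat (top_block n b x) \<and>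
     spec_norm (rows_from b (gauss_mat n b x) * mat_inv (top_block n b x)) \<le> C)"
proof -
  let ?K = "{..<n - b}" and ?L = "{..<b}"
  interpret GI: prob_space "gauss I" by (rule gauss_prob_space)
  interpret G: prob_space "gauss ?K" by (rule gauss_prob_space)
  interpret H: prob_space "gauss ?L" by (rule gauss_prob_space)
  interpret HG: pair_prob_space "gauss ?K" "gauss ?L" ..
  let ?P = "gauss ?K \<Otimes>\<^sub>M gauss ?L"
  interpret IP: pair_sigma_finite "gauss I" ?P ..
  have sq: "0 < sqrt (real b * real (n - b))" using b by simp
  have "0 < 9 * sqrt (real b * real (n - b)) / \<delta>" by (intro divide_pos_pos mult_pos_pos sq \<delta>) simp
  hence C0: "0 < C" using C by linarith
  define u where "u = C / 4"
  have u: "0 < u" using C0 by (simp add: u_def)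
  have mult3: "ennreal (p * (r * s)) = ennreal p * (ennreal r * ennreal s)" if "0 \<le> p" "0 \<le> r" "0 \<le> s" for p r s
    using that by (simp add: ennreal_mult)
  have "Measurable.pred (gauss I \<Otimes>\<^sub>M ?P) (\<lambda>z. form_exceeds n b u (fst z) (snd z))"
    using form_exceeds_measurable[of b n u] b unfolding I_def
    by (simp add: measurable_cong_sets[OF sets_pair_measure_cong[OF sets_gauss sets_pair_measure_cong[OF sets_gauss sets_gauss]] refl])
  hence m: "(\<lambda>(x,hg). indicator {hg. form_exceeds n b u x hg} hg :: ennreal) \<in> borel_measurable (gauss I \<Otimes>\<^sub>M ?P)"
    unfolding split_beta' indicator_def mem_Collect_eq by measurable
  define \<psi> where "\<psi> x = (\<integral>\<^sup>+hg. indicator {hg. form_exceeds n b u x hg} hg \<partial>?P)" for x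
  have \<psi>m: "\<psi> \<in> borel_measurable (gauss I)"
    unfolding \<psi>_def using m by (intro HG.borel_measurable_nn_integral) 
  have nK: "(\<lambda>h. ennreal (vnorm (vec (n - b) h))) \<in> borel_measurable (gauss ?K)"
    unfolding measurable_cong_sets[OF sets_gauss refl] vnorm_vec_eq by measurable
  have nL: "(\<lambda>h. ennreal (vnorm (vec b h))) \<in> borel_measurable (gauss ?L)"
    unfolding measurable_cong_sets[OF sets_gauss refl] vnorm_vec_eq by measurable
  have "(\<integral>\<^sup>+x. \<psi> x \<partial>gauss I) = (\<integral>\<^sup>+hg. (\<integral>\<^sup>+x. indicator {hg. form_exceeds n b u x hg} hg \<partial>gauss I) \<partial>?P)"
    unfolding \<psi>_def by (rule IP.Fubini'[OF m, symmetric])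
  also have "\<dots> \<le> (\<integral>\<^sup>+hg. ennreal (4/5 / u) * (ennreal (vnorm (vec (n - b) (fst hg))) * ennreal (vnorm (vec b (snd hg)))) \<partial>?P)"
  proof (rule nn_integral_mono)
    fix hg :: "(nat \<Rightarrow> real) \<times> (nat \<Rightarrow> real)"
    let ?E = "{x\<in>space (gauss I). form_exceeds n b u x hg}"
    have E: "?E \<in> sets (gauss I)" unfolding I_def using b by (intro form_exceeds_fixed_measurable) simp
    have "(\<integral>\<^sup>+x. indicator {hg. form_exceeds n b u x hg} hg \<partial>gauss I) = (\<integral>\<^sup>+x. indicator ?E x \<partial>gauss I)"
      by (intro nn_integral_cong) (auto simp: indicator_def)
    also have "\<dots> = emeasure (gauss I) ?E" using E by simp
    also have "\<dots> \<le> ennreal (4/5 / u * (vnorm (vec (n - b) (fst hg)) * vnorm (vec b (snd hg))))"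
      using gauss_form_exceeds_fixed[OF b u, of "fst hg" "snd hg"] by (simp add: I_def)
    also have "\<dots> = ennreal (4/5 / u) * (ennreal (vnorm (vec (n - b) (fst hg))) * ennreal (vnorm (vec b (snd hg))))"
      using u by (intro mult3) auto
    finally show "(\<integral>\<^sup>+x. indicator {hg. form_exceeds n b u x hg} hg \<partial>gauss I) \<le>
      ennreal (4/5 / u) * (ennreal (vnorm (vec (n - b) (fst hg))) * ennreal (vnorm (vec b (snd hg))))" .
  qed
  also have "\<dots> = ennreal (4/5 / u) * (\<integral>\<^sup>+hg. ennreal (vnorm (vec (n - b) (fst hg))) * ennreal (vnorm (vec b (snd hg))) \<partial>?P)"
    by (intro nn_integral_cmult borel_measurable_times_ennreal measurable_compose[OF measurable_fst nK]
        measurable_compose[OF measurable_snd nL])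
  also have "(\<integral>\<^sup>+hg. ennreal (vnorm (vec (n - b) (fst hg))) * ennreal (vnorm (vec b (snd hg))) \<partial>?P)
     = (\<integral>\<^sup>+h. (\<integral>\<^sup>+g. ennreal (vnorm (vec (n - b) h)) * ennreal (vnorm (vec b g)) \<partial>gauss ?L) \<partial>gauss ?K)"
    by (subst H.nn_integral_fst[symmetric]) (simp_all, intro borel_measurable_times_ennreal
        measurable_compose[OF measurable_fst nK] measurable_compose[OF measurable_snd nL])
  also have "\<dots> = (\<integral>\<^sup>+h. ennreal (vnorm (vec (n - b) h)) \<partial>gauss ?K) * (\<integral>\<^sup>+g. ennreal (vnorm (vec b g)) \<partial>gauss ?L)"
    by (simp add: nn_integral_cmult[OF nL] nn_integral_multc[OF nK])
  also have "\<dots> \<le> ennreal (sqrt (real (n - b))) * ennreal (sqrt (real b))"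
    by (intro mult_mono gauss_vnorm_le) auto
  finally have int: "(\<integral>\<^sup>+x. \<psi> x \<partial>gauss I) \<le> ennreal (4/5 / u) * (ennreal (sqrt (real (n - b))) * ennreal (sqrt (real b)))"
    by (simp add: mult_left_mono)
  define D where "D = {x\<in>space (gauss I). det (top_block n b x) = 0}"
  \<comment> \<open>25/9 is the reciprocal of the detection probability: outside \<open>D\<close>,
    every draw whose quotient has norm above \<open>C\<close> lies in \<open>M\<close>.\<close>
  define M where "M = {x\<in>space (gauss I). 1 \<le> ennreal (25/9) * \<psi> x}"
  have dm: "(\<lambda>x. det (top_block n b x)) \<in> borel_measurable (gauss I)"
    unfolding measurable_cong_sets[OF sets_gauss refl] I_def using b by (intro det_top_block_measurable) auto
  have D: "D \<in> sets (gauss I)" unfolding D_def by (intro borel_measurable_eq dm borel_measurable_const)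
  have Ms: "M \<in> sets (gauss I)" unfolding M_def using \<psi>m by measurable
  have "AE x in gauss I. det (top_block n b x) \<noteq> 0" unfolding I_def using b by (intro gauss_top_block_det_nonzero) auto
  hence "AE x in gauss I. x \<notin> D" by (rule AE_mp) (auto simp: D_def)
  hence pD: "GI.prob D = 0" using D GI.prob_eq_0 by blast
  have "emeasure (gauss I) M \<le> ennreal (25/9) * (\<integral>\<^sup>+x. \<psi> x \<partial>gauss I)"
  proof -
    have "emeasure (gauss I) M \<le> ennreal (25/9) * (\<integral>\<^sup>+x. \<psi> x * indicator (space (gauss I)) x \<partial>gauss I)"
      unfolding M_def by (intro nn_integral_Markov_inequality borel_measurable_times_ennreal \<psi>m
        borel_measurable_indicator sets.top)
    moreover have "(\<integral>\<^sup>+x. \<psi> x * indicator (space (gauss I)) x \<partial>gauss I) = (\<integral>\<^sup>+x. \<psi> x \<partial>gauss I)"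
      by (intro nn_integral_cong) simp
    ultimately show ?thesis by simp
  qed
  also have "\<dots> \<le> ennreal (25/9) * (ennreal (4/5 / u) * (ennreal (sqrt (real (n - b))) * ennreal (sqrt (real b))))"
    by (intro mult_left_mono int) simp
  also have "\<dots> = ennreal (25/9 * (4/5 / u * (sqrt (real (n - b)) * sqrt (real b))))"
  proof -
    have "ennreal (25/9 * (4/5 / u * (sqrt (real (n - b)) * sqrt (real b)))) =
        ennreal (25/9) * ennreal (4/5 / u * (sqrt (real (n - b)) * sqrt (real b)))"
      using u by (intro ennreal_mult) auto
    moreover have "ennreal (4/5 / u * (sqrt (real (n - b)) * sqrt (real b))) =
        ennreal (4/5 / u) * (ennreal (sqrt (real (n - b))) * ennreal (sqrt (real b)))"
      using u by (intro mult3) auto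
    ultimately show ?thesis by simp
  qed
  also have "\<dots> \<le> ennreal \<delta>"
  proof (rule ennreal_leI)
    have "9 * sqrt (real b * real (n - b)) \<le> \<delta> * C" using C \<delta> by (simp add: divide_le_eq mult.commute)
    hence "9 * (sqrt (real (n - b)) * sqrt (real b)) \<le> \<delta> * C" by (simp add: real_sqrt_mult mult.commute)
    moreover have "0 \<le> sqrt (real (n - b)) * sqrt (real b)" by simp
    \<comment> \<open>25/9 * 4/5 * 4 = 80/9, just below the factor 9 in the hypothesis on
      \<open>C\<close>.\<close>
    ultimately have "80/9 * (sqrt (real (n - b)) * sqrt (real b)) \<le> \<delta> * C" by linarith
    moreover have "25/9 * (4/5 / u * (sqrt (real (n - b)) * sqrt (real b))) = 80/9 * (sqrt (real (n - b)) * sqrt (real b)) / C"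
      by (simp add: u_def)
    ultimately show "25/9 * (4/5 / u * (sqrt (real (n - b)) * sqrt (real b))) \<le> \<delta>"
      using C0 by (simp only: divide_le_eq if_True)
  qed
  finally have pM: "GI.prob M \<le> \<delta>" using \<delta> by (simp add: GI.emeasure_eq_measure)
  define E where "E = space (gauss I) - (D \<union> M)"
  have E: "E \<in> sets (gauss I)" using D Ms by (auto simp: E_def)
  have "GI.prob (D \<union> M) \<le> \<delta>" using measure_Un_le[OF D Ms] pD pM by linarith
  hence "1 - \<delta> \<le> GI.prob E" unfolding E_def using GI.prob_compl[of "D \<union> M"] D Ms by auto
  moreover have "invertible_mat (top_block n b x) \<and> spec_norm (rows_from b (gauss_mat n b x) * mat_inv (top_block n b x)) \<le> C"
    if "x \<in> E" for x
  proof -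
    have x: "x \<in> space (gauss I)" and d0: "det (top_block n b x) \<noteq> 0" and nM: "\<not> 1 \<le> ennreal (25/9) * \<psi> x"
      using that by (auto simp: E_def D_def M_def)
    obtain L where L: "L \<in> carrier_mat b b" "top_block n b x * L = 1\<^sub>m b"
      using det_non_zero_imp_unit[OF top_block_carrier d0, of "()"] by (auto simp: Units_def ring_mat_def)
    have inv: "invertible_mat (top_block n b x)" by (rule invertible_mat_of_inverse[OF top_block_carrier L])
    note T = mat_inv_props[OF top_block_carrier inv]
    have "spec_norm (rows_from b (gauss_mat n b x) * mat_inv (top_block n b x)) \<le> C"
    proof (rule ccontr)
      assume "\<not> ?thesis"
      hence "ennreal (9/25) \<le> \<psi> x"
        unfolding \<psi>_def u_def using C0 by (intro form_exceeds_of_large_norm[OF b _ d0 T]) auto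
      hence "ennreal (25/9) * ennreal (9/25) \<le> ennreal (25/9) * \<psi> x" by (intro mult_left_mono) auto
      thus False using nM by (simp add: ennreal_mult[symmetric])
    qed
    thus ?thesis using inv by simp
  qed
  ultimately show ?thesis using E by blast
qed

text \<open>The good set is pulled back along multiplication by \<open>R\<close>, which preserves
  the Gaussian measure. In the application \<open>R\<close> is the transposed right singular basis
  of the deflated matrix.\<close>

lemma gauss_space_quotient_tail:
  assumes b: "0 < b" "b < n" and \<delta>: "0 < \<delta>" and C: "9 * sqrt (real b * real (n - b)) / \<delta> \<le> C"
    and R: "R \<in> carrier_mat n n" "orthonormal_cols R"
  shows "\<exists>E\<in>sets (gauss_space n b). 1 - \<delta> \<le> measure (gauss_space n b) E \<and> (\<forall>x\<in>E.
     invertible_mat (first_rows b (R * gauss_mat n b x)) \<and>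
     spec_norm (rows_from b (R * gauss_mat n b x) * mat_inv (first_rows b (R * gauss_mat n b x))) \<le> C)"
proof -
  let ?I = "{0..<n} \<times> {0..<b}"
  interpret GI: prob_space "gauss ?I" by (rule gauss_prob_space)
  obtain E where E: "E \<in> sets (gauss ?I)" "1 - \<delta> \<le> measure (gauss ?I) E"
    "\<And>x. x \<in> E \<Longrightarrow> invertible_mat (top_block n b x) \<and>
     spec_norm (rows_from b (gauss_mat n b x) * mat_inv (top_block n b x)) \<le> C"
    using gauss_quotient_tail[OF b \<delta> C] by blast
  let ?R = "\<lambda>x. unmat n b (R * gauss_mat n b x)"
  define F where "F = ?R -` E \<inter> space (gauss ?I)"
  have Rm: "?R \<in> gauss ?I \<rightarrow>\<^sub>M gauss ?I"
    unfolding measurable_cong_sets[OF sets_gauss sets_gauss] by (rule left_mult_measurable[OF R(1)])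
  have F: "F \<in> sets (gauss ?I)" unfolding F_def by (rule measurable_sets[OF Rm E(1)])
  have "emeasure (gauss ?I) F = (\<integral>\<^sup>+x. indicator E (?R x) \<partial>gauss ?I)"
    unfolding nn_integral_indicator[OF F, symmetric] by (intro nn_integral_cong) (auto simp: F_def indicator_def)
  also have "\<dots> = (\<integral>\<^sup>+x. indicator E x \<partial>gauss ?I)"
    using E(1) unfolding sets_gauss by (intro gauss_left_mult_invariant[OF R]) simp
  also have "\<dots> = emeasure (gauss ?I) E" using E(1) by simp
  finally have "measure (gauss ?I) F = measure (gauss ?I) E" by (simp add: measure_def)
  moreover have gm: "gauss_mat n b (?R x) = R * gauss_mat n b x" for x using R(1) by (intro gauss_mat_unmat) auto
  have "invertible_mat (first_rows b (R * gauss_mat n b x)) \<and>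
     spec_norm (rows_from b (R * gauss_mat n b x) * mat_inv (first_rows b (R * gauss_mat n b x))) \<le> C"
    if "x \<in> F" for x
    using E(3)[of "?R x"] that unfolding top_block_def gm by (simp add: F_def)
  ultimately show ?thesis unfolding gauss_space_eq using F E(2) by (intro bexI[of _ F]) auto
qed

section \<open>Deflated sketches\<close>

lemma transpose_mult_zero:
  fixes P Q :: "real mat"
  assumes Q: "Q \<in> carrier_mat p r" and P: "P \<in> carrier_mat p k"
    and z: "\<And>z. z \<in> colsp P \<Longrightarrow> Q\<^sup>T *\<^sub>v z = 0\<^sub>v r"
  shows "Q\<^sup>T * P = 0\<^sub>m r k"
proof (rule mat_eq_by_mult_vec[of _ r k])
  fix x :: "real vec" assume x: "x \<in> carrier_vec k"
  have QT: "Q\<^sup>T \<in> carrier_mat r p" using Q by simp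
  have "Q\<^sup>T * P *\<^sub>v x = Q\<^sup>T *\<^sub>v (P *\<^sub>v x)" by (rule assoc_mult_mat_vec[OF QT P x])
  also have "\<dots> = 0\<^sub>v r" using P x by (intro z) (auto simp: colsp_def)
  also have "\<dots> = 0\<^sub>m r k *\<^sub>v x" using x by (intro eq_vecI) auto
  finally show "Q\<^sup>T * P *\<^sub>v x = 0\<^sub>m r k *\<^sub>v x" .
qed (use Q P in auto)

text \<open>The range of \<open>B\<close> is orthogonal to \<open>Q\<close>, and B B^T maps this
  range into itself; the induction on \<open>q\<close> therefore runs over vectors already in the
  range of \<open>B\<close>.\<close>

lemma deflated_sketch_orthogonal:
  assumes Q: "Q \<in> carrier_mat m r" "orthonormal_cols Q" and A: "A \<in> carrier_mat m n"
    and B_def: "B = (1\<^sub>m m - Q * Q\<^sup>T) * A" and \<Omega>: "\<Omega> \<in> carrier_mat n b"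
    and z: "z \<in> colsp ((B * B\<^sup>T) ^\<^sub>m q * B * \<Omega>)"
  shows "Q\<^sup>T *\<^sub>v z = 0\<^sub>v r"
proof -
  have B: "B \<in> carrier_mat m n" using Q A by (auto simp: B_def)
  have BT: "B\<^sup>T \<in> carrier_mat n m" using B by simp
  have BBT: "B * B\<^sup>T \<in> carrier_mat m m" using B by auto
  have QB: "Q\<^sup>T *\<^sub>v (B *\<^sub>v x) = 0\<^sub>v r" if x: "x \<in> carrier_vec n" for x
  proof -
    have Ax: "A *\<^sub>v x \<in> carrier_vec m" using A x by auto
    have "B *\<^sub>v x = (1\<^sub>m m - Q * Q\<^sup>T) *\<^sub>v (A *\<^sub>v x)"
      unfolding B_def using Q(1) A x by (intro assoc_mult_mat_vec) auto
    thus ?thesis by (simp only: complement_mult_vec[OF Q(1) Ax] complement_orthogonal[OF Q Ax])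
  qed
  have pow: "Q\<^sup>T *\<^sub>v ((B * B\<^sup>T) ^\<^sub>m q *\<^sub>v (B *\<^sub>v x)) = 0\<^sub>v r" if "x \<in> carrier_vec n" for x
    using that
  proof (induction q arbitrary: x)
    case 0
    have "B *\<^sub>v x \<in> carrier_vec m" using B 0 by auto
    hence "(B * B\<^sup>T) ^\<^sub>m 0 *\<^sub>v (B *\<^sub>v x) = B *\<^sub>v x" using B by simp
    thus ?case by (simp only: QB[OF 0])
  next
    case (Suc q)
    have P: "(B * B\<^sup>T) ^\<^sub>m q \<in> carrier_mat m m" using BBT by (rule pow_carrier_mat)
    have Bx: "B *\<^sub>v x \<in> carrier_vec m" using B Suc.prems by auto
    have y: "B\<^sup>T *\<^sub>v (B *\<^sub>v x) \<in> carrier_vec n" using BT Bx by (rule mult_mat_vec_carrier)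
    have "(B * B\<^sup>T) ^\<^sub>m Suc q *\<^sub>v (B *\<^sub>v x) = (B * B\<^sup>T) ^\<^sub>m q *\<^sub>v (B * B\<^sup>T *\<^sub>v (B *\<^sub>v x))"
      unfolding pow_mat.simps by (rule assoc_mult_mat_vec[OF P BBT Bx])
    also have "B * B\<^sup>T *\<^sub>v (B *\<^sub>v x) = B *\<^sub>v (B\<^sup>T *\<^sub>v (B *\<^sub>v x))"
      by (rule assoc_mult_mat_vec[OF B BT Bx])
    finally show ?case by (simp only: Suc.IH[OF y])
  qed
  obtain x where x: "x \<in> carrier_vec b" "z = (B * B\<^sup>T) ^\<^sub>m q * B * \<Omega> *\<^sub>v x"
    using z \<Omega> by (auto simp: colsp_def)
  have P: "(B * B\<^sup>T) ^\<^sub>m q \<in> carrier_mat m m" using BBT by (rule pow_carrier_mat)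
  have PB: "(B * B\<^sup>T) ^\<^sub>m q * B \<in> carrier_mat m n" using P B by auto
  have Ox: "\<Omega> *\<^sub>v x \<in> carrier_vec n" using \<Omega> x(1) by auto
  have "z = (B * B\<^sup>T) ^\<^sub>m q *\<^sub>v (B *\<^sub>v (\<Omega> *\<^sub>v x))"
    unfolding x(2) by (simp only: assoc_mult_mat_vec[OF PB \<Omega> x(1)] assoc_mult_mat_vec[OF P B Ox])
  thus ?thesis by (simp only: pow[OF Ox])
qed

text \<open>Since Q^T P = 0, the product (I - P P^T) (I - Q Q^T) has no cross term. So the residual
  of \<open>A\<close> after the new block is a residual of the deflated matrix, and \<open>P\<close>
  compresses \<open>A\<close> and \<open>B\<close> to the same matrix. This transfers the sketch
  bounds from \<open>B\<close> to \<open>A\<close>.\<close>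

lemma hcat_deflation:
  assumes Q: "Q \<in> carrier_mat m r" and P: "P \<in> carrier_mat m k" and QP: "Q\<^sup>T * P = 0\<^sub>m r k"
    and A: "A \<in> carrier_mat m n" and B_def: "B = (1\<^sub>m m - Q * Q\<^sup>T) * A"
  shows "(1\<^sub>m m - hcat Q P * (hcat Q P)\<^sup>T) * A = (1\<^sub>m m - P * P\<^sup>T) * B" and "P\<^sup>T * A = P\<^sup>T * B"
proof -
  have B: "B \<in> carrier_mat m n" using Q A by (auto simp: B_def)
  have PT: "P\<^sup>T \<in> carrier_mat k m" and QT: "Q\<^sup>T \<in> carrier_mat r m" using P Q by auto
  have PQ: "P\<^sup>T * Q = 0\<^sub>m k r"
    using arg_cong[OF QP, of transpose_mat] Q P by (simp add: transpose_mult[of _ r m _ k])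
  have Bv: "B *\<^sub>v x = A *\<^sub>v x - Q *\<^sub>v (Q\<^sup>T *\<^sub>v (A *\<^sub>v x))" if x: "x \<in> carrier_vec n" for x
  proof -
    have Ax: "A *\<^sub>v x \<in> carrier_vec m" using A x by auto
    have "B *\<^sub>v x = (1\<^sub>m m - Q * Q\<^sup>T) *\<^sub>v (A *\<^sub>v x)"
      unfolding B_def using Q A x by (intro assoc_mult_mat_vec) auto
    thus ?thesis by (simp only: complement_mult_vec[OF Q Ax])
  qed
  have PB: "P\<^sup>T *\<^sub>v (B *\<^sub>v x) = P\<^sup>T *\<^sub>v (A *\<^sub>v x)" if x: "x \<in> carrier_vec n" for x
  proof -
    have Ax: "A *\<^sub>v x \<in> carrier_vec m" using A x by auto
    have c: "Q\<^sup>T *\<^sub>v (A *\<^sub>v x) \<in> carrier_vec r" using QT Ax by (rule mult_mat_vec_carrier)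
    have Qc: "Q *\<^sub>v (Q\<^sup>T *\<^sub>v (A *\<^sub>v x)) \<in> carrier_vec m" using Q c by (rule mult_mat_vec_carrier)
    have PA: "P\<^sup>T *\<^sub>v (A *\<^sub>v x) \<in> carrier_vec k" using PT Ax by (rule mult_mat_vec_carrier)
    have "P\<^sup>T *\<^sub>v (Q *\<^sub>v (Q\<^sup>T *\<^sub>v (A *\<^sub>v x))) = P\<^sup>T * Q *\<^sub>v (Q\<^sup>T *\<^sub>v (A *\<^sub>v x))"
      by (rule assoc_mult_mat_vec[OF PT Q c, symmetric])
    also have "\<dots> = 0\<^sub>v k" unfolding PQ using c by (intro eq_vecI) auto
    finally have z: "P\<^sup>T *\<^sub>v (Q *\<^sub>v (Q\<^sup>T *\<^sub>v (A *\<^sub>v x))) = 0\<^sub>v k" .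
    have "P\<^sup>T *\<^sub>v (B *\<^sub>v x) = P\<^sup>T *\<^sub>v (A *\<^sub>v x) - 0\<^sub>v k"
      unfolding Bv[OF x] by (simp only: mult_minus_distrib_mat_vec[OF PT Ax Qc] z)
    thus ?thesis using PA by simp
  qed
  show "P\<^sup>T * A = P\<^sup>T * B"
  proof (rule mat_eq_by_mult_vec[of _ k n])
    fix x :: "real vec" assume x: "x \<in> carrier_vec n"
    show "P\<^sup>T * A *\<^sub>v x = P\<^sup>T * B *\<^sub>v x"
      by (simp only: assoc_mult_mat_vec[OF PT A x] assoc_mult_mat_vec[OF PT B x] PB[OF x])
  qed (use PT A B in auto)
  let ?G = "Q * Q\<^sup>T" and ?L = "P * P\<^sup>T"
  have G: "?G \<in> carrier_mat m m" and L: "?L \<in> carrier_mat m m" using P Q by auto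
  show "(1\<^sub>m m - hcat Q P * (hcat Q P)\<^sup>T) * A = (1\<^sub>m m - ?L) * B"
    unfolding hcat_gram[OF Q P]
  proof (rule mat_eq_by_mult_vec[of _ m n])
    have c: "1\<^sub>m m - (?G + ?L) \<in> carrier_mat m m" "1\<^sub>m m - ?L \<in> carrier_mat m m"
      by (rule minus_carrier_mat[OF add_carrier_mat[OF L]], rule minus_carrier_mat[OF L])
    show "(1\<^sub>m m - (?G + ?L)) * A \<in> carrier_mat m n" "(1\<^sub>m m - ?L) * B \<in> carrier_mat m n"
      using c A B by auto
    fix x :: "real vec" assume x: "x \<in> carrier_vec n"
    define y where "y = A *\<^sub>v x"
    have y: "y \<in> carrier_vec m" using A x by (auto simp: y_def)
    have Bx: "B *\<^sub>v x \<in> carrier_vec m" using B x by auto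
    have Gy: "?G *\<^sub>v y = Q *\<^sub>v (Q\<^sup>T *\<^sub>v y)" by (rule assoc_mult_mat_vec[OF Q QT y])
    have Ly: "?L *\<^sub>v y = P *\<^sub>v (P\<^sup>T *\<^sub>v y)" by (rule assoc_mult_mat_vec[OF P PT y])
    have gc: "Q *\<^sub>v (Q\<^sup>T *\<^sub>v y) \<in> carrier_vec m" and lc: "P *\<^sub>v (P\<^sup>T *\<^sub>v y) \<in> carrier_vec m"
      using Q P QT PT y by (auto intro!: mult_mat_vec_carrier)
    have sub: "1\<^sub>m m *\<^sub>v y - (g + h) = y - g - h" if "g \<in> carrier_vec m" "h \<in> carrier_vec m" for g h
      using y that by (intro eq_vecI) auto
    have "(1\<^sub>m m - (?G + ?L)) * A *\<^sub>v x = (1\<^sub>m m - (?G + ?L)) *\<^sub>v y"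
      unfolding y_def by (rule assoc_mult_mat_vec[OF c(1) A x])
    also have "\<dots> = 1\<^sub>m m *\<^sub>v y - (?G + ?L) *\<^sub>v y"
      using G L y by (intro minus_mult_distrib_mat_vec[of _ m m]) auto
    also have "(?G + ?L) *\<^sub>v y = Q *\<^sub>v (Q\<^sup>T *\<^sub>v y) + P *\<^sub>v (P\<^sup>T *\<^sub>v y)"
      using add_mult_distrib_mat_vec[OF G L y] by (simp only: Gy Ly)
    also have "1\<^sub>m m *\<^sub>v y - (Q *\<^sub>v (Q\<^sup>T *\<^sub>v y) + P *\<^sub>v (P\<^sup>T *\<^sub>v y))
        = (y - Q *\<^sub>v (Q\<^sup>T *\<^sub>v y)) - P *\<^sub>v (P\<^sup>T *\<^sub>v y)"
      by (rule sub[OF gc lc])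
    also have "\<dots> = B *\<^sub>v x - P *\<^sub>v (P\<^sup>T *\<^sub>v (B *\<^sub>v x))"
      by (simp only: PB[OF x]) (simp only: Bv[OF x] y_def)
    also have "\<dots> = (1\<^sub>m m - ?L) *\<^sub>v (B *\<^sub>v x)" by (rule complement_mult_vec[OF P Bx, symmetric])
    also have "\<dots> = (1\<^sub>m m - ?L) * B *\<^sub>v x" by (rule assoc_mult_mat_vec[OF c(2) B x, symmetric])
    finally show "(1\<^sub>m m - (?G + ?L)) * A *\<^sub>v x = (1\<^sub>m m - ?L) * B *\<^sub>v x" .
  qed
qed

lemma vnorm_transpose_orthonormal_le:
  assumes "P \<in> carrier_mat m k" "orthonormal_cols P" "x \<in> carrier_vec m"
  shows "vnorm (P\<^sup>T *\<^sub>v x) \<le> vnorm x"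
proof (rule power2_le_imp_le)
  have "0 \<le> (vnorm (x - P *\<^sub>v (P\<^sup>T *\<^sub>v x)))\<^sup>2" by simp
  thus "(vnorm (P\<^sup>T *\<^sub>v x))\<^sup>2 \<le> (vnorm x)\<^sup>2" unfolding orthonormal_cols_complement_sq[OF assms] by simp
qed simp

theorem theorem3p6:
  fixes sbl :: bool
    and A U S V Qp B Ut St Vt :: "real mat"
    and m n b q l :: nat
    and eps :: real
  assumes A_dim: "A \<in> carrier_mat m n"
    and mn: "n \<le> m"
    and svdA: "is_svd A U S V"
    and b_pos: "0 < b"
    and l_ge: "2 \<le> l"
    and run: "blarank_run sbl A b q (l - 1) Qp"
    and Qp_dim: "dim_col Qp = b * (l - 1)"
    and B_def: "B = (1\<^sub>m m - Qp * Qp\<^sup>T) * A"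
    and svdB: "is_svd B Ut St Vt"
    and eps_def: "eps = subspace_dist Qp (first_cols (b * (l - 1)) U)"
    and eps_lt: "eps < 1"
    and gap: "sval A (b * l) - sval A (b * l + 1) > 2 * eps * spec_norm A"
  shows
   "\<comment> \<open>(i)\<close>
    (\<forall>j. 1 \<le> j \<and> j \<le> n - b * (l - 1) \<longrightarrow>
        \<bar>sval B j - sval A (b * (l - 1) + j)\<bar> \<le> eps * spec_norm A) \<and>
    (\<forall>j. n - b * (l - 1) + 1 \<le> j \<and> j \<le> n \<longrightarrow> sval B j \<le> eps * spec_norm A) \<and>
    \<comment> \<open>(ii)\<close>
    sval B (b + 1) / sval B b
      \<le> (sval A (b * l + 1) + eps * spec_norm A) / (sval A (b * l) - eps * spec_norm A) \<and>
    (sval A (b * l + 1) + eps * spec_norm A) / (sval A (b * l) - eps * spec_norm A) < 1 \<and>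
    \<comment> \<open>(iii)\<close>
    (\<forall>delta::real. 0 < delta \<and> delta < 1 \<longrightarrow>
      (\<exists>E \<in> sets (gauss_space n b). measure (gauss_space n b) E \<ge> 1 - delta \<and>
        E \<subseteq> {\<omega> \<in> space (gauss_space n b).
          (let \<Omega> = gauss_mat n b \<omega>;
               Ot = Vt\<^sup>T * \<Omega>;
               O1 = first_rows b Ot;
               O2 = rows_from b Ot;
               Ql = orth ((B * B\<^sup>T) ^\<^sub>m q * B * \<Omega>);
               Qf = hcat Qp Ql;
               P = 1\<^sub>m m - Qf * Qf\<^sup>T;
               tau = sval B (b + 1) / sval B b;
               C = 2 * exp 1 * sqrt (real b) * (2 / delta) *
                     (sqrt (real (n - b)) + sqrt (real b) + sqrt (2 * ln (2 / delta)));
               Sperp = trailing_block b St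
           in invertible_mat O1 \<and>
              spec_norm (P * A)
                \<le> sqrt (1 + tau ^ (4 * q) * (spec_norm (O2 * mat_inv O1))\<^sup>2) * spec_norm Sperp \<and>
              sqrt (1 + tau ^ (4 * q) * (spec_norm (O2 * mat_inv O1))\<^sup>2) * spec_norm Sperp
                \<le> sqrt (1 + tau ^ (4 * q) * C\<^sup>2) * spec_norm Sperp \<and>
              frob_norm (P * A)
                \<le> sqrt (1 + tau ^ (4 * q) * (spec_norm (O2 * mat_inv O1))\<^sup>2) * frob_norm Sperp \<and>
              sqrt (1 + tau ^ (4 * q) * (spec_norm (O2 * mat_inv O1))\<^sup>2) * frob_norm Sperp
                \<le> sqrt (1 + tau ^ (4 * q) * C\<^sup>2) * frob_norm Sperp)})) \<and>
    \<comment> \<open>(iv)\<close>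
    (\<forall>\<Omega> \<in> carrier_mat n b.
      (let Ot = Vt\<^sup>T * \<Omega>;
           O1 = first_rows b Ot;
           O2 = rows_from b Ot;
           Ql = orth ((B * B\<^sup>T) ^\<^sub>m q * B * \<Omega>)
       in invertible_mat O1 \<longrightarrow>
          (\<forall>j. 1 \<le> j \<and> j \<le> b \<longrightarrow>
             sval (Ql\<^sup>T * A) j \<le> sval B j \<and>
             sval B j / sqrt (1 + (spec_norm O2)\<^sup>2 * (spec_norm (mat_inv O1))\<^sup>2 *
                               (sval B (b + 1) / sval B j) ^ (4 * q + 2))
               \<le> sval (Ql\<^sup>T * A) j)))"
proof -
  define r where "r = b * (l - 1)"
  define e where "e = eps * spec_norm A"
  have bl: "b * l = r + b" using l_ge by (cases l) (auto simp: r_def)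
  \<comment> \<open>This is where \<open>l \<ge> 2\<close> enters; it later gives
    \<open>b < n\<close>, so that the lower block of the rotated Gaussian matrix is
    nonempty.\<close>
  have rb: "b \<le> r" using l_ge by (cases l) (auto simp: r_def)
  have eps0: "0 \<le> eps" by (simp add: eps_def subspace_dist_def)
  have e0: "0 \<le> e" using eps0 by (simp add: e_def)
  have gap': "2 * e < sval A (r + b) - sval A (r + b + 1)" using gap by (simp add: e_def bl mult.assoc)
  \<comment> \<open>The gap makes this singular value positive; as \<open>sval\<close> is 0 out of
    range, the dimension bound \<open>r + b \<le> n\<close> follows.\<close>
  have posA: "0 < sval A (r + b)" using gap' e0 sval_nonneg[of A "r + b + 1"] by linarith
  have rbn: "r + b \<le> n"
  proof (rule ccontr)
    assume "\<not> r + b \<le> n"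
    hence "sval A (r + b) = 0" using A_dim by (simp add: sval_def)
    thus False using posA by simp
  qed
  have bn: "b < n" using rbn rb b_pos by simp
  have Q: "Qp \<in> carrier_mat m r" "orthonormal_cols Qp"
    using blarank_run_orthonormal[OF run] A_dim Qp_dim by (auto simp: r_def)
  have B: "B \<in> carrier_mat m n" using Q A_dim by (auto simp: B_def)
  have up: "sval B j \<le> sval A (r + j) + e" if "1 \<le> j" for j
    unfolding B_def e_def using rbn eps_def eps_lt that
    by (intro sval_deflate_le[OF A_dim mn svdA Q]) (auto simp: r_def)
  have low: "sval A (r + j) \<le> sval B j" if "1 \<le> j" for j
    unfolding B_def by (rule sval_deflate_ge[OF A_dim Q(1) that])
  have i1: "\<bar>sval B j - sval A (r + j)\<bar> \<le> e" if "1 \<le> j" for j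
    using up[OF that] low[OF that] e0 by linarith
  \<comment> \<open>Here \<open>r + j\<close> exceeds \<open>n\<close>, so the singular value of
    \<open>A\<close> takes its default 0 and only the error term remains.\<close>
  have i2: "sval B j \<le> e" if "n - r + 1 \<le> j" for j
  proof -
    have "\<not> r + j \<le> min (dim_row A) (dim_col A)" using that A_dim by auto
    hence "sval A (r + j) = 0" unfolding sval_def by (simp only: if_False simp_thms)
    thus ?thesis using up[of j] that by simp
  qed
  have Bb: "sval A (r + b) \<le> sval B b" using low[of b] b_pos by simp
  \<comment> \<open>Deflation does not lower the shifted singular values, so the denominator bound
    holds even before \<open>e\<close> is subtracted.\<close>
  have ii1: "sval B (b + 1) / sval B b \<le> (sval A (r + b + 1) + e) / (sval A (r + b) - e)"
    using up[of "b + 1"] Bb gap' e0 sval_nonneg[of A "r + b + 1"] by (intro frac_le) (auto simp: add.assoc)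
  have ii2: "(sval A (r + b + 1) + e) / (sval A (r + b) - e) < 1"
    using gap' e0 sval_nonneg[of A "r + b + 1"] by (subst divide_less_eq_1_pos) auto
  \<comment> \<open>\<open>sval\<close> counts from 1 and \<open>d\<close> from 0, so
    \<open>d (b - 1)\<close> and \<open>d b\<close> are the values on the two sides of the
    gap.\<close>
  define d where "d = svd_diag St"
  have dS: "sval B (Suc i) = d i" for i unfolding d_def by (rule sval_eq_svd_diag[OF svdB])
  have dj: "sval B j = d (j - 1)" if "1 \<le> j" for j using dS[of "j - 1"] that by simp
  have dpos: "0 < svd_diag St (b - 1)" using dj[of b] Bb posA b_pos by (simp add: d_def)
  have d_b: "sval B (b + 1) = d b" using dS[of b] by simp
  note D = is_svdD[OF svdB B]
  have VT: "Vt\<^sup>T \<in> carrier_mat n n" "orthonormal_cols (Vt\<^sup>T)"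
    using D(3) orthogonal_mat_transpose(2)[OF D(3,4)] by auto
  have sketch: "dim_row (orth ((B * B\<^sup>T) ^\<^sub>m q * B * \<Omega>)) = m"
    "orthonormal_cols (orth ((B * B\<^sup>T) ^\<^sub>m q * B * \<Omega>))"
    "colsp (orth ((B * B\<^sup>T) ^\<^sub>m q * B * \<Omega>)) = colsp ((B * B\<^sup>T) ^\<^sub>m q * B * \<Omega>)"
    "Qp\<^sup>T * orth ((B * B\<^sup>T) ^\<^sub>m q * B * \<Omega>) = 0\<^sub>m r (dim_col (orth ((B * B\<^sup>T) ^\<^sub>m q * B * \<Omega>)))"
    if \<Omega>: "\<Omega> \<in> carrier_mat n b" for \<Omega>
  proof -
    let ?Y = "(B * B\<^sup>T) ^\<^sub>m q * B * \<Omega>"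
    have "(B * B\<^sup>T) ^\<^sub>m q \<in> carrier_mat m m" using B by (intro pow_carrier_mat) auto
    hence Y: "dim_row ?Y = m" using B by simp
    show dr: "dim_row (orth ?Y) = m" unfolding orth_props(1) by (rule Y)
    show "orthonormal_cols (orth ?Y)" "colsp (orth ?Y) = colsp ?Y" by (rule orth_props)+
    show "Qp\<^sup>T * orth ?Y = 0\<^sub>m r (dim_col (orth ?Y))"
    proof (rule transpose_mult_zero[OF Q(1)])
      show "orth ?Y \<in> carrier_mat m (dim_col (orth ?Y))" using dr by (intro carrier_matI) auto
      fix z assume "z \<in> colsp (orth ?Y)"
      thus "Qp\<^sup>T *\<^sub>v z = 0\<^sub>v r"
        unfolding orth_props(3) by (rule deflated_sketch_orthogonal[OF Q A_dim B_def \<Omega>])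
    qed
  qed
  have iii: "\<exists>E \<in> sets (gauss_space n b). measure (gauss_space n b) E \<ge> 1 - delta \<and>
        E \<subseteq> {\<omega> \<in> space (gauss_space n b).
          (let \<Omega> = gauss_mat n b \<omega>;
               Ot = Vt\<^sup>T * \<Omega>;
               O1 = first_rows b Ot;
               O2 = rows_from b Ot;
               Ql = orth ((B * B\<^sup>T) ^\<^sub>m q * B * \<Omega>);
               Qf = hcat Qp Ql;
               P = 1\<^sub>m m - Qf * Qf\<^sup>T;
               tau = sval B (b + 1) / sval B b;
               C = 2 * exp 1 * sqrt (real b) * (2 / delta) *
                     (sqrt (real (n - b)) + sqrt (real b) + sqrt (2 * ln (2 / delta)));
               Sperp = trailing_block b St
           in invertible_mat O1 \<and>
              spec_norm (P * A)
                \<le> sqrt (1 + tau ^ (4 * q) * (spec_norm (O2 * mat_inv O1))\<^sup>2) * spec_norm Sperp \<and>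
              sqrt (1 + tau ^ (4 * q) * (spec_norm (O2 * mat_inv O1))\<^sup>2) * spec_norm Sperp
                \<le> sqrt (1 + tau ^ (4 * q) * C\<^sup>2) * spec_norm Sperp \<and>
              frob_norm (P * A)
                \<le> sqrt (1 + tau ^ (4 * q) * (spec_norm (O2 * mat_inv O1))\<^sup>2) * frob_norm Sperp \<and>
              sqrt (1 + tau ^ (4 * q) * (spec_norm (O2 * mat_inv O1))\<^sup>2) * frob_norm Sperp
                \<le> sqrt (1 + tau ^ (4 * q) * C\<^sup>2) * frob_norm Sperp)}"
    if delta: "0 < delta" "delta < 1" for delta :: real
  proof -
    define C where "C = 2 * exp 1 * sqrt (real b) * (2 / delta) *
      (sqrt (real (n - b)) + sqrt (real b) + sqrt (2 * ln (2 / delta)))"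
    have "0 \<le> sqrt (2 * ln (2 / delta))" using delta by simp
    hence s: "sqrt (real (n - b)) \<le> sqrt (real (n - b)) + sqrt (real b) + sqrt (2 * ln (2 / delta))" by simp
    \<comment> \<open>9 = 2 * (9/4) * 2, with 9/4 a lower bound for e; of the bracket in
      \<open>C\<close> only sqrt(n - b) is kept.\<close>
    have "9 * sqrt (real b * real (n - b)) / delta = 2 * (9/4) * sqrt (real b) * (2 / delta) * sqrt (real (n - b))"
      unfolding real_sqrt_mult by (simp add: mult_ac)
    also have "\<dots> \<le> C" unfolding C_def
      using exp_1_ge s delta by (intro mult_mono) auto
    finally have CC: "9 * sqrt (real b * real (n - b)) / delta \<le> C" .
    have "0 \<le> 9 * sqrt (real b * real (n - b)) / delta" using delta by simp
    hence C0: "0 \<le> C" using CC by linarith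
    obtain E where E: "E \<in> sets (gauss_space n b)" "1 - delta \<le> measure (gauss_space n b) E"
      "\<And>x. x \<in> E \<Longrightarrow> invertible_mat (first_rows b (Vt\<^sup>T * gauss_mat n b x)) \<and>
        spec_norm (rows_from b (Vt\<^sup>T * gauss_mat n b x) * mat_inv (first_rows b (Vt\<^sup>T * gauss_mat n b x))) \<le> C"
      using gauss_space_quotient_tail[OF b_pos bn delta(1) CC VT] by blast
    show ?thesis
    proof (intro bexI[of _ E] conjI subsetI CollectI E(1,2))
      fix \<omega> assume \<omega>: "\<omega> \<in> E"
      show "\<omega> \<in> space (gauss_space n b)" using \<omega> E(1) sets.sets_into_space by blast
      let ?\<Omega> = "gauss_mat n b \<omega>"
      let ?O1 = "first_rows b (Vt\<^sup>T * ?\<Omega>)" and ?O2 = "rows_from b (Vt\<^sup>T * ?\<Omega>)"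
      let ?Ql = "orth ((B * B\<^sup>T) ^\<^sub>m q * B * ?\<Omega>)"
      have Ot: "Vt\<^sup>T * ?\<Omega> \<in> carrier_mat n b" using VT(1) by auto
      have inv: "invertible_mat ?O1" using E(3)[OF \<omega>] by simp
      note T = mat_inv_props[OF first_rows_carrier[OF Ot] inv]
      note sk = sketch[OF gauss_mat_carrier[of n b \<omega>]]
      have Ql: "?Ql \<in> carrier_mat m (dim_col ?Ql)" using sk(1) by (intro carrier_matI) auto
      note PA = hcat_deflation(1)[OF Q(1) Ql sk(4) A_dim B_def]
      note bounds = sketch_error_bounds[OF B mn svdB b_pos less_imp_le[OF bn] gauss_mat_carrier[of n b \<omega>]
          T refl dpos refl refl Ql sk(2,3), folded d_def PA, folded dj[of b, OF Suc_leI[OF b_pos, folded One_nat_def]] d_b]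
      have mono: "sqrt (1 + (sval B (b + 1) / sval B b) ^ (4 * q) * (spec_norm (?O2 * mat_inv ?O1))\<^sup>2)
        \<le> sqrt (1 + (sval B (b + 1) / sval B b) ^ (4 * q) * C\<^sup>2)"
        using E(3)[OF \<omega>] by (intro real_sqrt_le_mono add_left_mono mult_left_mono power_mono)
          (auto simp: sval_nonneg)
      show "let \<Omega> = gauss_mat n b \<omega>;
               Ot = Vt\<^sup>T * \<Omega>;
               O1 = first_rows b Ot;
               O2 = rows_from b Ot;
               Ql = orth ((B * B\<^sup>T) ^\<^sub>m q * B * \<Omega>);
               Qf = hcat Qp Ql;
               P = 1\<^sub>m m - Qf * Qf\<^sup>T;
               tau = sval B (b + 1) / sval B b;
               C = 2 * exp 1 * sqrt (real b) * (2 / delta) *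
                     (sqrt (real (n - b)) + sqrt (real b) + sqrt (2 * ln (2 / delta)));
               Sperp = trailing_block b St
           in invertible_mat O1 \<and>
              spec_norm (P * A)
                \<le> sqrt (1 + tau ^ (4 * q) * (spec_norm (O2 * mat_inv O1))\<^sup>2) * spec_norm Sperp \<and>
              sqrt (1 + tau ^ (4 * q) * (spec_norm (O2 * mat_inv O1))\<^sup>2) * spec_norm Sperp
                \<le> sqrt (1 + tau ^ (4 * q) * C\<^sup>2) * spec_norm Sperp \<and>
              frob_norm (P * A)
                \<le> sqrt (1 + tau ^ (4 * q) * (spec_norm (O2 * mat_inv O1))\<^sup>2) * frob_norm Sperp \<and>
              sqrt (1 + tau ^ (4 * q) * (spec_norm (O2 * mat_inv O1))\<^sup>2) * frob_norm Sperp
                \<le> sqrt (1 + tau ^ (4 * q) * C\<^sup>2) * frob_norm Sperp"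
        unfolding Let_def C_def[symmetric]
        by (intro conjI inv bounds mult_right_mono mono spec_norm_nonneg frob_norm_nonneg)
    qed
  qed
  have iv: "(let Ot = Vt\<^sup>T * \<Omega>;
           O1 = first_rows b Ot;
           O2 = rows_from b Ot;
           Ql = orth ((B * B\<^sup>T) ^\<^sub>m q * B * \<Omega>)
       in invertible_mat O1 \<longrightarrow>
          (\<forall>j. 1 \<le> j \<and> j \<le> b \<longrightarrow>
             sval (Ql\<^sup>T * A) j \<le> sval B j \<and>
             sval B j / sqrt (1 + (spec_norm O2)\<^sup>2 * (spec_norm (mat_inv O1))\<^sup>2 *
                               (sval B (b + 1) / sval B j) ^ (4 * q + 2))
               \<le> sval (Ql\<^sup>T * A) j))" if \<Omega>: "\<Omega> \<in> carrier_mat n b" for \<Omega>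
    unfolding Let_def
  proof (intro impI allI)
    let ?O1 = "first_rows b (Vt\<^sup>T * \<Omega>)" and ?O2 = "rows_from b (Vt\<^sup>T * \<Omega>)"
    let ?Ql = "orth ((B * B\<^sup>T) ^\<^sub>m q * B * \<Omega>)"
    fix j assume inv: "invertible_mat ?O1" and j: "1 \<le> j \<and> j \<le> b"
    have Ot: "Vt\<^sup>T * \<Omega> \<in> carrier_mat n b" using VT(1) \<Omega> by auto
    have O2: "?O2 \<in> carrier_mat (n - b) b" by (rule rows_from_carrier[OF Ot])
    note T = mat_inv_props[OF first_rows_carrier[OF Ot] inv]
    note sk = sketch[OF \<Omega>]
    have Ql: "?Ql \<in> carrier_mat m (dim_col ?Ql)" using sk(1) by (intro carrier_matI) auto
    have QlT: "?Ql\<^sup>T \<in> carrier_mat (dim_col ?Ql) m"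
      by (rule carrier_matI) (simp_all only: index_transpose_mat(2,3) sk(1))
    note QA = hcat_deflation(2)[OF Q(1) Ql sk(4) A_dim B_def]
    \<comment> \<open>Multiplying by the transpose of a matrix with orthonormal columns never
      lengthens a vector.\<close>
    have "sval (?Ql\<^sup>T * B) j \<le> sval B j"
    proof (rule sval_le_of_vnorm_le[OF _ B])
      show "?Ql\<^sup>T * B \<in> carrier_mat (dim_col ?Ql) n" using QlT B by (rule mult_carrier_mat)
      fix x :: "real vec" assume x: "x \<in> carrier_vec n"
      have Bx: "B *\<^sub>v x \<in> carrier_vec m" using B x by auto
      show "vnorm (?Ql\<^sup>T * B *\<^sub>v x) \<le> vnorm (B *\<^sub>v x)"
        unfolding assoc_mult_mat_vec[OF QlT B x] by (rule vnorm_transpose_orthonormal_le[OF Ql sk(2) Bx])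
    qed (use j in simp)
    moreover have "sval B j / sqrt (1 + (spec_norm ?O2)\<^sup>2 * (spec_norm (mat_inv ?O1))\<^sup>2 *
                               (sval B (b + 1) / sval B j) ^ (4 * q + 2)) \<le> sval (?Ql\<^sup>T * B) j"
    proof -
      let ?x = "(sval B (b + 1) / sval B j) ^ (4 * q + 2)"
      have x0: "0 \<le> ?x" by (intro zero_le_power divide_nonneg_nonneg sval_nonneg)
      \<comment> \<open>The claim separates the norms of the two factors; submultiplicativity
        enlarges the denominator and so weakens the bound already available for their
        product.\<close>
      have "spec_norm (?O2 * mat_inv ?O1) \<le> spec_norm ?O2 * spec_norm (mat_inv ?O1)"
        by (rule spec_norm_mult[OF O2 T(1)])
      hence "(spec_norm (?O2 * mat_inv ?O1))\<^sup>2 \<le> (spec_norm ?O2 * spec_norm (mat_inv ?O1))\<^sup>2"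
        by (intro power_mono spec_norm_nonneg)
      hence sq: "(spec_norm (?O2 * mat_inv ?O1))\<^sup>2 \<le> (spec_norm ?O2)\<^sup>2 * (spec_norm (mat_inv ?O1))\<^sup>2"
        by (simp only: power_mult_distrib)
      have "sqrt (1 + (spec_norm (?O2 * mat_inv ?O1))\<^sup>2 * ?x) \<le>
        sqrt (1 + (spec_norm ?O2)\<^sup>2 * (spec_norm (mat_inv ?O1))\<^sup>2 * ?x)"
        by (intro real_sqrt_le_mono add_left_mono mult_right_mono sq x0)
      moreover have "0 < sqrt (1 + (spec_norm (?O2 * mat_inv ?O1))\<^sup>2 * ?x)"
        by (intro real_sqrt_gt_zero add_pos_nonneg mult_nonneg_nonneg zero_le_power2 x0) simp
      ultimately have "sval B j / sqrt (1 + (spec_norm ?O2)\<^sup>2 * (spec_norm (mat_inv ?O1))\<^sup>2 * ?x)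
        \<le> sval B j / sqrt (1 + (spec_norm (?O2 * mat_inv ?O1))\<^sup>2 * ?x)"
        using frac_le[OF sval_nonneg order_refl] by blast
      also have "\<dots> \<le> sval (?Ql\<^sup>T * B) j"
        by (rule sketch_sval_lower[OF B mn svdB b_pos less_imp_le[OF bn] \<Omega> T refl dpos refl refl Ql sk(2,3)
            conjunct1[OF j] conjunct2[OF j], folded d_def, folded dj[OF conjunct1[OF j]] d_b])
      finally show ?thesis .
    qed
    ultimately show "sval (?Ql\<^sup>T * A) j \<le> sval B j \<and>
             sval B j / sqrt (1 + (spec_norm ?O2)\<^sup>2 * (spec_norm (mat_inv ?O1))\<^sup>2 *
                               (sval B (b + 1) / sval B j) ^ (4 * q + 2))
               \<le> sval (?Ql\<^sup>T * A) j" unfolding QA by (rule conjI)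
  qed
  show ?thesis
    unfolding bl r_def[symmetric] e_def[symmetric]
    apply (intro conjI allI impI ballI)
         apply (rule i1, erule conjunct1)
        apply (rule i2, erule conjunct1)
       apply (rule ii1)
      apply (rule ii2)
     apply (erule conjE, rule iii, assumption, assumption)
    apply (rule iv, assumption)
    done
qed

end
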